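(* Let $K$ be a connected Poisson-Lie group, $H\subset K$ a connected Poisson-Lie subgroup with Lie algebra $\mathfrak h$, and let $\mathfrak k=\mathfrak h+\mathfrak m$ be a vector space direct sum such that, with $\mathfrak h^*:=\mathfrak m^\perp$ and $\mathfrak m^*:=\mathfrak h^\perp$ in $\mathfrak k^*$: $\mathfrak h^*\subset\mathfrak k^*$ is a Lie subalgebra, $\mathfrak h^\perp\subset\mathfrak k^*$ is a Lie ideal, and $[\mathfrak h,\mathfrak m]\subset\mathfrak m$. Let $H^*\subset K^*$ be the connected Lie subgroup with Lie algebra $\mathfrak h^*$. Let $\{M^i\}$ be a basis of $\mathfrak m$, and consider a submanifold $\check H^*\subset K^*$ (an open submanifold of $H^*$) defined locally by the constraints $\xi_{M^i}=0$, where, for $M\in\mathfrak m$, $\xi_M(\lambda e^\mu):=\langle\mu,M\rangle$ for $\lambda\in H^*$ and $\mu$ in a neighbourhood of zero in $\mathfrak m^*$. Then the Poisson brackets of the constraints are given by $$C^{ij}(\lambda):=\{\xi_{M^i},\xi_{M^j}\}_{K^*}(\lambda)=\langle\langle(\lambda M^j\lambda^{-1})_{\mathfrak m^*},(\lambda M^i\lambda^{-1})_{\mathfrak m}\rangle\rangle\qquad(\lambda\in\check H^* ).$$ If the matrix $C^{ij}(\lambda)$ is non-degenerate for $\lambda\in\check H^*$, then the Dirac reduction of $(K^*,\{\ ,\ \}_{K^*})$ yields $(\check H^*,\{\ ,\ \}_{\check H^*})$; that is, the Dirac bracket on $\check H^*$ coincides with the restriction to $\check H^*$ of the Poisson bracket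 $\{\ ,\ \}_{H^*}$ of the dual Poisson-Lie group $H^*$ of $H$.
   Context: **Drinfeld double.** $K^*$ is the dual Poisson-Lie group of $K$, with Lie algebra $\mathfrak k^*$, where $\mathfrak k$ is the Lie algebra of $K$. $\mathcal D(\mathfrak k,\mathfrak k^* )=\mathfrak k+\mathfrak k^*$ is the Drinfeld double Lie algebra with its invariant scalar product $\langle\langle\ ,\ \rangle\rangle$ ($\mathfrak k$ and $\mathfrak k^*$ are isotropic and paired by the canonical pairing $\langle\ ,\ \rangle$). $D(K,K^* )$ is the Drinfeld double Lie group, containing $K$ and $K^*$ as Lie subgroups. For $\kappa\in K^*$ and $X\in\mathcal D(\mathfrak k,\mathfrak k^* )$, $\kappa X\kappa^{-1}$ means $\mathrm{Ad}_\kappa X$ in $D(K,K^* )$. For a subspace $V\subset\mathfrak k$, $V^\perp=\{\alpha\in\mathfrak k^*\mid\langle\alpha,X\rangle=0\ \forall X\in V\}$. In the decomposition $\mathcal D(\mathfrak k,\mathfrak k^* )=\mathfrak h+\mathfrak m+\mathfrak h^*+\mathfrak m^*$ a subscript such as $(\,\cdot\,)_{\mathfrak m}$ or $(\,\cdot\,)_{\mathfrak m^*}$ denotes the corresponding component. **Poisson brackets.** For a function $f$ on $K^*$, $\nabla_\kappa f,\nabla'_\kappa f\in\mathfrak k=(\mathfrak k^* )^*$ are defined by $\langle\nabla_\kappa f,X\rangle=\frac{d}{dt}f(e^{tX}\kappa)|_{t=0}$ and $\langle\nabla'_\kappa f,X\rangle=\frac{d}{dt}f(\kappa e^{tX})|_{t=0}$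 for $X\in\mathfrak k^*$. The Poisson bracket on $K^*$ is $\{f_1,f_2\}_{K^*}(\kappa)=\langle\langle\nabla_\kappa f_1,\kappa(\nabla'_\kappa f_2)\kappa^{-1}\rangle\rangle$. The dual Poisson-Lie group $H^*$ of $H$ is identified with the connected subgroup of $K^*$ with Lie algebra $\mathfrak h^*=\mathfrak m^\perp\cong\mathfrak k^*/\mathfrak h^\perp$, and $\{\ ,\ \}_{H^*}$ is given by the same formula, with gradients in $\mathfrak h=(\mathfrak h^* )^*$ and the double $\mathcal D(\mathfrak h,\mathfrak h^* )=\mathfrak h+\mathfrak h^*$. **Dirac reduction.** Let a submanifold $N$ of a Poisson manifold $P$ be given locally by $\xi_i=0$ with independent functions $\xi_i$, and suppose $C^{ij}=\{\xi_i,\xi_j\}_P$ is invertible on $N$. The Dirac bracket on $N$ is $\{F_1,F_2\}^*=\{f_1,f_2\}_P-\sum_{i,j}\{f_1,\xi_i\}_P(C^{-1})_{ij}\{\xi_j,f_2\}_P$ restricted to $N$, where $f_n$ is any local extension of $F_n$ to $P$. The Dirac reduction of $P$ is $N$ with this bracket. *)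

theory Defs
  imports "HOL-Analysis.Analysis" "HOL-Algebra.Group"
begin

section \<open>Smooth manifolds\<close>

text \<open>\<open>Ck n S f\<close>: all partial derivatives of order at most \<open>n\<close> of \<open>f\<close> exist, are differentiable
  below order \<open>n\<close>, and are continuous on the open set \<open>S\<close>.\<close>

fun Ck :: "nat \<Rightarrow> 'e::euclidean_space set \<Rightarrow> ('e \<Rightarrow> 'f::euclidean_space) \<Rightarrow> bool" where
  "Ck 0 S f \<longleftrightarrow> continuous_on S f"
| "Ck (Suc n) S f \<longleftrightarrow> (\<forall>x\<in>S. f differentiable at x) \<and>
     (\<forall>v. Ck n S (\<lambda>x. frechet_derivative f (at x) v))"

text \<open>Smoothness on an arbitrary subset: local extendability to a smooth function of the ambient
  space. It is used for relatively open subsets of linear subspaces.\<close>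

definition smooth_on :: "'e::euclidean_space set \<Rightarrow> ('e \<Rightarrow> 'f::euclidean_space) \<Rightarrow> bool" where
  "smooth_on S f \<longleftrightarrow> (\<forall>x\<in>S. \<exists>U g. open U \<and> x \<in> U \<and> (\<forall>n. Ck n U g) \<and> (\<forall>y\<in>U \<inter> S. g y = f y))"

text \<open>Charts take values in relatively open subsets of a linear subspace \<open>model\<close> of a Euclidean
  space, so that manifolds of different dimensions, including dimension 0, can share one type.\<close>

record ('a, 'e) mfd =
  model :: "'e set"
  charts :: "('a set \<times> ('a \<Rightarrow> 'e)) set"

definition points :: "('a, 'e) mfd \<Rightarrow> 'a set" where
  "points M = (\<Union>(U, \<phi>)\<in>charts M. U)"

definition mfd_top :: "('a, 'e::euclidean_space) mfd \<Rightarrow> 'a topology" where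
  "mfd_top M = topology_generated_by
     {W. \<exists>(U, \<phi>)\<in>charts M. W \<subseteq> U \<and> openin (top_of_set (model M)) (\<phi> ` W)}"

definition manifold :: "('a, 'e::euclidean_space) mfd \<Rightarrow> bool" where
  "manifold M \<longleftrightarrow> subspace (model M)
   \<and> (\<forall>(U, \<phi>)\<in>charts M. inj_on \<phi> U \<and> openin (top_of_set (model M)) (\<phi> ` U))
   \<and> (\<forall>(U, \<phi>)\<in>charts M. \<forall>(V, \<psi>)\<in>charts M.
        openin (top_of_set (model M)) (\<phi> ` (U \<inter> V)) \<and>
        smooth_on (\<phi> ` (U \<inter> V)) (\<psi> \<circ> inv_into U \<phi>))
   \<and> Hausdorff_space (mfd_top M) \<and> second_countable (mfd_top M)"

definition vec_mfd :: "('e::euclidean_space, 'e) mfd" where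
  "vec_mfd = \<lparr>model = UNIV, charts = {(UNIV, id)}\<rparr>"

definition prod_mfd :: "('a, 'e) mfd \<Rightarrow> ('b, 'f) mfd \<Rightarrow> ('a \<times> 'b, 'e \<times> 'f) mfd" where
  "prod_mfd M N = \<lparr>model = model M \<times> model N,
     charts = {(U \<times> V, map_prod \<phi> \<psi>) | U V \<phi> \<psi>. (U, \<phi>) \<in> charts M \<and> (V, \<psi>) \<in> charts N}\<rparr>"

text \<open>\<open>F\<close> is smooth as a map from the open subset \<open>W\<close> of \<open>M\<close> to \<open>N\<close>.\<close>

definition smooth_map ::
    "('a, 'e::euclidean_space) mfd \<Rightarrow> 'a set \<Rightarrow> ('b, 'f::euclidean_space) mfd \<Rightarrow> ('a \<Rightarrow> 'b) \<Rightarrow> bool" where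
  "smooth_map M W N F \<longleftrightarrow> F ` W \<subseteq> points N \<and>
     (\<forall>p\<in>W. \<forall>(U, \<phi>)\<in>charts M. \<forall>(V, \<psi>)\<in>charts N. p \<in> U \<and> F p \<in> V \<longrightarrow>
        (\<exists>Q. openin (mfd_top M) Q \<and> p \<in> Q \<and> Q \<subseteq> U \<inter> W \<and> F ` Q \<subseteq> V \<and>
             smooth_on (\<phi> ` Q) (\<psi> \<circ> F \<circ> inv_into U \<phi>)))"

definition smooth_fun :: "('a, 'e::euclidean_space) mfd \<Rightarrow> 'a set \<Rightarrow> ('a \<Rightarrow> real) \<Rightarrow> bool" where
  "smooth_fun M W f \<longleftrightarrow> openin (mfd_top M) W \<and> smooth_map M W vec_mfd f"

definition immersion ::
    "('a, 'e::euclidean_space) mfd \<Rightarrow> ('b, 'f::euclidean_space) mfd \<Rightarrow> ('a \<Rightarrow> 'b) \<Rightarrow> bool" where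
  "immersion M N F \<longleftrightarrow> smooth_map M (points M) N F \<and>
     (\<forall>p\<in>points M. \<forall>(U, \<phi>)\<in>charts M. \<forall>(V, \<psi>)\<in>charts N. p \<in> U \<and> F p \<in> V \<longrightarrow>
        (\<exists>L. ((\<psi> \<circ> F \<circ> inv_into U \<phi>) has_derivative L) (at (\<phi> p) within model M) \<and>
             inj_on L (model M)))"

section \<open>Lie groups and their Lie algebras\<close>

record ('a, 'e) lgroup = "'a monoid" +
  man :: "('a, 'e) mfd"

definition lie_group :: "('a, 'e::euclidean_space) lgroup \<Rightarrow> bool" where
  "lie_group G \<longleftrightarrow> group G \<and> manifold (man G) \<and> points (man G) = carrier G
   \<and> smooth_map (prod_mfd (man G) (man G)) (carrier G \<times> carrier G) (man G) (\<lambda>(x, y). x \<otimes>\<^bsub>G\<^esub> y)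
   \<and> smooth_map (man G) (carrier G) (man G) (\<lambda>x. inv\<^bsub>G\<^esub> x)"

abbreviation connected_lgroup :: "('a, 'e::euclidean_space) lgroup \<Rightarrow> bool" where
  "connected_lgroup G \<equiv> connected_space (mfd_top (man G))"

text \<open>Lie subgroups are immersed; they carry their own manifold structure.\<close>

definition lie_subgroup :: "('a, 'e::euclidean_space) lgroup \<Rightarrow> ('a, 'e) lgroup \<Rightarrow> bool" where
  "lie_subgroup S G \<longleftrightarrow> lie_group S \<and> lie_group G \<and> subgroup (carrier S) G
   \<and> (\<forall>x\<in>carrier S. \<forall>y\<in>carrier S. x \<otimes>\<^bsub>S\<^esub> y = x \<otimes>\<^bsub>G\<^esub> y)
   \<and> immersion (man S) (man G) (\<lambda>x. x)"

text \<open>Derivatives of \<open>f\<close> at \<open>p\<close> along the curves \<open>p e\<^bsup>tX\<^esup>\<close> (this is the left-invariant vector field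
  of \<open>X\<close>) and \<open>e\<^bsup>tX\<^esup> p\<close>.\<close>

definition lfield :: "('a, 'e) lgroup \<Rightarrow> ('d::real_vector \<Rightarrow> 'a) \<Rightarrow> 'd \<Rightarrow> ('a \<Rightarrow> real) \<Rightarrow> 'a \<Rightarrow> real" where
  "lfield G ex X f p = deriv (\<lambda>t. f (p \<otimes>\<^bsub>G\<^esub> ex (t *\<^sub>R X))) 0"

definition rfield :: "('a, 'e) lgroup \<Rightarrow> ('d::real_vector \<Rightarrow> 'a) \<Rightarrow> 'd \<Rightarrow> ('a \<Rightarrow> real) \<Rightarrow> 'a \<Rightarrow> real" where
  "rfield G ex X f p = deriv (\<lambda>t. f (ex (t *\<^sub>R X) \<otimes>\<^bsub>G\<^esub> p)) 0"

text \<open>The vector space \<open>g\<close> with bracket \<open>br\<close> is the Lie algebra of \<open>G\<close>, and \<open>ex\<close> is the exponential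
  map: the curves \<open>e\<^bsup>tX\<^esup>\<close> are one-parameter subgroups, \<open>ex\<close> is smooth (expressed through linear
  parametrizations of subspaces of \<open>g\<close> by the Euclidean space containing the model space), the map
  sending \<open>X\<close> to the velocity of \<open>e\<^bsup>tX\<^esup>\<close> at \<open>t = 0\<close> is a linear bijection from \<open>g\<close> onto the tangent
  space at the unit, whose elements are the velocities of smooth curves, and \<open>br\<close> is the commutator of left-invariant vector fields.\<close>

definition has_lie_algebra ::
    "('a, 'e::euclidean_space) lgroup \<Rightarrow> 'd::real_vector set \<Rightarrow> ('d \<Rightarrow> 'd \<Rightarrow> 'd) \<Rightarrow> ('d \<Rightarrow> 'a) \<Rightarrow> bool" where
  "has_lie_algebra G g br ex \<longleftrightarrow> subspace g
   \<and> (\<forall>X\<in>g. \<forall>s t. ex ((s + t) *\<^sub>R X) = ex (s *\<^sub>R X) \<otimes>\<^bsub>G\<^esub> ex (t *\<^sub>R X))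
   \<and> (\<forall>L::'e \<Rightarrow> 'd. linear L \<and> range L \<subseteq> g \<longrightarrow> smooth_map vec_mfd UNIV (man G) (ex \<circ> L))
   \<and> (\<forall>c. smooth_map (vec_mfd :: (real, real) mfd) UNIV (man G) c \<and> c 0 = \<one>\<^bsub>G\<^esub> \<longrightarrow>
        (\<exists>!X. X \<in> g \<and> (\<forall>W f. \<one>\<^bsub>G\<^esub> \<in> W \<and> smooth_fun (man G) W f \<longrightarrow>
                 deriv (\<lambda>t. f (c t)) 0 = lfield G ex X f \<one>\<^bsub>G\<^esub>)))
   \<and> (\<forall>X\<in>g. \<forall>Y\<in>g. \<forall>a b W f p. smooth_fun (man G) W f \<and> p \<in> W \<longrightarrow>
        lfield G ex (a *\<^sub>R X + b *\<^sub>R Y) f p = a * lfield G ex X f p + b * lfield G ex Y f p)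
   \<and> (\<forall>X\<in>g. \<forall>Y\<in>g. br X Y \<in> g \<and> (\<forall>W f p. smooth_fun (man G) W f \<and> p \<in> W \<longrightarrow>
        lfield G ex (br X Y) f p
          = lfield G ex X (lfield G ex Y f) p - lfield G ex Y (lfield G ex X f) p))"

definition Adj :: "('a, 'e) lgroup \<Rightarrow> ('d::real_vector \<Rightarrow> 'a) \<Rightarrow> 'a \<Rightarrow> 'd \<Rightarrow> 'd" where
  "Adj G ex g X = (THE Y. \<forall>t. ex (t *\<^sub>R Y) = g \<otimes>\<^bsub>G\<^esub> ex (t *\<^sub>R X) \<otimes>\<^bsub>G\<^esub> inv\<^bsub>G\<^esub> g)"

section \<open>Poisson-Lie groups\<close>

text \<open>Functions on a manifold are total functions on its ambient type, so brackets must be required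
  to depend only on the values at the points of the manifold.\<close>

definition poisson_bracket ::
    "('a, 'e::euclidean_space) mfd \<Rightarrow> (('a \<Rightarrow> real) \<Rightarrow> ('a \<Rightarrow> real) \<Rightarrow> 'a \<Rightarrow> real) \<Rightarrow> bool" where
  "poisson_bracket M pb \<longleftrightarrow> (let C = {f. smooth_fun M (points M) f} in
     (\<forall>f\<in>C. \<forall>f'\<in>C. \<forall>g\<in>C. (\<forall>p\<in>points M. f p = f' p) \<longrightarrow> (\<forall>p\<in>points M. pb f g p = pb f' g p)) \<and>
     (\<forall>f\<in>C. \<forall>g\<in>C. pb f g \<in> C) \<and>
     (\<forall>f\<in>C. \<forall>g\<in>C. \<forall>h\<in>C. \<forall>p\<in>points M.
        pb f g p = - pb g f p \<and>
        (\<forall>a b. pb (\<lambda>q. a * f q + b * g q) h p = a * pb f h p + b * pb g h p) \<and>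
        pb (\<lambda>q. f q * g q) h p = f p * pb g h p + pb f h p * g p \<and>
        pb f (pb g h) p + pb g (pb h f) p + pb h (pb f g) p = 0))"

text \<open>The last condition states that multiplication is a Poisson map from the product Poisson
  manifold \<open>G \<times> G\<close>.\<close>

definition poisson_lie_group ::
    "('a, 'e::euclidean_space) lgroup \<Rightarrow> (('a \<Rightarrow> real) \<Rightarrow> ('a \<Rightarrow> real) \<Rightarrow> 'a \<Rightarrow> real) \<Rightarrow> bool" where
  "poisson_lie_group G pb \<longleftrightarrow> lie_group G \<and> poisson_bracket (man G) pb \<and>
     (\<forall>f1 f2. smooth_fun (man G) (carrier G) f1 \<and> smooth_fun (man G) (carrier G) f2 \<longrightarrow>
        (\<forall>x\<in>carrier G. \<forall>y\<in>carrier G. pb f1 f2 (x \<otimes>\<^bsub>G\<^esub> y) =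
            pb (\<lambda>z. f1 (x \<otimes>\<^bsub>G\<^esub> z)) (\<lambda>z. f2 (x \<otimes>\<^bsub>G\<^esub> z)) y +
            pb (\<lambda>z. f1 (z \<otimes>\<^bsub>G\<^esub> y)) (\<lambda>z. f2 (z \<otimes>\<^bsub>G\<^esub> y)) x))"

definition poisson_lie_subgroup ::
    "('a, 'e::euclidean_space) lgroup \<Rightarrow> ('a, 'e) lgroup \<Rightarrow>
     (('a \<Rightarrow> real) \<Rightarrow> ('a \<Rightarrow> real) \<Rightarrow> 'a \<Rightarrow> real) \<Rightarrow> bool" where
  "poisson_lie_subgroup S G pb \<longleftrightarrow> lie_subgroup S G \<and>
     (\<exists>pbS. poisson_lie_group S pbS \<and>
        (\<forall>f1 f2. smooth_fun (man G) (carrier G) f1 \<and> smooth_fun (man G) (carrier G) f2 \<longrightarrow>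
           (\<forall>p\<in>carrier S. pb f1 f2 p = pbS f1 f2 p)))"

section \<open>The Drinfeld double\<close>

definition direct_sum :: "'d::real_vector set \<Rightarrow> 'd set \<Rightarrow> 'd set \<Rightarrow> bool" where
  "direct_sum V W U \<longleftrightarrow> subspace V \<and> subspace W \<and> V \<inter> W = {0} \<and> {x + y | x y. x \<in> V \<and> y \<in> W} = U"

text \<open>The component in \<open>V\<close> with respect to the direct sum \<open>V + W\<close>.\<close>

definition proj_along :: "'d::real_vector set \<Rightarrow> 'd set \<Rightarrow> 'd \<Rightarrow> 'd" where
  "proj_along V W Z = (THE x. x \<in> V \<and> Z - x \<in> W)"

definition lie_bracket :: "('d::real_vector \<Rightarrow> 'd \<Rightarrow> 'd) \<Rightarrow> bool" where
  "lie_bracket br \<longleftrightarrow> bilinear br \<and> (\<forall>X. br X X = 0) \<and>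
     (\<forall>X Y Z. br X (br Y Z) + br Y (br Z X) + br Z (br X Y) = 0)"

text \<open>The double of \<open>k\<close> is the whole type \<open>'d\<close>, with invariant scalar product \<open>form\<close>. The dual space
  of \<open>k\<close> is the subspace \<open>ks\<close>, where \<open>\<alpha>\<close> in \<open>ks\<close> stands for the linear functional \<open>form \<alpha>\<close> on
  \<open>k\<close>; thus \<open>form\<close> restricts to the canonical pairing of \<open>ks\<close> with \<open>k\<close>.\<close>

definition drinfeld_double ::
    "('d::real_vector \<Rightarrow> 'd \<Rightarrow> 'd) \<Rightarrow> ('d \<Rightarrow> 'd \<Rightarrow> real) \<Rightarrow> 'd set \<Rightarrow> 'd set \<Rightarrow> bool" where
  "drinfeld_double br form k ks \<longleftrightarrow>
     (\<exists>B::'d set. finite B \<and> span B = UNIV) \<and> lie_bracket br \<and> direct_sum k ks UNIV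
   \<and> (\<forall>X\<in>k. \<forall>Y\<in>k. br X Y \<in> k) \<and> (\<forall>\<alpha>\<in>ks. \<forall>\<beta>\<in>ks. br \<alpha> \<beta> \<in> ks)
   \<and> bilinear form \<and> (\<forall>X Y. form X Y = form Y X)
   \<and> (\<forall>X Y Z. form (br X Y) Z = form X (br Y Z))
   \<and> (\<forall>X\<in>k. \<forall>Y\<in>k. form X Y = 0) \<and> (\<forall>\<alpha>\<in>ks. \<forall>\<beta>\<in>ks. form \<alpha> \<beta> = 0)
   \<and> (\<forall>l::'d \<Rightarrow> real. linear l \<longrightarrow> (\<exists>!\<alpha>. \<alpha> \<in> ks \<and> (\<forall>X\<in>k. form \<alpha> X = l X)))"

definition annihilator :: "('d \<Rightarrow> 'd \<Rightarrow> real) \<Rightarrow> 'd set \<Rightarrow> 'd set \<Rightarrow> 'd set" where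
  "annihilator form ks V = {\<alpha>\<in>ks. \<forall>X\<in>V. form \<alpha> X = 0}"

text \<open>The Lie bracket on \<open>ks\<close> is the linearization at the unit of the Poisson bracket of \<open>K\<close>:
  the bracket of the differentials at the unit of \<open>f1\<close> and \<open>f2\<close> is the differential of their
  Poisson bracket.\<close>

definition linearization ::
    "('a, 'e::euclidean_space) lgroup \<Rightarrow> (('a \<Rightarrow> real) \<Rightarrow> ('a \<Rightarrow> real) \<Rightarrow> 'a \<Rightarrow> real) \<Rightarrow>
     'd::real_vector set \<Rightarrow> 'd set \<Rightarrow> ('d \<Rightarrow> 'd \<Rightarrow> real) \<Rightarrow> ('d \<Rightarrow> 'd \<Rightarrow> 'd) \<Rightarrow> ('d \<Rightarrow> 'a) \<Rightarrow> bool" where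
  "linearization K pb k ks form br ex \<longleftrightarrow>
     (\<forall>f1 f2. \<forall>\<alpha>1\<in>ks. \<forall>\<alpha>2\<in>ks.
        smooth_fun (man K) (carrier K) f1 \<and> smooth_fun (man K) (carrier K) f2 \<and>
        (\<forall>X\<in>k. form \<alpha>1 X = lfield K ex X f1 \<one>\<^bsub>K\<^esub> \<and> form \<alpha>2 X = lfield K ex X f2 \<one>\<^bsub>K\<^esub>) \<longrightarrow>
        (\<forall>X\<in>k. form (br \<alpha>1 \<alpha>2) X = lfield K ex X (pb f1 f2) \<one>\<^bsub>K\<^esub>))"

text \<open>Gradients of a function on a group \<open>G\<close> with Lie algebra \<open>as\<close>, as elements of \<open>a\<close>, the dual
  of \<open>as\<close>.\<close>

definition grad :: "('a, 'e) lgroup \<Rightarrow> 'd::real_vector set \<Rightarrow> 'd set \<Rightarrow> ('d \<Rightarrow> 'd \<Rightarrow> real) \<Rightarrow>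
    ('d \<Rightarrow> 'a) \<Rightarrow> ('a \<Rightarrow> real) \<Rightarrow> 'a \<Rightarrow> 'd" where
  "grad G a as form ex f \<kappa> = (THE Y. Y \<in> a \<and> (\<forall>X\<in>as. form Y X = rfield G ex X f \<kappa>))"

definition grad' :: "('a, 'e) lgroup \<Rightarrow> 'd::real_vector set \<Rightarrow> 'd set \<Rightarrow> ('d \<Rightarrow> 'd \<Rightarrow> real) \<Rightarrow>
    ('d \<Rightarrow> 'a) \<Rightarrow> ('a \<Rightarrow> real) \<Rightarrow> 'a \<Rightarrow> 'd" where
  "grad' G a as form ex f \<kappa> = (THE Y. Y \<in> a \<and> (\<forall>X\<in>as. form Y X = lfield G ex X f \<kappa>))"

text \<open>The bracket on the dual group \<open>G\<close> with Lie algebra \<open>as\<close>, conjugation being taken in a Lie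
  group \<open>D\<close> containing \<open>G\<close> whose Lie algebra contains \<open>a + as\<close>. The value at \<open>\<kappa>\<close> depends only on
  germs, so the bracket may be applied to functions that are smooth near \<open>\<kappa>\<close> only.\<close>

definition dual_bracket :: "('a, 'e) lgroup \<Rightarrow> ('a, 'e) lgroup \<Rightarrow> 'd::real_vector set \<Rightarrow> 'd set \<Rightarrow>
    ('d \<Rightarrow> 'd \<Rightarrow> real) \<Rightarrow> ('d \<Rightarrow> 'a) \<Rightarrow> ('a \<Rightarrow> real) \<Rightarrow> ('a \<Rightarrow> real) \<Rightarrow> 'a \<Rightarrow> real" where
  "dual_bracket D G a as form ex f1 f2 \<kappa> =
     form (grad G a as form ex f1 \<kappa>) (Adj D ex \<kappa> (grad' G a as form ex f2 \<kappa>))"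

section \<open>Constraints and Dirac reduction\<close>

definition basis_family :: "nat \<Rightarrow> (nat \<Rightarrow> 'd::real_vector) \<Rightarrow> 'd set \<Rightarrow> bool" where
  "basis_family n M V \<longleftrightarrow> inj_on M {..<n} \<and> independent (M ` {..<n}) \<and> span (M ` {..<n}) = V"

text \<open>\<open>constraint G ex form V B M\<close> is the function sending \<open>\<lambda> e\<^bsup>\<mu>\<^esup>\<close> to the pairing of \<open>\<mu>\<close> and \<open>M\<close>, for
  \<open>\<lambda>\<close> in \<open>V\<close> and \<open>\<mu>\<close> in \<open>B\<close>, and \<open>base_point\<close> sends \<open>\<lambda> e\<^bsup>\<mu>\<^esup>\<close> to \<open>\<lambda>\<close>.\<close>

definition constraint :: "('a, 'e) lgroup \<Rightarrow> ('d \<Rightarrow> 'a) \<Rightarrow> ('d \<Rightarrow> 'd \<Rightarrow> real) \<Rightarrow>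
    'a set \<Rightarrow> 'd set \<Rightarrow> 'd \<Rightarrow> 'a \<Rightarrow> real" where
  "constraint G ex form V B M \<kappa> = form (THE \<mu>. \<mu> \<in> B \<and> (\<exists>l\<in>V. \<kappa> = l \<otimes>\<^bsub>G\<^esub> ex \<mu>)) M"

definition base_point :: "('a, 'e) lgroup \<Rightarrow> ('d \<Rightarrow> 'a) \<Rightarrow> 'a set \<Rightarrow> 'd set \<Rightarrow> 'a \<Rightarrow> 'a" where
  "base_point G ex V B \<kappa> = (THE l. l \<in> V \<and> (\<exists>\<mu>\<in>B. \<kappa> = l \<otimes>\<^bsub>G\<^esub> ex \<mu>))"

text \<open>On the open subset \<open>U\<close> of \<open>Ks\<close>, the set \<open>N\<close> is given by the vanishing of the constraints
  \<open>\<xi> i\<close>, for \<open>i < n\<close>, which belong to the \<open>M i\<close>. Here \<open>U\<close> is the diffeomorphic image of the product of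
  an open subset \<open>V\<close> of \<open>Hs\<close> and a neighbourhood \<open>B\<close> of zero in \<open>ms\<close> under the map sending
  \<open>(\<lambda>, \<mu>)\<close> to \<open>\<lambda> e\<^bsup>\<mu>\<^esup>\<close>; smoothness of the inverse is expressed by that of its components.\<close>

definition local_constraints ::
    "('a, 'e::euclidean_space) lgroup \<Rightarrow> ('a, 'e) lgroup \<Rightarrow> ('d::real_normed_vector \<Rightarrow> 'a) \<Rightarrow>
     ('d \<Rightarrow> 'd \<Rightarrow> real) \<Rightarrow> 'd set \<Rightarrow> 'd set \<Rightarrow> (nat \<Rightarrow> 'd) \<Rightarrow> 'a set \<Rightarrow>
     'a set \<Rightarrow> (nat \<Rightarrow> 'a \<Rightarrow> real) \<Rightarrow> bool" where
  "local_constraints Ks Hs ex form m ms M N U \<xi> \<longleftrightarrow>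
     (\<exists>V B. openin (mfd_top (man Hs)) V \<and> openin (top_of_set ms) B \<and> 0 \<in> B
        \<and> inj_on (\<lambda>(l, \<mu>). l \<otimes>\<^bsub>Ks\<^esub> ex \<mu>) (V \<times> B) \<and> U = (\<lambda>(l, \<mu>). l \<otimes>\<^bsub>Ks\<^esub> ex \<mu>) ` (V \<times> B)
        \<and> openin (mfd_top (man Ks)) U
        \<and> smooth_map (man Ks) U (man Hs) (base_point Ks ex V B)
        \<and> (\<forall>X\<in>m. smooth_fun (man Ks) U (constraint Ks ex form V B X))
        \<and> U \<inter> N = V \<and> \<xi> = (\<lambda>i. constraint Ks ex form V B (M i)))"

definition inverse_matrix :: "nat \<Rightarrow> (nat \<Rightarrow> nat \<Rightarrow> real) \<Rightarrow> (nat \<Rightarrow> nat \<Rightarrow> real) \<Rightarrow> bool" where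
  "inverse_matrix n C C' \<longleftrightarrow> (\<forall>i<n. \<forall>j<n. (\<Sum>k<n. C i k * C' k j) = of_bool (i = j)
                                      \<and> (\<Sum>k<n. C' i k * C k j) = of_bool (i = j))"

definition dirac_bracket :: "(('a \<Rightarrow> real) \<Rightarrow> ('a \<Rightarrow> real) \<Rightarrow> 'a \<Rightarrow> real) \<Rightarrow> nat \<Rightarrow> (nat \<Rightarrow> 'a \<Rightarrow> real) \<Rightarrow>
    (nat \<Rightarrow> nat \<Rightarrow> real) \<Rightarrow> ('a \<Rightarrow> real) \<Rightarrow> ('a \<Rightarrow> real) \<Rightarrow> 'a \<Rightarrow> real" where
  "dirac_bracket pb n \<xi> C' f1 f2 p =
     pb f1 f2 p - (\<Sum>i<n. \<Sum>j<n. pb f1 (\<xi> i) p * C' i j * pb (\<xi> j) f2 p)"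

definition local_extension :: "('a, 'e::euclidean_space) mfd \<Rightarrow> 'a set \<Rightarrow> ('a \<Rightarrow> real) \<Rightarrow> 'a \<Rightarrow>
    'a set \<Rightarrow> ('a \<Rightarrow> real) \<Rightarrow> bool" where
  "local_extension P N F p W f \<longleftrightarrow> p \<in> W \<and> smooth_fun P W f \<and> (\<forall>q\<in>W \<inter> N. f q = F q)"

text \<open>The Dirac reduction of \<open>(P, pb)\<close> to the submanifold \<open>N\<close> (an open subset of the manifold
  \<open>Q\<close>), given locally by the constraints \<open>cons U \<xi>\<close>, is \<open>N\<close> with the bracket \<open>b\<close>.\<close>

definition dirac_reduction ::
    "('a, 'e::euclidean_space) mfd \<Rightarrow> (('a \<Rightarrow> real) \<Rightarrow> ('a \<Rightarrow> real) \<Rightarrow> 'a \<Rightarrow> real) \<Rightarrow> nat \<Rightarrow>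
     ('a set \<Rightarrow> (nat \<Rightarrow> 'a \<Rightarrow> real) \<Rightarrow> bool) \<Rightarrow> ('a, 'e) mfd \<Rightarrow> 'a set \<Rightarrow>
     (('a \<Rightarrow> real) \<Rightarrow> ('a \<Rightarrow> real) \<Rightarrow> 'a \<Rightarrow> real) \<Rightarrow> bool" where
  "dirac_reduction P pb n cons Q N b \<longleftrightarrow>
     (\<forall>F p. smooth_fun Q N F \<and> p \<in> N \<longrightarrow> (\<exists>W f. local_extension P N F p W f)) \<and>
     (\<forall>F1 F2 p U \<xi> W1 f1 W2 f2 C'.
        smooth_fun Q N F1 \<and> smooth_fun Q N F2 \<and> p \<in> N \<and> p \<in> U \<and> cons U \<xi> \<and>
        local_extension P N F1 p W1 f1 \<and> local_extension P N F2 p W2 f2 \<and>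
        inverse_matrix n (\<lambda>i j. pb (\<xi> i) (\<xi> j) p) C' \<longrightarrow>
        b F1 F2 p = dirac_bracket pb n \<xi> C' f1 f2 p)"

end

theory Submission
  imports Defs
begin

text \<open>
  For \<open>\<lambda>\<close> in \<open>H\<^sup>*\<close> the operator \<open>Ad \<lambda>\<close> preserves the invariant form and both summands of the
  orthogonal decomposition of the double into \<open>h + h\<^sup>*\<close> and \<open>m + m\<^sup>*\<close>. Indeed \<open>ad h\<^sup>*\<close> does so
  infinitesimally, and an \<open>ad h\<^sup>*\<close>-invariant bilinear form is \<open>Ad\<close>-invariant: its pullback has
  zero derivative along smooth curves in the connected group \<open>H\<^sup>*\<close>.

  If \<open>X\<close> and \<open>Y\<close> are the gradients \<open>\<nabla>'f\<close> and \<open>\<nabla>'g\<close> at \<open>\<lambda>\<close>, the bracket on \<open>K\<^sup>*\<close> is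
  \<open>\<omega> X Y\<close>, the pairing of the \<open>k\<close>-component of \<open>Ad \<lambda> X\<close> with \<open>Ad \<lambda> Y\<close>. By the decomposition \<open>\<omega>\<close> splits
  into a block on \<open>h\<close> and a block on \<open>m\<close>. The constraint \<open>\<xi>\<^sub>M\<close> has gradient \<open>M\<close>, so the constraint matrix is
  the \<open>m\<close>-block, the Dirac correction removes exactly this block, and the remaining \<open>h\<close>-block is
  the bracket on \<open>H\<^sup>*\<close>, since the \<open>h\<close>-component of the gradient of an extension of \<open>F\<close> is the gradient of \<open>F\<close>.
\<close>

section \<open>Smooth maps between Euclidean spaces\<close>

text \<open>The hypotheses describe a Lie algebra by one-parameter groups, by derivatives of
  functions along them and by a commutator formula; they say nothing about flows or about the
  smoothness of \<open>Ad\<close>. So tangent vectors are handled through their action on functions,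
  identities in a group come from curves with vanishing derivative, and the derivative of
  \<open>Ad\<close> comes from the symmetry of second partial derivatives. The Lie algebra carries
  no inner product: vector-valued derivatives are tested with linear functionals, each of which is
  the differential at the unit of a smooth function. As a point of \<open>Hs\<close> need not be an
  exponential, invariance is propagated along chart segments. Both brackets are values of one form
  \<open>\<omega>\<close> because \<open>Ad\<close> of \<open>Hs\<close> maps \<open>h\<close> into
  \<open>h + hs\<close>, so that the \<open>k\<close>-component used for \<open>Ks\<close> is
  already the \<open>h\<close>-component used for \<open>Hs\<close>.\<close>

lemma Ck_subset: "Ck n S f \<Longrightarrow> T \<subseteq> S \<Longrightarrow> Ck n T f"
  by (induction n arbitrary: f) (auto intro: continuous_on_subset)

text \<open>Only the bottom order has content, where differentiability gives continuity; above it
  the recursion shifts the claim to the directional derivatives.\<close>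

lemma Ck_SucD: "Ck (Suc n) S f \<Longrightarrow> Ck n S f"
proof (induction n arbitrary: f)
  case 0
  then show ?case
    by (auto intro!: continuous_at_imp_continuous_on differentiable_imp_continuous_within)
next
  case (Suc n)
  then show ?case by (metis Ck.simps(2))
qed

lemma frechet_derivative_cong_open:
  assumes "open S" "x \<in> S" "\<And>y. y \<in> S \<Longrightarrow> f y = g y" "f differentiable at x"
  shows "g differentiable at x" "frechet_derivative g (at x) = frechet_derivative f (at x)"
proof -
  have "(f has_derivative frechet_derivative f (at x)) (at x)"
    using assms(4) frechet_derivative_works by blast
  then have *: "(g has_derivative frechet_derivative f (at x)) (at x)"
    by (rule has_derivative_transform_within_open[OF _ assms(1,2)]) (use assms(3) in auto)
  then show "g differentiable at x" by (auto simp: differentiable_def)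
  show "frechet_derivative g (at x) = frechet_derivative f (at x)"
    using frechet_derivative_at[OF *] by simp
qed

lemma Ck_cong:
  assumes "open S" "\<And>x. x \<in> S \<Longrightarrow> f x = g x" "Ck n S f"
  shows "Ck n S g"
  using assms(2,3)
proof (induction n arbitrary: f g)
  case 0
  then show ?case by (auto cong: continuous_on_cong)
next
  case (Suc n)
  have d: "f differentiable at x" if "x \<in> S" for x using Suc.prems that by simp
  have "g differentiable at x" if "x \<in> S" for x
    by (rule frechet_derivative_cong_open(1)[OF assms(1) that Suc.prems(1) d[OF that]])
  moreover have "Ck n S (\<lambda>x. frechet_derivative g (at x) v)" for v
  proof (rule Suc.IH)
    show "Ck n S (\<lambda>x. frechet_derivative f (at x) v)" using Suc.prems by simp
    show "frechet_derivative f (at x) v = frechet_derivative g (at x) v" if "x \<in> S" for x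
      using frechet_derivative_cong_open(2)[OF assms(1) that Suc.prems(1) d[OF that]] by simp
  qed
  ultimately show ?case by simp
qed

lemma Ck_local:
  assumes "\<And>x. x \<in> S \<Longrightarrow> \<exists>U. open U \<and> x \<in> U \<and> Ck n U f"
  shows "Ck n S f"
  using assms
proof (induction n arbitrary: f)
  case 0
  show ?case unfolding Ck.simps
  proof (rule continuous_at_imp_continuous_on, safe)
    fix x assume "x \<in> S"
    then obtain U where "open U" "x \<in> U" "continuous_on U f" using 0 by auto
    then show "isCont f x" by (simp add: continuous_on_eq_continuous_at)
  qed
next
  case (Suc n)
  then show ?case by (metis Ck.simps(2))
qed

lemma Ck_const: "Ck n S (\<lambda>x. c)"
  by (induction n arbitrary: c) auto

lemma Ck_bounded_linear:
  assumes "bounded_linear f" shows "Ck n S f"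
proof (cases n)
  case 0
  then show ?thesis using assms by (simp add: linear_continuous_on)
next
  case (Suc m)
  have "(f has_derivative f) (at x)" for x
    using assms by (simp add: bounded_linear_imp_has_derivative)
  moreover from this have "frechet_derivative f (at x) = f" for x
    using frechet_derivative_at by metis
  ultimately show ?thesis using Suc by (auto simp: differentiable_def intro: Ck_const)
qed

text \<open>Derivatives are unique, so any explicit derivative may replace the choice operator
  \<open>frechet_derivative\<close> in the recursion; the calculus rules below enter their
  inductions this way.\<close>

lemma Ck_SucI:
  assumes "open S" "\<And>x. x \<in> S \<Longrightarrow> (f has_derivative f' x) (at x)" "\<And>v. Ck n S (\<lambda>x. f' x v)"
  shows "Ck (Suc n) S f"
proof -
  have "Ck n S (\<lambda>x. frechet_derivative f (at x) v)" for v
    by (rule Ck_cong[OF assms(1) _ assms(3)[of v]]) (metis assms(2) frechet_derivative_at)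
  then show ?thesis using assms(2) by (auto simp: differentiable_def)
qed

lemma Ck_SucE:
  assumes "Ck (Suc n) S f" "x \<in> S"
  shows "(f has_derivative frechet_derivative f (at x)) (at x)"
  using assms frechet_derivative_works by auto

lemma Ck_add:
  assumes "open S" "Ck n S f" "Ck n S g"
  shows "Ck n S (\<lambda>x. f x + g x)"
  using assms(2,3)
proof (induction n arbitrary: f g)
  case 0
  then show ?case by (auto intro: continuous_intros)
next
  case (Suc n)
  show ?case
    by (rule Ck_SucI[OF assms(1) has_derivative_add[OF Ck_SucE[OF Suc.prems(1)] Ck_SucE[OF Suc.prems(2)]]])
      (use Suc in auto)
qed

lemma Ck_sum:
  assumes "open S" "finite I" "\<And>i. i \<in> I \<Longrightarrow> Ck n S (f i)"
  shows "Ck n S (\<lambda>x. \<Sum>i\<in>I. f i x)"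
  using assms(2,3)
proof (induction I rule: finite_induct)
  case empty
  then show ?case by (simp add: Ck_const)
next
  case (insert i I)
  then have "Ck n S (\<lambda>x. f i x + (\<Sum>i\<in>I. f i x))" by (intro Ck_add[OF assms(1)]) auto
  then show ?case using insert.hyps by simp
qed

lemma Ck_linear_compose:
  assumes "open S" "bounded_linear L" "Ck n S f"
  shows "Ck n S (\<lambda>x. L (f x))"
  using assms(3)
proof (induction n arbitrary: f)
  case 0
  then show ?case using assms(2) by (auto intro: bounded_linear.continuous_on)
next
  case (Suc n)
  show ?case
    by (rule Ck_SucI[OF assms(1) bounded_linear.has_derivative[OF assms(2) Ck_SucE[OF Suc.prems]]])
      (use Suc in auto)
qed

lemma Ck_scaleR:
  fixes f :: "'e::euclidean_space \<Rightarrow> real"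
  assumes "open S" "Ck n S f" "Ck n S g"
  shows "Ck n S (\<lambda>x. f x *\<^sub>R g x)"
  using assms(2,3)
proof (induction n arbitrary: f g)
  case 0
  then show ?case by (auto intro: continuous_intros)
next
  case (Suc n)
  show ?case
    by (rule Ck_SucI[OF assms(1) has_derivative_scaleR[OF Ck_SucE[OF Suc.prems(1)] Ck_SucE[OF Suc.prems(2)]]])
      (use Suc Ck_SucD[OF Suc.prems(1)] Ck_SucD[OF Suc.prems(2)] in \<open>auto intro!: Ck_add[OF assms(1)]\<close>)
qed

lemma Ck_Pair:
  assumes "open S" "Ck n S f" "Ck n S g"
  shows "Ck n S (\<lambda>x. (f x, g x))"
proof -
  have "Ck n S (\<lambda>x. (f x, 0) + (0, g x))"
    by (intro Ck_add Ck_linear_compose[OF assms(1) _ assms(2)] Ck_linear_compose[OF assms(1) _ assms(3)]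
        assms(1) bounded_linear_Pair bounded_linear_ident bounded_linear_zero)
  then show ?thesis by simp
qed

lemma Ck_compose:
  fixes f :: "'e::euclidean_space \<Rightarrow> 'f::euclidean_space" and g :: "'f \<Rightarrow> 'g::euclidean_space"
  assumes "open S" "f ` S \<subseteq> T" "Ck n S f" "Ck n T g"
  shows "Ck n S (\<lambda>x. g (f x))"
  using assms(3,4)
proof (induction n arbitrary: g)
  case 0
  then show ?case using continuous_on_compose2 assms(2) by auto
next
  case (Suc n)
  have chain: "((\<lambda>x. g (f x)) has_derivative
      (\<lambda>v. frechet_derivative g (at (f x)) (frechet_derivative f (at x) v))) (at x)" if "x \<in> S" for x
    by (rule has_derivative_compose[OF Ck_SucE[OF Suc.prems(1) that] Ck_SucE[OF Suc.prems(2)]])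
      (use that assms(2) in auto)
  have lin: "linear (frechet_derivative g (at (f x)))" if "x \<in> S" for x
    using Suc.prems(2) that assms(2) by (auto intro: linear_frechet_derivative)
  \<comment> \<open>The derivative of the composite is a varying linear map applied to a varying
    vector. Expanding the vector in \<open>Basis\<close> leaves products of scalar functions with
    composites of order \<open>n\<close>, to which the induction hypothesis applies.\<close>
  have "Ck n S (\<lambda>x. \<Sum>b\<in>Basis. (frechet_derivative f (at x) v \<bullet> b) *\<^sub>R frechet_derivative g (at (f x)) b)" for v
    using Suc.prems Ck_SucD[OF Suc.prems(1)]
    by (intro Ck_sum Ck_scaleR assms(1) Suc.IH Ck_linear_compose[where L="\<lambda>y. y \<bullet> _", OF assms(1) bounded_linear_inner_left])
      auto
  then have "Ck n S (\<lambda>x. frechet_derivative g (at (f x)) (frechet_derivative f (at x) v))" for v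
  proof (rule Ck_cong[OF assms(1), rotated])
    fix x assume x: "x \<in> S"
    have "frechet_derivative g (at (f x)) (frechet_derivative f (at x) v)
      = frechet_derivative g (at (f x)) (\<Sum>b\<in>Basis. (frechet_derivative f (at x) v \<bullet> b) *\<^sub>R b)"
      by (simp add: euclidean_representation)
    also have "\<dots> = (\<Sum>b\<in>Basis. (frechet_derivative f (at x) v \<bullet> b) *\<^sub>R frechet_derivative g (at (f x)) b)"
      using lin[OF x] by (simp add: linear_sum linear_scale)
    finally show "(\<Sum>b\<in>Basis. (frechet_derivative f (at x) v \<bullet> b) *\<^sub>R frechet_derivative g (at (f x)) b)
      = frechet_derivative g (at (f x)) (frechet_derivative f (at x) v)" by simp
  qed
  then show ?case by (intro Ck_SucI[OF assms(1) chain])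
qed

text \<open>The induction is joint, since differentiation exchanges the two functions.\<close>

lemma Ck_sin_cos: "Ck n UNIV (sin :: real \<Rightarrow> real) \<and> Ck n UNIV (cos :: real \<Rightarrow> real)"
proof (induction n)
  case 0
  then show ?case by (auto intro: continuous_intros)
next
  case (Suc n)
  have "(sin has_derivative (\<lambda>v. v * cos x)) (at x)" "(cos has_derivative (\<lambda>v. - v * sin x)) (at x)" for x :: real
    by (auto intro!: derivative_eq_intros)
  moreover have "Ck n UNIV (\<lambda>x. v * cos x)" "Ck n UNIV (\<lambda>x. - v * sin x)" for v :: real
    using Suc by (auto intro: Ck_linear_compose[OF open_UNIV bounded_linear_mult_right]
        Ck_linear_compose[OF open_UNIV bounded_linear_minus[OF bounded_linear_mult_right]])
  ultimately show ?case by (intro conjI Ck_SucI[OF open_UNIV]) blast+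
qed

section \<open>Smoothness on arbitrary subsets of a Euclidean space\<close>

lemma smooth_on_openD:
  assumes "open S" "smooth_on S f"
  shows "Ck n S f"
proof (rule Ck_local)
  fix x assume "x \<in> S"
  then obtain U g where g: "open U" "x \<in> U" "\<And>n. Ck n U g" "\<And>y. y \<in> U \<inter> S \<Longrightarrow> g y = f y"
    using assms(2) unfolding smooth_on_def by metis
  have "Ck n (U \<inter> S) f"
    by (rule Ck_cong[where f=g]) (use g assms(1) in \<open>auto intro: Ck_subset\<close>)
  then show "\<exists>U. open U \<and> x \<in> U \<and> Ck n U f" using g assms(1) \<open>x \<in> S\<close> by (intro exI[of _ "U \<inter> S"]) auto
qed

lemma smooth_onI: "open S \<Longrightarrow> (\<And>n. Ck n S f) \<Longrightarrow> smooth_on S f"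
  unfolding smooth_on_def by blast

lemma smooth_onE:
  assumes "smooth_on S f" "x \<in> S"
  obtains U g where "open U" "x \<in> U" "\<forall>n. Ck n U g" "\<forall>y\<in>U \<inter> S. g y = f y"
  using assms unfolding smooth_on_def by blast

lemma smooth_on_subset:
  assumes "smooth_on S f" "T \<subseteq> S" shows "smooth_on T f"
  unfolding smooth_on_def
proof
  fix x assume x: "x \<in> T"
  obtain U g where "open U" "x \<in> U" "\<forall>n. Ck n U g" "\<forall>y\<in>U \<inter> S. g y = f y"
    by (rule smooth_onE[OF assms(1) subsetD[OF assms(2) x]])
  then show "\<exists>U g. open U \<and> x \<in> U \<and> (\<forall>n. Ck n U g) \<and> (\<forall>y\<in>U \<inter> T. g y = f y)"
    using assms(2) by (intro exI[of _ U] exI[of _ g]) auto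
qed

lemma smooth_on_cong:
  assumes "smooth_on S f" "\<And>x. x \<in> S \<Longrightarrow> f x = g x" shows "smooth_on S g"
  using assms unfolding smooth_on_def by (metis Int_iff)

lemma smooth_on_local:
  assumes "\<And>x. x \<in> S \<Longrightarrow> \<exists>U. open U \<and> x \<in> U \<and> smooth_on (U \<inter> S) f"
  shows "smooth_on S f"
  unfolding smooth_on_def
proof
  fix x assume x: "x \<in> S"
  obtain U where U: "open U" "x \<in> U" "smooth_on (U \<inter> S) f" using assms x by blast
  then obtain V g where V: "open V" "x \<in> V" "\<And>n. Ck n V g" "\<And>y. y \<in> V \<inter> (U \<inter> S) \<Longrightarrow> g y = f y"
    unfolding smooth_on_def using x by (metis Int_iff)
  then show "\<exists>U g. open U \<and> x \<in> U \<and> (\<forall>n. Ck n U g) \<and> (\<forall>y\<in>U \<inter> S. g y = f y)"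
    using U by (intro exI[of _ "V \<inter> U"] exI[of _ g]) (auto intro: Ck_subset)
qed

lemma smooth_on_continuous:
  assumes "smooth_on S f" shows "continuous_on S f"
  unfolding continuous_on_eq_continuous_within
proof
  fix x assume x: "x \<in> S"
  then obtain U g where g: "open U" "x \<in> U" "\<And>n. Ck n U g" "\<And>y. y \<in> U \<inter> S \<Longrightarrow> g y = f y"
    using assms unfolding smooth_on_def by metis
  have "continuous (at x) g" using g(1-2) g(3)[of 0] by (simp add: continuous_on_eq_continuous_at)
  then have "continuous (at x within S) g" by (rule continuous_at_imp_continuous_within)
  moreover have "\<forall>\<^sub>F y in at x within S. g y = f y"
    using g(1,2,4) x by (auto simp: eventually_at_topological)
  ultimately show "continuous (at x within S) f"
    using g x unfolding continuous_within by (metis Int_iff tendsto_cong)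
qed

lemma smooth_on_compose:
  assumes "smooth_on S f" "smooth_on T g" "f ` S \<subseteq> T"
  shows "smooth_on S (\<lambda>x. g (f x))"
  unfolding smooth_on_def
proof
  fix x assume x: "x \<in> S"
  then obtain U f' where f': "open U" "x \<in> U" "\<And>n. Ck n U f'" "\<And>y. y \<in> U \<inter> S \<Longrightarrow> f' y = f y"
    using assms unfolding smooth_on_def by metis
  obtain V g' where g': "open V" "f x \<in> V" "\<And>n. Ck n V g'" "\<And>y. y \<in> V \<inter> T \<Longrightarrow> g' y = g y"
    using assms x unfolding smooth_on_def by (metis image_subset_iff)
  \<comment> \<open>Shrinking to this preimage keeps the values of the extension \<open>f'\<close>
    inside the domain of the extension \<open>g'\<close>, even at points outside
    \<open>S\<close>.\<close>
  let ?U = "U \<inter> f' -` V"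
  have U: "open ?U" using f'(1) f'(3)[of 0] g'(1) continuous_open_preimage by auto
  have "Ck n ?U (\<lambda>x. g' (f' x))" for n
    by (rule Ck_compose[OF U _ _ g'(3)]) (use f' in \<open>auto intro: Ck_subset\<close>)
  then show "\<exists>U g'. open U \<and> x \<in> U \<and> (\<forall>n. Ck n U g') \<and> (\<forall>y\<in>U \<inter> S. g' y = g (f y))"
    using U f' g' x assms(3) by (intro exI[of _ ?U] exI[of _ "\<lambda>x. g' (f' x)"]) auto
qed

lemma smooth_on_Pair:
  assumes "smooth_on S f" "smooth_on S g"
  shows "smooth_on S (\<lambda>x. (f x, g x))"
  unfolding smooth_on_def
proof
  fix x assume x: "x \<in> S"
  then obtain U f' where f': "open U" "x \<in> U" "\<And>n. Ck n U f'" "\<And>y. y \<in> U \<inter> S \<Longrightarrow> f' y = f y"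
    using assms unfolding smooth_on_def by metis
  obtain V g' where g': "open V" "x \<in> V" "\<And>n. Ck n V g'" "\<And>y. y \<in> V \<inter> S \<Longrightarrow> g' y = g y"
    using assms x unfolding smooth_on_def by metis
  have "Ck n (U \<inter> V) (\<lambda>x. (f' x, g' x))" for n
    by (rule Ck_Pair) (use f' g' in \<open>auto intro: Ck_subset\<close>)
  then show "\<exists>U h. open U \<and> x \<in> U \<and> (\<forall>n. Ck n U h) \<and> (\<forall>y\<in>U \<inter> S. h y = (f y, g y))"
    using f' g' by (intro exI[of _ "U \<inter> V"] exI[of _ "\<lambda>x. (f' x, g' x)"]) auto
qed

lemma smooth_on_bounded_linear: "bounded_linear f \<Longrightarrow> smooth_on S f"
  using smooth_onI[of UNIV f] Ck_bounded_linear smooth_on_subset by blast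

lemma smooth_on_const: "smooth_on S (\<lambda>x. c)"
  using smooth_onI[of UNIV "\<lambda>x. c"] Ck_const smooth_on_subset by blast

lemma smooth_on_add:
  assumes "smooth_on S f" "smooth_on S g"
  shows "smooth_on S (\<lambda>x. f x + g x)"
  using smooth_on_compose[OF smooth_on_Pair[OF assms] smooth_on_bounded_linear[of "\<lambda>z. fst z + snd z" UNIV]]
  by (simp add: bounded_linear_add bounded_linear_fst bounded_linear_snd)

lemma smooth_on_scaleR_left:
  "smooth_on S f \<Longrightarrow> smooth_on S (\<lambda>x. f x *\<^sub>R v)"
  using smooth_on_compose[OF _ smooth_on_bounded_linear[of "\<lambda>z. z *\<^sub>R v" UNIV]]
  by (simp add: bounded_linear_scaleR_left)

section \<open>Smooth maps between manifolds\<close>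

text \<open>The part of the manifold axioms that is needed for continuity arguments; it passes to products
  without any separation or countability argument.\<close>

definition compatible_charts :: "('a, 'e::euclidean_space) mfd \<Rightarrow> bool" where
  "compatible_charts M \<longleftrightarrow>
     (\<forall>(U, \<phi>)\<in>charts M. inj_on \<phi> U \<and> openin (top_of_set (model M)) (\<phi> ` U)) \<and>
     (\<forall>(U, \<phi>)\<in>charts M. \<forall>(V, \<psi>)\<in>charts M. openin (top_of_set (model M)) (\<phi> ` (U \<inter> V)) \<and>
        continuous_on (\<phi> ` (U \<inter> V)) (\<psi> \<circ> inv_into U \<phi>))"

lemma compatible_chartsD:
  assumes "compatible_charts M" "(U, \<phi>) \<in> charts M"
  shows "inj_on \<phi> U" "openin (top_of_set (model M)) (\<phi> ` U)"
    "(V, \<psi>) \<in> charts M \<Longrightarrow> openin (top_of_set (model M)) (\<phi> ` (U \<inter> V))"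
    "(V, \<psi>) \<in> charts M \<Longrightarrow> continuous_on (\<phi> ` (U \<inter> V)) (\<psi> \<circ> inv_into U \<phi>)"
  using assms unfolding compatible_charts_def by fast+

lemma manifold_transition:
  assumes "manifold M" "(U, \<phi>) \<in> charts M" "(V, \<psi>) \<in> charts M"
  shows "smooth_on (\<phi> ` (U \<inter> V)) (\<psi> \<circ> inv_into U \<phi>)"
  using assms unfolding manifold_def by fast

lemma manifold_compatible:
  assumes "manifold M" shows "compatible_charts M"
proof -
  have "inj_on \<phi> U" "openin (top_of_set (model M)) (\<phi> ` U)" if "(U, \<phi>) \<in> charts M" for U \<phi>
    using assms that unfolding manifold_def by fast+
  moreover have "openin (top_of_set (model M)) (\<phi> ` (U \<inter> V))"
    if "(U, \<phi>) \<in> charts M" "(V, \<psi>) \<in> charts M" for U \<phi> V \<psi>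
    using assms that unfolding manifold_def by fast
  ultimately show ?thesis
    using smooth_on_continuous[OF manifold_transition[OF assms]] unfolding compatible_charts_def by blast
qed

lemma compatible_vec: "compatible_charts (vec_mfd :: ('e::euclidean_space, 'e) mfd)"
  by (auto simp: compatible_charts_def vec_mfd_def)

lemma pointsE:
  assumes "p \<in> points M" obtains U \<phi> where "(U, \<phi>) \<in> charts M" "p \<in> U"
  using assms unfolding points_def by auto

lemma pointsI: "(U, \<phi>) \<in> charts M \<Longrightarrow> p \<in> U \<Longrightarrow> p \<in> points M"
  unfolding points_def by auto

lemma charts_prodI:
  "(U, \<phi>) \<in> charts M \<Longrightarrow> (V, \<psi>) \<in> charts N \<Longrightarrow> (U \<times> V, map_prod \<phi> \<psi>) \<in> charts (prod_mfd M N)"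
  unfolding prod_mfd_def by auto

lemma charts_prodE:
  assumes "(X, \<theta>) \<in> charts (prod_mfd M N)"
  obtains U \<phi> V \<psi> where "(U, \<phi>) \<in> charts M" "(V, \<psi>) \<in> charts N" "X = U \<times> V" "\<theta> = map_prod \<phi> \<psi>"
  using assms unfolding prod_mfd_def by auto

lemma model_prod [simp]: "model (prod_mfd M N) = model M \<times> model N"
  by (simp add: prod_mfd_def)

lemma points_prodI: "p \<in> points M \<Longrightarrow> q \<in> points N \<Longrightarrow> (p, q) \<in> points (prod_mfd M N)"
  by (elim pointsE) (rule pointsI[OF charts_prodI], auto)

lemma inv_into_map_prod:
  assumes "inj_on \<phi> U" "inj_on \<psi> V" "x \<in> \<phi> ` U" "y \<in> \<psi> ` V"
  shows "inv_into (U \<times> V) (map_prod \<phi> \<psi>) (x, y) = (inv_into U \<phi> x, inv_into V \<psi> y)"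
  by (rule inv_into_f_eq) (use assms in \<open>auto intro!: map_prod_inj_on simp: f_inv_into_f inv_into_into\<close>)

lemma compatible_prod:
  fixes M :: "('a, 'e::euclidean_space) mfd" and N :: "('b, 'f::euclidean_space) mfd"
  assumes "compatible_charts M" "compatible_charts N"
  shows "compatible_charts (prod_mfd M N)"
proof -
  have *: "openin (top_of_set (model M \<times> model N)) (map_prod \<phi> \<psi> ` ((U \<times> V) \<inter> (U' \<times> V')))
     \<and> continuous_on (map_prod \<phi> \<psi> ` ((U \<times> V) \<inter> (U' \<times> V'))) (map_prod \<phi>' \<psi>' \<circ> inv_into (U \<times> V) (map_prod \<phi> \<psi>))"
    if c: "(U, \<phi>) \<in> charts M" "(V, \<psi>) \<in> charts N" "(U', \<phi>') \<in> charts M" "(V', \<psi>') \<in> charts N"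
    for U \<phi> V \<psi> U' \<phi>' V' \<psi>'
  proof -
    have eq: "map_prod \<phi> \<psi> ` ((U \<times> V) \<inter> (U' \<times> V')) = \<phi> ` (U \<inter> U') \<times> \<psi> ` (V \<inter> V')" by auto
    note cM = compatible_chartsD[OF assms(1)] and cN = compatible_chartsD[OF assms(2)]
    have "continuous_on (\<phi> ` (U \<inter> U') \<times> \<psi> ` (V \<inter> V'))
      (\<lambda>z. ((\<phi>' \<circ> inv_into U \<phi>) (fst z), (\<psi>' \<circ> inv_into V \<psi>) (snd z)))"
      by (intro continuous_on_Pair continuous_on_compose2[OF cM(4)[OF c(1,3)]]
          continuous_on_compose2[OF cN(4)[OF c(2,4)]] continuous_intros) auto
    then have "continuous_on (\<phi> ` (U \<inter> U') \<times> \<psi> ` (V \<inter> V'))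
      (map_prod \<phi>' \<psi>' \<circ> inv_into (U \<times> V) (map_prod \<phi> \<psi>))"
      by (rule continuous_on_eq)
        (auto simp: inv_into_map_prod[OF cM(1)[OF c(1)] cN(1)[OF c(2)]])
    then show ?thesis unfolding eq using cM(3)[OF c(1,3)] cN(3)[OF c(2,4)] by (auto intro: openin_Times)
  qed
  have inj: "inj_on \<theta> X" if "(X, \<theta>) \<in> charts (prod_mfd M N)" for X \<theta>
    by (rule charts_prodE[OF that])
      (auto intro!: map_prod_inj_on compatible_chartsD(1)[OF assms(1)] compatible_chartsD(1)[OF assms(2)])
  have int: "openin (top_of_set (model (prod_mfd M N))) (\<theta> ` (X \<inter> Y))"
      "continuous_on (\<theta> ` (X \<inter> Y)) (\<upsilon> \<circ> inv_into X \<theta>)"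
    if X: "(X, \<theta>) \<in> charts (prod_mfd M N)" and Y: "(Y, \<upsilon>) \<in> charts (prod_mfd M N)" for X \<theta> Y \<upsilon>
    by (rule charts_prodE[OF X], rule charts_prodE[OF Y], use * in simp)+
  show ?thesis
    unfolding compatible_charts_def using inj int(1)[of X \<theta> X \<theta> for X \<theta>] int by (auto simp: Int_absorb)
qed

section \<open>The topology generated by the charts\<close>

lemma openin_chartI:
  "(U, \<phi>) \<in> charts M \<Longrightarrow> W \<subseteq> U \<Longrightarrow> openin (top_of_set (model M)) (\<phi> ` W) \<Longrightarrow> openin (mfd_top M) W"
  unfolding mfd_top_def by (rule topology_generated_by_Basis) auto

text \<open>The topology is only generated by sets that are open in some chart, so openness in a
  prescribed chart needs an induction over the generation; continuity of the transition maps settles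
  the generators.\<close>

lemma openin_chartD:
  assumes "compatible_charts M" "(U, \<phi>) \<in> charts M" "openin (mfd_top M) W"
  shows "openin (top_of_set (model M)) (\<phi> ` (U \<inter> W))"
proof -
  have "generate_topology_on {W. \<exists>(U, \<phi>)\<in>charts M. W \<subseteq> U \<and> openin (top_of_set (model M)) (\<phi> ` W)} W"
    using assms(3) unfolding mfd_top_def openin_topology_generated_by_iff .
  then show ?thesis
  proof induction
    case Empty
    then show ?case by simp
  next
    case (Int a b)
    have "\<phi> ` (U \<inter> (a \<inter> b)) = \<phi> ` (U \<inter> a) \<inter> \<phi> ` (U \<inter> b)"
      using compatible_chartsD(1)[OF assms(1,2)] by (auto simp: inj_on_def) 
    then show ?case using Int by (auto intro: openin_Int)
  next
    case (UN K)
    have "\<phi> ` (U \<inter> \<Union> K) = (\<Union>k\<in>K. \<phi> ` (U \<inter> k))" by auto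
    then show ?case using UN by auto
  next
    case (Basis s)
    then obtain V \<psi> where V: "(V, \<psi>) \<in> charts M" "s \<subseteq> V" "openin (top_of_set (model M)) (\<psi> ` s)" by auto
    note c = compatible_chartsD[OF assms(1)]
    \<comment> \<open>In the coordinates of \<open>\<phi>\<close>, the part of \<open>s\<close>
      inside \<open>U\<close> is the preimage of its \<open>\<psi>\<close>-image under the
      transition map.\<close>
    have "openin (top_of_set (\<phi> ` (U \<inter> V))) (\<phi> ` (U \<inter> V) \<inter> (\<psi> \<circ> inv_into U \<phi>) -` (\<psi> ` s))"
      by (rule continuous_openin_preimage[OF c(4)[OF assms(2) V(1)] _ V(3)])
        (use c(1)[OF assms(2)] openin_imp_subset[OF c(2)[OF V(1)]] in auto)
    then have "openin (top_of_set (model M)) (\<phi> ` (U \<inter> V) \<inter> (\<psi> \<circ> inv_into U \<phi>) -` (\<psi> ` s))"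
      using openin_trans c(3)[OF assms(2) V(1)] by blast
    moreover have "\<phi> ` (U \<inter> V) \<inter> (\<psi> \<circ> inv_into U \<phi>) -` (\<psi> ` s) = \<phi> ` (U \<inter> s)"
    proof -
      have "\<psi> q \<in> \<psi> ` s \<longleftrightarrow> q \<in> s" if "q \<in> V" for q
        using that inj_on_image_mem_iff[OF c(1)[OF V(1)] that V(2)] by simp
      then show ?thesis using c(1)[OF assms(2)] V(2) by (auto; force)
    qed
    ultimately show ?case by simp
  qed
qed

lemma openin_chart: "compatible_charts M \<Longrightarrow> (U, \<phi>) \<in> charts M \<Longrightarrow> openin (mfd_top M) U"
  by (rule openin_chartI[OF _ _ compatible_chartsD(2)]) auto

lemma openin_mfd_points:
  assumes "openin (mfd_top M) W" shows "W \<subseteq> points M"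
  using openin_subset[OF assms] unfolding mfd_top_def topology_generated_by_topspace points_def by auto

lemma openin_points:
  assumes "compatible_charts M" shows "openin (mfd_top M) (points M)"
  unfolding points_def using openin_chart[OF assms] by auto

lemma topspace_mfd: "compatible_charts M \<Longrightarrow> topspace (mfd_top M) = points M"
  by (meson openin_mfd_points openin_points openin_subset openin_topspace subset_antisym)

lemma openin_vec_mfd: "openin (mfd_top (vec_mfd :: ('e::euclidean_space, 'e) mfd)) W \<longleftrightarrow> open W"
proof
  assume "openin (mfd_top (vec_mfd :: ('e, 'e) mfd)) W"
  from openin_chartD[OF compatible_vec _ this, of UNIV id] show "open W"
    by (simp add: vec_mfd_def)
next
  assume "open W" then show "openin (mfd_top (vec_mfd :: ('e, 'e) mfd)) W"
    by (intro openin_chartI[of UNIV id]) (auto simp: vec_mfd_def)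
qed

lemma points_vec [simp]: "points vec_mfd = UNIV"
  by (simp add: points_def vec_mfd_def)

lemma charts_vec [simp]: "charts vec_mfd = {(UNIV, id)}"
  by (simp add: vec_mfd_def)

section \<open>Local representatives, continuity and composition of smooth maps\<close>

lemma smooth_mapE:
  assumes "smooth_map M W N F" "p \<in> W" "(U, \<phi>) \<in> charts M" "(V, \<psi>) \<in> charts N" "p \<in> U" "F p \<in> V"
  obtains Q where "openin (mfd_top M) Q" "p \<in> Q" "Q \<subseteq> U \<inter> W" "F ` Q \<subseteq> V"
    "smooth_on (\<phi> ` Q) (\<psi> \<circ> F \<circ> inv_into U \<phi>)"
  using assms unfolding smooth_map_def by fast

lemma smooth_mapI:
  assumes "F ` W \<subseteq> points N"
    "\<And>p U \<phi> V \<psi>. p \<in> W \<Longrightarrow> (U, \<phi>) \<in> charts M \<Longrightarrow> (V, \<psi>) \<in> charts N \<Longrightarrow> p \<in> U \<Longrightarrow> F p \<in> V \<Longrightarrow>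
      \<exists>Q. openin (mfd_top M) Q \<and> p \<in> Q \<and> Q \<subseteq> U \<inter> W \<and> F ` Q \<subseteq> V \<and>
          smooth_on (\<phi> ` Q) (\<psi> \<circ> F \<circ> inv_into U \<phi>)"
  shows "smooth_map M W N F"
  using assms unfolding smooth_map_def by fast

lemma smooth_map_points: "smooth_map M W N F \<Longrightarrow> p \<in> W \<Longrightarrow> F p \<in> points N"
  unfolding smooth_map_def by auto

lemma smooth_map_refine:
  assumes "smooth_map M W N F" "compatible_charts M" "compatible_charts N"
    "p \<in> W" "(U, \<phi>) \<in> charts M" "(V, \<psi>) \<in> charts N" "p \<in> U" "F p \<in> V"
    "openin (mfd_top N) V'" "F p \<in> V'"
  obtains Q where "openin (mfd_top M) Q" "p \<in> Q" "Q \<subseteq> U \<inter> W" "F ` Q \<subseteq> V \<inter> V'"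
    "smooth_on (\<phi> ` Q) (\<psi> \<circ> F \<circ> inv_into U \<phi>)"
proof -
  obtain Q where Q: "openin (mfd_top M) Q" "p \<in> Q" "Q \<subseteq> U \<inter> W" "F ` Q \<subseteq> V"
    "smooth_on (\<phi> ` Q) (\<psi> \<circ> F \<circ> inv_into U \<phi>)"
    using smooth_mapE[OF assms(1,4-8)] .
  note cM = compatible_chartsD[OF assms(2,5)] and cN = compatible_chartsD[OF assms(3,6)]
  have inv: "inv_into U \<phi> (\<phi> q) = q" if "q \<in> Q" for q using that Q(3) cM(1) by auto
  define R where "R = {q \<in> Q. F q \<in> V'}"
  have RQ: "R \<subseteq> Q" by (auto simp: R_def)
  have "openin (top_of_set (\<phi> ` Q)) (\<phi> ` Q \<inter> (\<psi> \<circ> F \<circ> inv_into U \<phi>) -` (\<psi> ` (V \<inter> V')))"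
    by (rule continuous_openin_preimage[OF smooth_on_continuous[OF Q(5)] _ openin_chartD[OF assms(3,6,9)]])
      (use inv Q(4) openin_imp_subset[OF cN(2)] in \<open>auto simp: image_subset_iff\<close>)
  moreover have "openin (top_of_set (model M)) (\<phi> ` Q)"
    using openin_chartD[OF assms(2,5) Q(1)] Q(3) by (simp add: Int_absorb1)
  ultimately have "openin (top_of_set (model M)) (\<phi> ` Q \<inter> (\<psi> \<circ> F \<circ> inv_into U \<phi>) -` (\<psi> ` (V \<inter> V')))"
    using openin_trans by blast
  moreover have "\<phi> ` Q \<inter> (\<psi> \<circ> F \<circ> inv_into U \<phi>) -` (\<psi> ` (V \<inter> V')) = \<phi> ` R"
  proof -
    have "\<psi> (F q) \<in> \<psi> ` (V \<inter> V') \<longleftrightarrow> F q \<in> V'" if "q \<in> Q" for q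
      using Q(4) that cN(1) by (auto simp: inj_on_def)
    then have "(\<psi> \<circ> F \<circ> inv_into U \<phi>) (\<phi> q) \<in> \<psi> ` (V \<inter> V') \<longleftrightarrow> q \<in> R" if "q \<in> Q" for q
      using that inv by (simp add: R_def)
    then show ?thesis using RQ by blast
  qed
  ultimately have "openin (mfd_top M) R" using openin_chartI[OF assms(5)] RQ Q(3) by auto
  moreover have "smooth_on (\<phi> ` R) (\<psi> \<circ> F \<circ> inv_into U \<phi>)"
    by (rule smooth_on_subset[OF Q(5)]) (use RQ in auto)
  ultimately show ?thesis using that[of R] Q assms(10) RQ by (auto simp: R_def)
qed

lemma openin_smooth_map_preimage:
  assumes "smooth_map M W N F" "compatible_charts M" "compatible_charts N"
    "openin (mfd_top M) W" "openin (mfd_top N) V'"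
  shows "openin (mfd_top M) {p \<in> W. F p \<in> V'}"
proof (subst openin_subopen, safe)
  fix p assume p: "p \<in> W" "F p \<in> V'"
  obtain U \<phi> where U: "(U, \<phi>) \<in> charts M" "p \<in> U"
    by (rule pointsE[OF subsetD[OF openin_mfd_points[OF assms(4)] p(1)]])
  obtain V \<psi> where V: "(V, \<psi>) \<in> charts N" "F p \<in> V"
    by (rule pointsE[OF subsetD[OF openin_mfd_points[OF assms(5)] p(2)]])
  obtain Q where "openin (mfd_top M) Q" "p \<in> Q" "Q \<subseteq> U \<inter> W" "F ` Q \<subseteq> V \<inter> V'"
    using smooth_map_refine[OF assms(1-3) p(1) U(1) V(1) U(2) V(2) assms(5) p(2)] .
  then show "\<exists>T. openin (mfd_top M) T \<and> p \<in> T \<and> T \<subseteq> {p \<in> W. F p \<in> V'}" by blast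
qed

lemma smooth_map_compose:
  assumes F: "smooth_map M W N F" and G: "smooth_map N V P G"
    and comp: "compatible_charts M" "compatible_charts N" and sub: "F ` W \<subseteq> V"
  shows "smooth_map M W P (\<lambda>x. G (F x))"
proof (rule smooth_mapI)
  show "(\<lambda>x. G (F x)) ` W \<subseteq> points P" using G sub by (auto simp: smooth_map_def)
  fix p U \<phi> X \<theta> assume p: "p \<in> W" "(U, \<phi>) \<in> charts M" "(X, \<theta>) \<in> charts P" "p \<in> U" "G (F p) \<in> X"
  obtain Y \<psi> where Y: "(Y, \<psi>) \<in> charts N" "F p \<in> Y"
    by (rule pointsE[OF smooth_map_points[OF F p(1)]])
  have Fp: "F p \<in> V" using p sub by auto
  obtain R where R: "openin (mfd_top N) R" "F p \<in> R" "R \<subseteq> Y \<inter> V" "G ` R \<subseteq> X"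
    "smooth_on (\<psi> ` R) (\<theta> \<circ> G \<circ> inv_into Y \<psi>)"
    using smooth_mapE[OF G Fp Y(1) p(3) Y(2) p(5)] .
  \<comment> \<open>The refinement is taken against \<open>R\<close>, so that \<open>F\<close> maps
    \<open>Q\<close> to where the representative of \<open>G\<close> is known to be smooth.\<close>
  obtain Q where Q: "openin (mfd_top M) Q" "p \<in> Q" "Q \<subseteq> U \<inter> W" "F ` Q \<subseteq> Y \<inter> R"
    "smooth_on (\<phi> ` Q) (\<psi> \<circ> F \<circ> inv_into U \<phi>)"
    using smooth_map_refine[OF F comp p(1,2) Y(1) p(4) Y(2) R(1,2)] .
  have inv: "inv_into U \<phi> (\<phi> q) = q" if "q \<in> Q" for q
    using that Q(3) compatible_chartsD(1)[OF comp(1) p(2)] by auto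
  have inv': "inv_into Y \<psi> (\<psi> (F q)) = F q" if "q \<in> Q" for q
    using that Q(4) compatible_chartsD(1)[OF comp(2) Y(1)] by auto
  have "smooth_on (\<phi> ` Q) (\<lambda>x. (\<theta> \<circ> G \<circ> inv_into Y \<psi>) ((\<psi> \<circ> F \<circ> inv_into U \<phi>) x))"
    by (rule smooth_on_compose[OF Q(5) R(5)]) (use inv Q(4) in auto)
  then have "smooth_on (\<phi> ` Q) (\<theta> \<circ> (\<lambda>x. G (F x)) \<circ> inv_into U \<phi>)"
    by (rule smooth_on_cong) (auto simp: inv inv')
  then show "\<exists>Q. openin (mfd_top M) Q \<and> p \<in> Q \<and> Q \<subseteq> U \<inter> W \<and> (\<lambda>x. G (F x)) ` Q \<subseteq> X \<and>
    smooth_on (\<phi> ` Q) (\<theta> \<circ> (\<lambda>x. G (F x)) \<circ> inv_into U \<phi>)"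
    using Q R(4) by (intro exI[of _ Q]) (auto simp: image_subset_iff)
qed

lemma smooth_map_Pair:
  assumes "smooth_map M W N F" "smooth_map M W P G" "compatible_charts M"
  shows "smooth_map M W (prod_mfd N P) (\<lambda>x. (F x, G x))"
proof (rule smooth_mapI)
  show "(\<lambda>x. (F x, G x)) ` W \<subseteq> points (prod_mfd N P)"
    using assms by (auto simp: smooth_map_def image_subset_iff intro!: points_prodI)
  fix p U \<phi> X \<theta> assume p: "p \<in> W" "(U, \<phi>) \<in> charts M" "(X, \<theta>) \<in> charts (prod_mfd N P)" "p \<in> U" "(F p, G p) \<in> X"
  obtain Y \<psi> Z \<zeta> where X: "X = Y \<times> Z" "\<theta> = map_prod \<psi> \<zeta>" "(Y, \<psi>) \<in> charts N" "(Z, \<zeta>) \<in> charts P"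
    using p(3) by (auto simp: prod_mfd_def)
  have m: "F p \<in> Y" "G p \<in> Z" using p X by auto
  obtain Q where Q: "openin (mfd_top M) Q" "p \<in> Q" "Q \<subseteq> U \<inter> W" "F ` Q \<subseteq> Y"
    "smooth_on (\<phi> ` Q) (\<psi> \<circ> F \<circ> inv_into U \<phi>)"
    using smooth_mapE[OF assms(1) p(1,2) X(3) p(4) m(1)] .
  obtain R where R: "openin (mfd_top M) R" "p \<in> R" "R \<subseteq> U \<inter> W" "G ` R \<subseteq> Z"
    "smooth_on (\<phi> ` R) (\<zeta> \<circ> G \<circ> inv_into U \<phi>)"
    using smooth_mapE[OF assms(2) p(1,2) X(4) p(4) m(2)] .
  have "smooth_on (\<phi> ` (Q \<inter> R)) (\<lambda>x. ((\<psi> \<circ> F \<circ> inv_into U \<phi>) x, (\<zeta> \<circ> G \<circ> inv_into U \<phi>) x))"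
    by (rule smooth_on_Pair[OF smooth_on_subset[OF Q(5)] smooth_on_subset[OF R(5)]]) auto
  then have "smooth_on (\<phi> ` (Q \<inter> R)) (\<theta> \<circ> (\<lambda>x. (F x, G x)) \<circ> inv_into U \<phi>)"
    by (rule smooth_on_cong) (auto simp: X)
  then show "\<exists>Q. openin (mfd_top M) Q \<and> p \<in> Q \<and> Q \<subseteq> U \<inter> W \<and> (\<lambda>x. (F x, G x)) ` Q \<subseteq> X \<and>
    smooth_on (\<phi> ` Q) (\<theta> \<circ> (\<lambda>x. (F x, G x)) \<circ> inv_into U \<phi>)"
    using Q R X by (intro exI[of _ "Q \<inter> R"]) auto
qed

lemma smooth_map_subset:
  assumes "smooth_map M W N F" "openin (mfd_top M) W'" "W' \<subseteq> W"
  shows "smooth_map M W' N F"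
proof (rule smooth_mapI)
  show "F ` W' \<subseteq> points N" using assms by (auto simp: smooth_map_def)
  fix p U \<phi> V \<psi> assume p: "p \<in> W'" "(U, \<phi>) \<in> charts M" "(V, \<psi>) \<in> charts N" "p \<in> U" "F p \<in> V"
  have "p \<in> W" using p assms by auto
  then obtain Q where Q: "openin (mfd_top M) Q" "p \<in> Q" "Q \<subseteq> U \<inter> W" "F ` Q \<subseteq> V"
    "smooth_on (\<phi> ` Q) (\<psi> \<circ> F \<circ> inv_into U \<phi>)"
    using smooth_mapE[OF assms(1) _ p(2-5)] by blast
  have "smooth_on (\<phi> ` (Q \<inter> W')) (\<psi> \<circ> F \<circ> inv_into U \<phi>)"
    by (rule smooth_on_subset[OF Q(5)]) auto
  then show "\<exists>Q. openin (mfd_top M) Q \<and> p \<in> Q \<and> Q \<subseteq> U \<inter> W' \<and> F ` Q \<subseteq> V \<and>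
    smooth_on (\<phi> ` Q) (\<psi> \<circ> F \<circ> inv_into U \<phi>)"
    using Q assms p by (intro exI[of _ "Q \<inter> W'"]) auto
qed

lemma smooth_map_const:
  assumes "compatible_charts M" "openin (mfd_top M) W" "y \<in> points N"
  shows "smooth_map M W N (\<lambda>x. y)"
proof (rule smooth_mapI)
  show "(\<lambda>x. y) ` W \<subseteq> points N" using assms by auto
  fix p U \<phi> V \<psi> assume p: "p \<in> W" "(U, \<phi>) \<in> charts M" "(V, \<psi>) \<in> charts N" "p \<in> U" "y \<in> V"
  then show "\<exists>Q. openin (mfd_top M) Q \<and> p \<in> Q \<and> Q \<subseteq> U \<inter> W \<and> (\<lambda>x. y) ` Q \<subseteq> V \<and>
    smooth_on (\<phi> ` Q) (\<psi> \<circ> (\<lambda>x. y) \<circ> inv_into U \<phi>)"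
    using assms openin_chart[OF assms(1) p(2)]
    by (intro exI[of _ "U \<inter> W"]) (auto simp: o_def smooth_on_const)
qed

text \<open>In coordinates the identity is a transition map, so smoothness of the transitions is
  used here and not just \<open>compatible_charts\<close>.\<close>

lemma smooth_map_id:
  assumes "manifold M" "openin (mfd_top M) W"
  shows "smooth_map M W M (\<lambda>x. x)"
proof (rule smooth_mapI)
  show "(\<lambda>x. x) ` W \<subseteq> points M" using openin_mfd_points[OF assms(2)] by auto
  fix p U \<phi> V \<psi> assume p: "p \<in> W" "(U, \<phi>) \<in> charts M" "(V, \<psi>) \<in> charts M" "p \<in> U" "p \<in> V"
  have "smooth_on (\<phi> ` (U \<inter> V \<inter> W)) (\<psi> \<circ> inv_into U \<phi>)"
    by (rule smooth_on_subset[OF manifold_transition[OF assms(1) p(2,3)]]) auto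
  then show "\<exists>Q. openin (mfd_top M) Q \<and> p \<in> Q \<and> Q \<subseteq> U \<inter> W \<and> (\<lambda>x. x) ` Q \<subseteq> V \<and>
    smooth_on (\<phi> ` Q) (\<psi> \<circ> (\<lambda>x. x) \<circ> inv_into U \<phi>)"
    using assms p openin_chart[OF manifold_compatible[OF assms(1)]]
    by (intro exI[of _ "U \<inter> V \<inter> W"]) (auto simp: o_def)
qed

lemma smooth_map_vec_iff:
  assumes "open S"
  shows "smooth_map vec_mfd S vec_mfd f \<longleftrightarrow> smooth_on S f"
proof
  assume L: "smooth_map vec_mfd S vec_mfd f"
  show "smooth_on S f"
  proof (rule smooth_on_local)
    fix x assume "x \<in> S"
    then obtain Q where Q: "open Q" "x \<in> Q" "Q \<subseteq> S" "smooth_on Q f"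
      using smooth_mapE[OF L, of x UNIV id UNIV id] by (auto simp: openin_vec_mfd)
    then have "Q \<inter> S = Q" by auto
    then show "\<exists>U. open U \<and> x \<in> U \<and> smooth_on (U \<inter> S) f" using Q by metis
  qed
next
  assume "smooth_on S f" then show "smooth_map vec_mfd S vec_mfd f"
    by (intro smooth_mapI exI[of _ S]) (auto simp: openin_vec_mfd assms)
qed

lemma smooth_map_chart:
  assumes "manifold M" "(U, \<phi>) \<in> charts M"
  shows "smooth_map M U vec_mfd \<phi>"
proof (rule smooth_mapI)
  fix p V \<psi> X \<theta> assume p: "p \<in> U" "(V, \<psi>) \<in> charts M" "(X, \<theta>) \<in> charts (vec_mfd :: ('b, 'b) mfd)" "p \<in> V" "\<phi> p \<in> X"
  then show "\<exists>Q. openin (mfd_top M) Q \<and> p \<in> Q \<and> Q \<subseteq> V \<inter> U \<and> \<phi> ` Q \<subseteq> X \<and>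
     smooth_on (\<psi> ` Q) (\<theta> \<circ> \<phi> \<circ> inv_into V \<psi>)"
    using manifold_transition[OF assms(1) p(2) assms(2)] openin_chart[OF manifold_compatible[OF assms(1)]] assms(2)
    by (intro exI[of _ "V \<inter> U"]) auto
qed auto

text \<open>This manufactures curves in the manifold from curves in a chart image; in any other
  chart they appear composed with a transition map.\<close>

lemma smooth_map_chart_inv:
  fixes M :: "('a, 'e::euclidean_space) mfd" and \<gamma> :: "'v::euclidean_space \<Rightarrow> 'e"
  assumes "manifold M" "(U, \<phi>) \<in> charts M" "smooth_on UNIV \<gamma>" "range \<gamma> \<subseteq> \<phi> ` U"
  shows "smooth_map vec_mfd UNIV M (\<lambda>t. inv_into U \<phi> (\<gamma> t))"
proof (rule smooth_mapI)
  note c = compatible_chartsD[OF manifold_compatible[OF assms(1)] assms(2)]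
  have inU: "inv_into U \<phi> (\<gamma> t) \<in> U" for t using assms(4) by (blast intro: inv_into_into)
  have fi: "\<phi> (inv_into U \<phi> (\<gamma> t)) = \<gamma> t" for t using assms(4) by (blast intro: f_inv_into_f)
  then show "range (\<lambda>t. inv_into U \<phi> (\<gamma> t)) \<subseteq> points M" using assms(2) inU by (auto simp: points_def)
  fix p and X :: "'v set" and \<theta> V \<psi>
  assume p: "(X, \<theta>) \<in> charts vec_mfd" "(V, \<psi>) \<in> charts M" "inv_into U \<phi> (\<gamma> p) \<in> V"
  have X: "X = UNIV" "\<theta> = id" using p(1) by auto
  let ?Q = "\<gamma> -` (\<phi> ` (U \<inter> V))"
  have "openin (top_of_set UNIV) (UNIV \<inter> ?Q)"
    by (rule continuous_openin_preimage[OF smooth_on_continuous[OF assms(3)] _ c(3)[OF p(2)]])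
      (use assms(4) openin_imp_subset[OF c(2)] in auto)
  then have o: "open ?Q" by simp
  have "smooth_on ?Q (\<lambda>t. (\<psi> \<circ> inv_into U \<phi>) (\<gamma> t))"
    by (rule smooth_on_compose[OF smooth_on_subset[OF assms(3)] manifold_transition[OF assms(1,2) p(2)]]) auto
  moreover have "inv_into U \<phi> (\<gamma> q) \<in> V" if "q \<in> ?Q" for q
    using that c(1) by auto
  moreover have "p \<in> ?Q" using inU fi p(3) by (metis IntI image_eqI vimageI2)
  ultimately show "\<exists>Q. openin (mfd_top vec_mfd) Q \<and> p \<in> Q \<and> Q \<subseteq> X \<inter> UNIV \<and>
     (\<lambda>t. inv_into U \<phi> (\<gamma> t)) ` Q \<subseteq> V \<and> smooth_on (\<theta> ` Q) (\<psi> \<circ> (\<lambda>t. inv_into U \<phi> (\<gamma> t)) \<circ> inv_into X \<theta>)"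
    using o X by (intro exI[of _ ?Q]) (auto simp: openin_vec_mfd o_def)
qed

section \<open>Smooth functions along curves and pulled back by smooth maps\<close>

lemma open_smooth_map_vimage:
  assumes "smooth_map vec_mfd UNIV M c" "compatible_charts M" "openin (mfd_top M) W"
  shows "open (c -` W)"
  using openin_smooth_map_preimage[OF assms(1) compatible_vec assms(2) _ assms(3)]
  by (simp add: openin_vec_mfd vimage_def)

lemma smooth_fun_along:
  assumes "smooth_map vec_mfd UNIV M c" "compatible_charts M" "smooth_fun M W f"
  shows "smooth_on (c -` W) (\<lambda>t. f (c t))"
proof -
  have o: "open (c -` W)"
    using open_smooth_map_vimage[OF assms(1,2)] assms(3) by (auto simp: smooth_fun_def)
  have "smooth_map vec_mfd (c -` W) vec_mfd (\<lambda>t. f (c t))"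
    by (rule smooth_map_compose[OF smooth_map_subset[OF assms(1)] _ compatible_vec assms(2)])
      (use assms(3) o in \<open>auto simp: smooth_fun_def openin_vec_mfd\<close>)
  then show ?thesis by (rule iffD1[OF smooth_map_vec_iff[OF o]])
qed

lemma smooth_fun_compose:
  assumes "smooth_map M W N F" "compatible_charts M" "compatible_charts N" "openin (mfd_top M) W" "smooth_fun N V f"
  shows "smooth_fun M {p \<in> W. F p \<in> V} (\<lambda>x. f (F x))"
proof -
  have o: "openin (mfd_top M) {p \<in> W. F p \<in> V}"
    using openin_smooth_map_preimage[OF assms(1-4)] assms(5) by (auto simp: smooth_fun_def)
  show ?thesis unfolding smooth_fun_def
    using o smooth_map_compose[OF smooth_map_subset[OF assms(1) o] _ assms(2,3)] assms(5)
    by (auto simp: smooth_fun_def)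
qed

lemma smooth_fun_chart:
  assumes "manifold M" "(U, \<phi>) \<in> charts M" "bounded_linear l"
  shows "smooth_fun M U (\<lambda>p. l (\<phi> p))"
proof -
  have "smooth_map M U vec_mfd (\<lambda>p. l (\<phi> p))"
    by (rule smooth_map_compose[OF smooth_map_chart[OF assms(1,2)]
          _ manifold_compatible[OF assms(1)] compatible_vec, of UNIV])
      (use assms(3) in \<open>auto simp: smooth_map_vec_iff smooth_on_bounded_linear\<close>)
  then show ?thesis
    using openin_chart[OF manifold_compatible[OF assms(1)] assms(2)] by (simp add: smooth_fun_def)
qed

section \<open>Directional derivatives\<close>

lemma DERIV_along_line:
  fixes f :: "'v::real_normed_vector \<Rightarrow> real"
  assumes "(f has_derivative f') (at (a + s *\<^sub>R u))"
  shows "((\<lambda>s. f (a + s *\<^sub>R u)) has_real_derivative f' u) (at s)"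
proof -
  have "((\<lambda>s. a + s *\<^sub>R u) has_derivative (\<lambda>h. h *\<^sub>R u)) (at s)"
    by (auto intro!: derivative_eq_intros)
  from has_derivative_compose[where g=f, OF this assms]
  have "((\<lambda>s. f (a + s *\<^sub>R u)) has_derivative (\<lambda>h. f' (h *\<^sub>R u))) (at s)" .
  moreover have "(\<lambda>h. f' (h *\<^sub>R u)) = (*) (f' u)"
    using linear_scale[OF has_derivative_linear[OF assms]] by (auto simp: mult.commute)
  ultimately show ?thesis by (simp add: has_field_derivative_def)
qed

text \<open>Both sides are choices over equivalent derivative statements, so the equation is true
  for every \<open>f\<close>.\<close>

lemma deriv_shift: "deriv f t = deriv (\<lambda>s. f (s + t)) 0"
  for f :: "real \<Rightarrow> real"
  using DERIV_shift[of f _ 0 t] by (simp add: deriv_def)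

text \<open>The mean value theorem is used twice: along \<open>u\<close> for the increment of
  \<open>f\<close> over the step in direction \<open>v\<close>, then along \<open>v\<close> for the
  directional derivative \<open>D\<close>.\<close>

lemma second_difference:
  fixes f :: "'v::euclidean_space \<Rightarrow> real"
  assumes f: "Ck (Suc (Suc 0)) S f" and h: "0 < h"
    and S: "\<And>s t. 0 \<le> s \<Longrightarrow> s \<le> h \<Longrightarrow> 0 \<le> t \<Longrightarrow> t \<le> h \<Longrightarrow> x + s *\<^sub>R u + t *\<^sub>R v \<in> S"
  shows "\<exists>s t. 0 < s \<and> s < h \<and> 0 < t \<and> t < h \<and>
    f (x + h *\<^sub>R u + h *\<^sub>R v) - f (x + h *\<^sub>R u) - f (x + h *\<^sub>R v) + f x
    = h * h * frechet_derivative (\<lambda>y. frechet_derivative f (at y) u) (at (x + s *\<^sub>R u + t *\<^sub>R v)) v"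
proof -
  define D where "D = (\<lambda>y. frechet_derivative f (at y) u)"
  have DD: "(D has_derivative frechet_derivative D (at y)) (at y)" if "y \<in> S" for y
    unfolding D_def by (rule Ck_SucE[where n=0, OF _ that]) (use f in simp)
  have d1: "((\<lambda>s. f (x + s *\<^sub>R u + t *\<^sub>R v)) has_real_derivative D (x + s *\<^sub>R u + t *\<^sub>R v)) (at s)"
    if "0 \<le> s" "s \<le> h" "0 \<le> t" "t \<le> h" for s t
    using DERIV_along_line[of f _ "x + t *\<^sub>R v" s u] Ck_SucE[OF f S[OF that]] unfolding D_def
    by (simp add: ac_simps)
  have d2: "((\<lambda>t. D (x + s *\<^sub>R u + t *\<^sub>R v)) has_real_derivative
      frechet_derivative D (at (x + s *\<^sub>R u + t *\<^sub>R v)) v) (at t)"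
    if "0 \<le> s" "s \<le> h" "0 \<le> t" "t \<le> h" for s t
    by (rule DERIV_along_line) (rule DD[OF S[OF that]])
  have "\<exists>s>0. s < h \<and> (f (x + h *\<^sub>R u + h *\<^sub>R v) - f (x + h *\<^sub>R u + 0 *\<^sub>R v)) - (f (x + 0 *\<^sub>R u + h *\<^sub>R v) - f (x + 0 *\<^sub>R u + 0 *\<^sub>R v))
     = (h - 0) * (D (x + s *\<^sub>R u + h *\<^sub>R v) - D (x + s *\<^sub>R u + 0 *\<^sub>R v))"
    using h by (intro MVT2 DERIV_diff d1) auto
  then obtain s where s: "0 < s" "s < h" "f (x + h *\<^sub>R u + h *\<^sub>R v) - f (x + h *\<^sub>R u) - f (x + h *\<^sub>R v) + f x
     = h * (D (x + s *\<^sub>R u + h *\<^sub>R v) - D (x + s *\<^sub>R u + 0 *\<^sub>R v))" by auto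
  have "\<exists>t>0. t < h \<and> D (x + s *\<^sub>R u + h *\<^sub>R v) - D (x + s *\<^sub>R u + 0 *\<^sub>R v)
     = (h - 0) * frechet_derivative D (at (x + s *\<^sub>R u + t *\<^sub>R v)) v"
    using h s by (intro MVT2 d2) auto
  then obtain t where "0 < t" "t < h" "D (x + s *\<^sub>R u + h *\<^sub>R v) - D (x + s *\<^sub>R u + 0 *\<^sub>R v)
     = h * frechet_derivative D (at (x + s *\<^sub>R u + t *\<^sub>R v)) v" by auto
  then show ?thesis using s unfolding D_def[symmetric] by (intro exI[of _ s] exI[of _ t]) auto
qed

text \<open>The second difference is symmetric in \<open>u\<close> and \<open>v\<close>, so the two
  mixed derivatives agree at a pair of points near \<open>x\<close>; by continuity there is no gap
  at \<open>x\<close> itself.\<close>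

lemma frechet_derivative_symmetric:
  fixes f :: "'v::euclidean_space \<Rightarrow> real"
  assumes f: "Ck (Suc (Suc 0)) S f" and S: "open S" "x \<in> S"
  shows "frechet_derivative (\<lambda>y. frechet_derivative f (at y) u) (at x) v
       = frechet_derivative (\<lambda>y. frechet_derivative f (at y) v) (at x) u"
proof (rule ccontr)
  let ?A = "\<lambda>u v y. frechet_derivative (\<lambda>y. frechet_derivative f (at y) u) (at y) v"
  assume "?A u v x \<noteq> ?A v u x"
  \<comment> \<open>Half of the gap, so that two errors below \<open>e\<close> contradict
    it.\<close>
  define e where "e = dist (?A u v x) (?A v u x) / 2"
  then have e: "e > 0" using \<open>?A u v x \<noteq> ?A v u x\<close> zero_less_dist_iff[of "?A u v x" "?A v u x"] unfolding e_def by linarith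
  have cont: "continuous_on S (?A u v)" for u v using f by simp
  have ev: "\<forall>\<^sub>F y in nhds x. y \<in> S \<and> dist (?A u v y) (?A u v x) < e \<and> dist (?A v u y) (?A v u x) < e"
    using cont[of u v] cont[of v u] S e
    by (auto simp: continuous_on_eq_continuous_at isCont_def tendsto_iff eventually_at_filter
        eventually_conj_iff eventually_nhds_in_open elim!: eventually_mono dest!: bspec)
  then obtain r where r: "r > 0" "\<And>y. dist y x < r \<Longrightarrow>
     y \<in> S \<and> dist (?A u v y) (?A u v x) < e \<and> dist (?A v u y) (?A v u x) < e"
    unfolding eventually_nhds_metric by blast
  \<comment> \<open>The summand 1 keeps \<open>N\<close> positive when \<open>u\<close> and
    \<open>v\<close> vanish. With \<open>h * N = r / 2\<close> the whole parallelogram lies in the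
    ball of radius \<open>r\<close>.\<close>
  define N where "N = norm u + norm v + 1"
  have N: "N > 0" by (simp add: N_def add_nonneg_pos)
  define h where "h = r / N / 2"
  have h: "h > 0" using r(1) N by (simp add: h_def)
  have near: "dist (x + s *\<^sub>R u + t *\<^sub>R v) x < r" if "0 \<le> s" "s \<le> h" "0 \<le> t" "t \<le> h" for s t
  proof -
    have "dist (x + s *\<^sub>R u + t *\<^sub>R v) x = norm (s *\<^sub>R u + t *\<^sub>R v)" by (simp add: dist_norm add.assoc)
    also have "\<dots> \<le> s * norm u + t * norm v"
      using that norm_triangle_ineq[of "s *\<^sub>R u" "t *\<^sub>R v"] by simp
    also have "\<dots> \<le> h * norm u + h * norm v" using that by (intro add_mono mult_right_mono) auto
    also have "\<dots> \<le> h * N" using h by (simp add: N_def algebra_simps)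
    also have "\<dots> = r / 2"
      using N by (simp add: h_def)
    finally show ?thesis using r(1) by simp
  qed
  have inS: "x + s *\<^sub>R u + t *\<^sub>R v \<in> S"
    if "0 \<le> s" "s \<le> h" "0 \<le> t" "t \<le> h" for s t
    by (rule conjunct1[OF r(2)[OF near[OF that]]])
  have inS': "x + s *\<^sub>R v + t *\<^sub>R u \<in> S"
    if "0 \<le> s" "s \<le> h" "0 \<le> t" "t \<le> h" for s t
    by (subst add.assoc, subst add.commute[of "s *\<^sub>R v"], subst add.assoc[symmetric])
      (rule inS[OF that(3,4,1,2)])
  obtain s t where st: "0 < s" "s < h" "0 < t" "t < h"
    "f (x + h *\<^sub>R u + h *\<^sub>R v) - f (x + h *\<^sub>R u) - f (x + h *\<^sub>R v) + f x = h * h * ?A u v (x + s *\<^sub>R u + t *\<^sub>R v)"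
    using second_difference[OF f h inS] by blast
  obtain s' t' where st': "0 < s'" "s' < h" "0 < t'" "t' < h"
    "f (x + h *\<^sub>R v + h *\<^sub>R u) - f (x + h *\<^sub>R v) - f (x + h *\<^sub>R u) + f x = h * h * ?A v u (x + s' *\<^sub>R v + t' *\<^sub>R u)"
    using second_difference[OF f h inS'] by blast
  have "f (x + h *\<^sub>R v + h *\<^sub>R u) = f (x + h *\<^sub>R u + h *\<^sub>R v)" by (simp add: ac_simps)
  then have "h * h * ?A u v (x + s *\<^sub>R u + t *\<^sub>R v) = h * h * ?A v u (x + s' *\<^sub>R v + t' *\<^sub>R u)"
    using st(5) st'(5) by linarith
  then have eq: "?A u v (x + s *\<^sub>R u + t *\<^sub>R v) = ?A v u (x + s' *\<^sub>R v + t' *\<^sub>R u)" using h by simp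
  have st0: "0 \<le> s" "s \<le> h" "0 \<le> t" "t \<le> h" "0 \<le> s'" "s' \<le> h" "0 \<le> t'" "t' \<le> h"
    using st st' by simp_all
  have "x + s' *\<^sub>R v + t' *\<^sub>R u = x + t' *\<^sub>R u + s' *\<^sub>R v" by (simp add: add_ac)
  then have near': "dist (x + s' *\<^sub>R v + t' *\<^sub>R u) x < r" using near[OF st0(7,8,5,6)] by (simp only:)
  have 1: "dist (?A u v (x + s *\<^sub>R u + t *\<^sub>R v)) (?A u v x) < e"
    by (rule conjunct1[OF conjunct2[OF r(2)[OF near[OF st0(1-4)]]]])
  have 2: "dist (?A v u (x + s' *\<^sub>R v + t' *\<^sub>R u)) (?A v u x) < e"
    by (rule conjunct2[OF conjunct2[OF r(2)[OF near']]])
  have "dist (?A u v x) (?A v u x) < e + e"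
    by (rule dist_triangle_less_add[of _ "?A u v (x + s *\<^sub>R u + t *\<^sub>R v)"])
      (use 1 2 eq in \<open>simp_all add: dist_commute\<close>)
  then show False by (simp add: e_def)
qed

text \<open>The second claim is recorded because \<open>deriv\<close> is total: taking a sign out of
  the outer derivative requires that this derivative exists.\<close>

lemma mixed_partials:
  fixes F :: "real \<Rightarrow> real \<Rightarrow> real"
  assumes S: "open S" "(0, 0) \<in> S" and F: "Ck (Suc (Suc 0)) S (\<lambda>z. F (fst z) (snd z))"
  shows "deriv (\<lambda>s. deriv (\<lambda>t. F s t) 0) 0 = deriv (\<lambda>t. deriv (\<lambda>s. F s t) 0) 0" (is ?thesis1)
    and "((\<lambda>s. deriv (\<lambda>t. F s t) 0) has_real_derivative deriv (\<lambda>s. deriv (\<lambda>t. F s t) 0) 0) (at 0)" (is ?thesis2)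
proof -
  let ?F = "\<lambda>z. F (fst z) (snd z)"
  have ev: "\<forall>\<^sub>F s in nhds (0::real). (s, 0) \<in> S" "\<forall>\<^sub>F s in nhds (0::real). (0, s) \<in> S"
    by (rule topological_tendstoD[OF _ S]; intro tendsto_Pair tendsto_const filterlim_ident)+
  have 1: "deriv (\<lambda>t. F s t) 0 = frechet_derivative ?F (at (s, 0)) (0, 1)" if "(s, 0) \<in> S" for s
    using DERIV_along_line[of ?F _ "(s, 0)" 0 "(0, 1)"] Ck_SucE[OF F that] by (intro DERIV_imp_deriv) simp
  have 2: "deriv (\<lambda>s. F s t) 0 = frechet_derivative ?F (at (0, t)) (1, 0)" if "(0, t) \<in> S" for t
    using DERIV_along_line[of ?F _ "(0, t)" 0 "(1, 0)"] Ck_SucE[OF F that] by (intro DERIV_imp_deriv) simp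
  have C: "Ck (Suc 0) S (\<lambda>z. frechet_derivative ?F (at z) v)" for v
    using F unfolding Ck.simps(2)[of "Suc 0"] by blast
  have "((\<lambda>s. frechet_derivative ?F (at (s, 0)) (0, 1)) has_real_derivative
      frechet_derivative (\<lambda>z. frechet_derivative ?F (at z) (0, 1)) (at (0, 0)) (1, 0)) (at 0)"
    using DERIV_along_line[of "\<lambda>z. frechet_derivative ?F (at z) (0, 1)" _ "(0, 0)" 0 "(1, 0)"] Ck_SucE[OF C S(2)]
    by simp
  moreover have "\<forall>\<^sub>F s in nhds 0. deriv (\<lambda>t. F s t) 0 = frechet_derivative ?F (at (s, 0)) (0, 1)"
    using ev(1) by (rule eventually_mono) (use 1 in simp)
  ultimately have D: "((\<lambda>s. deriv (\<lambda>t. F s t) 0) has_real_derivative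
      frechet_derivative (\<lambda>z. frechet_derivative ?F (at z) (0, 1)) (at (0, 0)) (1, 0)) (at 0)"
    by (subst DERIV_cong_ev[OF refl _ refl])
  then show ?thesis2 using DERIV_imp_deriv[OF D] by simp
  have "deriv (\<lambda>s. deriv (\<lambda>t. F s t) 0) 0 = frechet_derivative (\<lambda>z. frechet_derivative ?F (at z) (0, 1)) (at (0, 0)) (1, 0)"
    by (rule DERIV_imp_deriv[OF D])
  also have "\<dots> = frechet_derivative (\<lambda>z. frechet_derivative ?F (at z) (1, 0)) (at (0, 0)) (0, 1)"
    by (rule frechet_derivative_symmetric[OF F S])
  also have "\<dots> = deriv (\<lambda>t. frechet_derivative ?F (at (0, t)) (1, 0)) 0"
    using DERIV_along_line[of "\<lambda>z. frechet_derivative ?F (at z) (1, 0)" _ "(0, 0)" 0 "(0, 1)"] Ck_SucE[OF C S(2)]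
    by (intro DERIV_imp_deriv[symmetric]) simp
  also have "\<dots> = deriv (\<lambda>t. deriv (\<lambda>s. F s t) 0) 0"
    by (rule deriv_cong_ev[OF eventually_mono[OF ev(2)]]) (use 2 in auto)
  finally show ?thesis1 .
qed

section \<open>Lie algebras and exponential maps\<close>

locale lie_group_algebra =
  fixes G :: "('a, 'e::euclidean_space) lgroup" and g :: "'d::real_vector set"
    and br :: "'d \<Rightarrow> 'd \<Rightarrow> 'd" and ex :: "'d \<Rightarrow> 'a"
  assumes lie: "lie_group G" and alg: "has_lie_algebra G g br ex"
begin

sublocale group G using lie by (simp add: lie_group_def)

lemma manifold: "manifold (man G)" and points: "points (man G) = carrier G"
  using lie by (auto simp: lie_group_def)

lemma compatible: "compatible_charts (man G)"
  by (rule manifold_compatible[OF manifold])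

lemma open_carrier: "openin (mfd_top (man G)) (carrier G)"
  using openin_points[OF compatible] points by simp

lemma smooth_map_carrier: "smooth_map M W (man G) a \<Longrightarrow> x \<in> W \<Longrightarrow> a x \<in> carrier G"
  using smooth_map_points[of M W "man G" a x] points by simp

lemma smooth_map_mult:
  assumes "compatible_charts M" "smooth_map M W (man G) a" "smooth_map M W (man G) b"
  shows "smooth_map M W (man G) (\<lambda>x. a x \<otimes>\<^bsub>G\<^esub> b x)"
proof -
  have "smooth_map M W (man G) (\<lambda>x. (\<lambda>(x, y). x \<otimes>\<^bsub>G\<^esub> y) (a x, b x))"
    by (rule smooth_map_compose[OF smooth_map_Pair[OF assms(2,3,1)] _ assms(1) compatible_prod[OF compatible compatible],
          where V="carrier G \<times> carrier G"])
      (use lie smooth_map_carrier[OF assms(2)] smooth_map_carrier[OF assms(3)] in \<open>auto simp: lie_group_def\<close>)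
  then show ?thesis by simp
qed

lemma smooth_map_inv:
  assumes "compatible_charts M" "smooth_map M W (man G) a"
  shows "smooth_map M W (man G) (\<lambda>x. inv\<^bsub>G\<^esub> (a x))"
  by (rule smooth_map_compose[OF assms(2) _ assms(1) compatible, where V="carrier G"])
    (use lie smooth_map_carrier[OF assms(2)] in \<open>auto simp: lie_group_def\<close>)

lemma smooth_map_constant:
  "compatible_charts M \<Longrightarrow> openin (mfd_top M) W \<Longrightarrow> x \<in> carrier G \<Longrightarrow> smooth_map M W (man G) (\<lambda>_. x)"
  by (rule smooth_map_const) (auto simp: points)

section \<open>The exponential map and velocities of curves at the unit\<close>

lemma subspace_alg: "subspace g"
  using alg by (simp add: has_lie_algebra_def)

lemma scale_alg: "X \<in> g \<Longrightarrow> t *\<^sub>R X \<in> g"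
  using subspace_alg by (rule subspace_scale)

lemma ex_add:
  assumes "X \<in> g" shows "ex ((s + t) *\<^sub>R X) = ex (s *\<^sub>R X) \<otimes>\<^bsub>G\<^esub> ex (t *\<^sub>R X)"
proof -
  have "\<forall>X\<in>g. \<forall>s t. ex ((s + t) *\<^sub>R X) = ex (s *\<^sub>R X) \<otimes>\<^bsub>G\<^esub> ex (t *\<^sub>R X)"
    using alg unfolding has_lie_algebra_def by (elim conjE)
  then show ?thesis using assms by blast
qed

lemma smooth_ex_linear:
  assumes "linear (L :: 'e \<Rightarrow> 'd)" "range L \<subseteq> g"
  shows "smooth_map vec_mfd UNIV (man G) (ex \<circ> L)"
proof -
  have "\<forall>L::'e \<Rightarrow> 'd. linear L \<and> range L \<subseteq> g \<longrightarrow> smooth_map vec_mfd UNIV (man G) (ex \<circ> L)"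
    using alg unfolding has_lie_algebra_def by (elim conjE)
  then show ?thesis using assms by simp
qed

lemma smooth_ex:
  fixes l :: "'v::euclidean_space \<Rightarrow> real"
  assumes "X \<in> g" "smooth_on UNIV l"
  shows "smooth_map vec_mfd UNIV (man G) (\<lambda>v. ex (l v *\<^sub>R X))"
proof -
  \<comment> \<open>Smoothness of \<open>ex\<close> is given along linear maps out of
    \<open>'e\<close>, so the scalar parameter is routed through the line spanned by a basis vector
    of \<open>'e\<close>.\<close>
  obtain b :: 'e where b: "b \<in> Basis" using nonempty_Basis by blast
  define L where "L = (\<lambda>e::'e. (e \<bullet> b) *\<^sub>R X)"
  have L: "linear L" unfolding L_def by (rule linearI) (auto simp: inner_add_left scaleR_add_left)
  have "smooth_map vec_mfd UNIV (man G) (\<lambda>v. (ex \<circ> L) (l v *\<^sub>R b))"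
    by (rule smooth_map_compose[OF _ smooth_ex_linear[OF L] compatible_vec compatible_vec])
      (use smooth_on_scaleR_left[OF assms(2)] assms(1) scale_alg in \<open>auto simp: smooth_map_vec_iff L_def\<close>)
  then show ?thesis using b by (simp add: L_def)
qed

lemma smooth_ex_curve: "X \<in> g \<Longrightarrow> smooth_map vec_mfd UNIV (man G) (\<lambda>t::real. ex (t *\<^sub>R X))"
  by (rule smooth_ex) (auto intro: smooth_on_bounded_linear)

lemma ex_carrier: "X \<in> g \<Longrightarrow> ex X \<in> carrier G"
  using smooth_map_carrier[OF smooth_ex_curve, of X 1] by simp

lemma ex_zero: "ex 0 = \<one>\<^bsub>G\<^esub>"
proof -
  have z: "0 \<in> g" using subspace_alg by (rule subspace_0)
  have "ex 0 = ex 0 \<otimes>\<^bsub>G\<^esub> ex 0" using ex_add[OF z, of 0 0] by simp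
  then show ?thesis using ex_carrier[OF z] by (metis l_cancel_one)
qed

lemma ex_minus: "X \<in> g \<Longrightarrow> ex (- X) = inv\<^bsub>G\<^esub> (ex X)"
  using ex_add[of X "-1" 1] ex_zero ex_carrier scale_alg[of X "-1"]
  by (intro inv_equality[symmetric]) auto

lemma lfield_linear:
  assumes "X \<in> g" "Y \<in> g" "smooth_fun (man G) W f" "p \<in> W"
  shows "lfield G ex (a *\<^sub>R X + b *\<^sub>R Y) f p = a * lfield G ex X f p + b * lfield G ex Y f p"
  using alg assms unfolding has_lie_algebra_def by blast

lemma lfield_br:
  assumes "X \<in> g" "Y \<in> g" "smooth_fun (man G) W f" "p \<in> W"
  shows "lfield G ex (br X Y) f p = lfield G ex X (lfield G ex Y f) p - lfield G ex Y (lfield G ex X f) p"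
  using alg assms unfolding has_lie_algebra_def by blast

text \<open>A tangent vector at the unit, represented by the Lie algebra element with the same
  action on functions. Naming it turns the existence and uniqueness clause of
  \<open>has_lie_algebra\<close> into a rule for arbitrary smooth curves.\<close>

definition velocity :: "(real \<Rightarrow> 'a) \<Rightarrow> 'd \<Rightarrow> bool" where
  "velocity c X \<longleftrightarrow> X \<in> g \<and> (\<forall>W f. \<one>\<^bsub>G\<^esub> \<in> W \<and> smooth_fun (man G) W f \<longrightarrow>
                 deriv (\<lambda>t. f (c t)) 0 = lfield G ex X f \<one>\<^bsub>G\<^esub>)"

lemma velocity_exists:
  assumes "smooth_map vec_mfd UNIV (man G) c" "c 0 = \<one>\<^bsub>G\<^esub>"
  shows "\<exists>!X. velocity c X"
proof -
  have "\<forall>c. smooth_map (vec_mfd :: (real, real) mfd) UNIV (man G) c \<and> c 0 = \<one>\<^bsub>G\<^esub> \<longrightarrow>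
        (\<exists>!X. X \<in> g \<and> (\<forall>W f. \<one>\<^bsub>G\<^esub> \<in> W \<and> smooth_fun (man G) W f \<longrightarrow>
                 deriv (\<lambda>t. f (c t)) 0 = lfield G ex X f \<one>\<^bsub>G\<^esub>))"
    using alg unfolding has_lie_algebra_def by (elim conjE)
  then show ?thesis using assms unfolding velocity_def by simp
qed

lemma velocityD:
  "velocity c X \<Longrightarrow> X \<in> g"
  "velocity c X \<Longrightarrow> \<one>\<^bsub>G\<^esub> \<in> W \<Longrightarrow> smooth_fun (man G) W f \<Longrightarrow> deriv (\<lambda>t. f (c t)) 0 = lfield G ex X f \<one>\<^bsub>G\<^esub>"
  unfolding velocity_def by blast+

lemma lfield_one: "X \<in> g \<Longrightarrow> lfield G ex X f \<one>\<^bsub>G\<^esub> = deriv (\<lambda>t. f (ex (t *\<^sub>R X))) 0"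
  unfolding lfield_def using ex_carrier scale_alg by simp

lemma velocity_ex: "X \<in> g \<Longrightarrow> velocity (\<lambda>t. ex (t *\<^sub>R X)) X"
  unfolding velocity_def by (simp add: lfield_one)

text \<open>Both elements are velocities of the one-parameter group of \<open>X\<close>, and
  velocities are unique. Thus functions near the unit separate the points of the Lie
  algebra.\<close>

lemma lfield_eqI:
  assumes "X \<in> g" "Y \<in> g"
    "\<And>W f. \<one>\<^bsub>G\<^esub> \<in> W \<Longrightarrow> smooth_fun (man G) W f \<Longrightarrow> lfield G ex X f \<one>\<^bsub>G\<^esub> = lfield G ex Y f \<one>\<^bsub>G\<^esub>"
  shows "X = Y"
proof -
  have "velocity (\<lambda>t. ex (t *\<^sub>R X)) Y"
    using velocity_ex[OF assms(1)] assms(2,3) unfolding velocity_def by metis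
  moreover have "\<exists>!X'. velocity (\<lambda>t. ex (t *\<^sub>R X)) X'"
    by (rule velocity_exists[OF smooth_ex_curve[OF assms(1)]]) (simp add: ex_zero)
  ultimately show ?thesis using velocity_ex[OF assms(1)] by blast
qed

section \<open>Derivatives of functions along curves in the group\<close>

lemma smooth_fun_Ck:
  assumes "smooth_map vec_mfd UNIV (man G) c" "smooth_fun (man G) W f"
  shows "Ck n (c -` W) (\<lambda>t. f (c t))" "open (c -` W)"
  using smooth_on_openD[OF _ smooth_fun_along[OF assms(1) compatible assms(2)]]
    open_smooth_map_vimage[OF assms(1) compatible] assms(2) by (auto simp: smooth_fun_def)

lemma smooth_fun_differentiable:
  assumes "smooth_map vec_mfd UNIV (man G) c" "smooth_fun (man G) W f" "c t \<in> W"
  shows "(\<lambda>t. f (c t)) differentiable at t"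
  using smooth_fun_Ck(1)[OF assms(1,2), of "Suc 0"] assms(3) by simp

lemma DERIV_deriv_along:
  fixes c :: "real \<Rightarrow> 'a"
  assumes "smooth_map vec_mfd UNIV (man G) c" "smooth_fun (man G) W f" "c t \<in> W"
  shows "((\<lambda>t. f (c t)) has_real_derivative deriv (\<lambda>t. f (c t)) t) (at t)"
  using smooth_fun_differentiable[OF assms] real_differentiable_def DERIV_deriv_iff_real_differentiable by blast

text \<open>Chain rule along the diagonal of the two-parameter product: the direction
  \<open>(1, 1)\<close> is the sum of the two coordinate directions.\<close>

lemma DERIV_product_curves:
  assumes a: "smooth_map vec_mfd UNIV (man G) a" and b: "smooth_map vec_mfd UNIV (man G) b"
    and f: "smooth_fun (man G) W f" "a t \<otimes>\<^bsub>G\<^esub> b t \<in> W"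
  shows "((\<lambda>s::real. f (a s \<otimes>\<^bsub>G\<^esub> b s)) has_real_derivative
     deriv (\<lambda>s. f (a s \<otimes>\<^bsub>G\<^esub> b t)) t + deriv (\<lambda>s. f (a t \<otimes>\<^bsub>G\<^esub> b s)) t) (at t)"
proof -
  define c where "c = (\<lambda>z::real \<times> real. a (fst z) \<otimes>\<^bsub>G\<^esub> b (snd z))"
  have pre: "smooth_map vec_mfd UNIV (man G) (\<lambda>z. u (l z))"
    if "smooth_map vec_mfd UNIV (man G) u" "bounded_linear l" for u and l :: "real \<times> real \<Rightarrow> real"
    by (rule smooth_map_compose[OF _ that(1) compatible_vec compatible_vec])
      (use that(2) in \<open>auto simp: smooth_map_vec_iff smooth_on_bounded_linear\<close>)
  have c: "smooth_map vec_mfd UNIV (man G) c"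
    unfolding c_def by (intro smooth_map_mult compatible_vec pre a b bounded_linear_fst bounded_linear_snd)
  have "(\<lambda>z. f (c z)) differentiable at (t, t)"
    by (rule smooth_fun_differentiable[OF c f(1)]) (use f(2) in \<open>simp add: c_def\<close>)
  then obtain F where F: "((\<lambda>z. f (c z)) has_derivative F) (at (t, t))" by (auto simp: differentiable_def)
  have eq: "(t, t) = (0, 0) + t *\<^sub>R (1, 1)" "(t, t) = (0, t) + t *\<^sub>R (1, 0)" "(t, t) = (t, 0) + t *\<^sub>R (0, 1)" by auto
  have "((\<lambda>s. f (a s \<otimes>\<^bsub>G\<^esub> b s)) has_real_derivative F (1, 1)) (at t)"
    using DERIV_along_line[of "\<lambda>z. f (c z)" F "(0, 0)" t "(1, 1)"] F by (simp add: c_def)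
  moreover have "((\<lambda>s. f (a s \<otimes>\<^bsub>G\<^esub> b t)) has_real_derivative F (1, 0)) (at t)"
    using DERIV_along_line[of "\<lambda>z. f (c z)" F "(0, t)" t "(1, 0)"] F by (simp add: c_def)
  moreover have "((\<lambda>s. f (a t \<otimes>\<^bsub>G\<^esub> b s)) has_real_derivative F (0, 1)) (at t)"
    using DERIV_along_line[of "\<lambda>z. f (c z)" F "(t, 0)" t "(0, 1)"] F by (simp add: c_def)
  moreover have "F (1, 1) = F (1, 0) + F (0, 1)"
    using linear_add[OF has_derivative_linear[OF F], of "(1, 0)" "(0, 1)"] by simp
  ultimately show ?thesis by (simp add: DERIV_imp_deriv)
qed

text \<open>The chart coordinates of \<open>c\<close> have zero derivative on a ball and the chart
  is injective, so \<open>c\<close> is locally constant on the connected line.\<close>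

lemma curve_constant:
  fixes c :: "real \<Rightarrow> 'a"
  assumes c: "smooth_map vec_mfd UNIV (man G) c"
    and der: "\<And>t W f. smooth_fun (man G) W f \<Longrightarrow> c t \<in> W \<Longrightarrow> ((\<lambda>s. f (c s)) has_real_derivative 0) (at t)"
  shows "c s = c t"
proof -
  have "c constant_on UNIV"
  proof (rule locally_constant_imp_constant)
    fix t0 :: real
    obtain U \<phi> where U: "(U, \<phi>) \<in> charts (man G)" "c t0 \<in> U"
      by (rule pointsE[OF smooth_map_points[OF c UNIV_I]])
    have "open (c -` U)" by (rule open_smooth_map_vimage[OF c compatible openin_chart[OF compatible U(1)]])
    then obtain e where e: "e > 0" "ball t0 e \<subseteq> c -` U" using U(2) by (metis open_contains_ball vimageI2)
    have "c t = c t0" if t: "t \<in> ball t0 e" for t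
    proof -
      have "\<phi> (c t) \<bullet> b = \<phi> (c t0) \<bullet> b" for b
      proof -
        have f: "smooth_fun (man G) U (\<lambda>p. \<phi> p \<bullet> b)"
          by (rule smooth_fun_chart[OF manifold U(1) bounded_linear_inner_left])
        have d: "((\<lambda>s. \<phi> (c s) \<bullet> b) has_real_derivative 0) (at x within ball t0 e)" if "x \<in> ball t0 e" for x
          by (rule has_field_derivative_at_within[OF der[OF f]]) (use e(2) that in auto)
        show ?thesis
          by (rule has_field_derivative_zero_constant[of "ball t0 e" "\<lambda>s. \<phi> (c s) \<bullet> b", THEN exE])
            (use d t e(1) in auto)
      qed
      then have "\<phi> (c t) = \<phi> (c t0)" by (simp add: euclidean_eq_iff[where 'a='e])
      then show ?thesis by (rule inj_onD[OF compatible_chartsD(1)[OF compatible U(1)] _ vimageD[OF subsetD[OF e(2) t]] U(2)])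
    qed
    then have "\<forall>x\<in>ball t0 e. c x = c t0" by blast
    moreover have "openin (top_of_set UNIV) (ball t0 e)" "t0 \<in> ball t0 e" using e(1) by simp_all
    ultimately show "\<exists>T. openin (top_of_set UNIV) T \<and> t0 \<in> T \<and> (\<forall>x\<in>T. c x = c t0)" by blast
  qed auto
  then show ?thesis by (auto simp: constant_on_def)
qed

lemma smooth_fun_left_translate:
  assumes "x \<in> carrier G" "smooth_fun (man G) W f"
  shows "smooth_fun (man G) {p \<in> carrier G. x \<otimes>\<^bsub>G\<^esub> p \<in> W} (\<lambda>p. f (x \<otimes>\<^bsub>G\<^esub> p))"
  by (rule smooth_fun_compose[OF _ compatible compatible open_carrier assms(2)])
    (intro smooth_map_mult compatible smooth_map_constant open_carrier assms(1) smooth_map_id manifold)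

lemma smooth_fun_right_translate:
  assumes "x \<in> carrier G" "smooth_fun (man G) W f"
  shows "smooth_fun (man G) {p \<in> carrier G. p \<otimes>\<^bsub>G\<^esub> x \<in> W} (\<lambda>p. f (p \<otimes>\<^bsub>G\<^esub> x))"
  by (rule smooth_fun_compose[OF _ compatible compatible open_carrier assms(2)])
    (intro smooth_map_mult compatible smooth_map_constant open_carrier assms(1) smooth_map_id manifold)

text \<open>If \<open>Y\<close> is the velocity at \<open>0\<close> of \<open>c t = x ex (t X) x\<inverse>\<close>, then \<open>c t ex (- t Y)\<close> has
  derivative zero, so it is constant; uniqueness of integral curves is not needed.\<close>

lemma ad_exists:
  assumes x: "x \<in> carrier G" and X: "X \<in> g"
  shows "\<exists>!Y. Y \<in> g \<and> (\<forall>t. ex (t *\<^sub>R Y) = x \<otimes>\<^bsub>G\<^esub> ex (t *\<^sub>R X) \<otimes>\<^bsub>G\<^esub> inv\<^bsub>G\<^esub> x)"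
proof -
  define c where "c = (\<lambda>t::real. x \<otimes>\<^bsub>G\<^esub> ex (t *\<^sub>R X) \<otimes>\<^bsub>G\<^esub> inv\<^bsub>G\<^esub> x)"
  have ec: "ex (t *\<^sub>R X) \<in> carrier G" if "X \<in> g" for t X using that ex_carrier scale_alg by blast
  have c: "smooth_map vec_mfd UNIV (man G) c"
    unfolding c_def by (intro smooth_map_mult smooth_map_constant smooth_ex_curve X compatible_vec inv_closed x)
      (auto simp: openin_vec_mfd)
  have cc: "c t \<in> carrier G" for t using x ec[OF X] by (simp add: c_def)
  have c0: "c 0 = \<one>\<^bsub>G\<^esub>" using x by (simp add: c_def ex_zero)
  have cadd: "c (s + t) = c s \<otimes>\<^bsub>G\<^esub> c t" for s t
  proof -
    have "c s \<otimes>\<^bsub>G\<^esub> c t = x \<otimes>\<^bsub>G\<^esub> ex (s *\<^sub>R X) \<otimes>\<^bsub>G\<^esub> (inv\<^bsub>G\<^esub> x \<otimes>\<^bsub>G\<^esub> x) \<otimes>\<^bsub>G\<^esub> ex (t *\<^sub>R X) \<otimes>\<^bsub>G\<^esub> inv\<^bsub>G\<^esub> x"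
      using x ec[OF X] by (simp only: c_def m_assoc m_closed inv_closed)
    then show ?thesis using x ec[OF X] by (simp add: c_def ex_add[OF X] m_assoc)
  qed
  obtain Y where Y: "velocity c Y" using velocity_exists[OF c c0] by blast
  note Yg = velocityD(1)[OF Y]
  have mYg: "- Y \<in> g" using subspace_alg Yg by (rule subspace_neg)
  define d where "d = (\<lambda>t::real. ex (t *\<^sub>R (- Y)))"
  have d: "smooth_map vec_mfd UNIV (man G) d" unfolding d_def by (rule smooth_ex_curve[OF mYg])
  have dc: "d t \<in> carrier G" for t unfolding d_def using ec[OF mYg] .
  have dadd: "d (s + t) = d s \<otimes>\<^bsub>G\<^esub> d t" for s t unfolding d_def by (rule ex_add[OF mYg])
  have cd: "c t \<otimes>\<^bsub>G\<^esub> d t = c 0 \<otimes>\<^bsub>G\<^esub> d 0" for t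
  proof (rule curve_constant)
    show "smooth_map vec_mfd UNIV (man G) (\<lambda>t. c t \<otimes>\<^bsub>G\<^esub> d t)"
      by (intro smooth_map_mult c d compatible_vec)
    fix t W f assume f: "smooth_fun (man G) W f" and W: "c t \<otimes>\<^bsub>G\<^esub> d t \<in> W"
    \<comment> \<open>\<open>h p\<close> inserts \<open>p\<close> between \<open>c t\<close> and
      \<open>d t\<close>. The homomorphism laws move the increments of both curves into that slot,
      so both partial derivatives become derivatives of the same \<open>h\<close> at the unit, in
      the opposite directions \<open>Y\<close> and \<open>- Y\<close>.\<close>
    define h where "h = (\<lambda>p. f (c t \<otimes>\<^bsub>G\<^esub> (p \<otimes>\<^bsub>G\<^esub> d t)))"
    define V where "V = {p \<in> carrier G. p \<otimes>\<^bsub>G\<^esub> d t \<in> {p \<in> carrier G. c t \<otimes>\<^bsub>G\<^esub> p \<in> W}}"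
    have h: "smooth_fun (man G) V h" unfolding V_def h_def
      by (rule smooth_fun_right_translate[OF dc smooth_fun_left_translate[OF cc f]])
    have V: "\<one>\<^bsub>G\<^esub> \<in> V" using W cc dc by (simp add: V_def)
    have 1: "deriv (\<lambda>s. f (c s \<otimes>\<^bsub>G\<^esub> d t)) t = deriv (\<lambda>s. f (c (s + t) \<otimes>\<^bsub>G\<^esub> d t)) 0"
      by (rule deriv_shift)
    have 2: "deriv (\<lambda>s. f (c t \<otimes>\<^bsub>G\<^esub> d s)) t = deriv (\<lambda>s. f (c t \<otimes>\<^bsub>G\<^esub> d (s + t))) 0"
      by (rule deriv_shift)
    have "deriv (\<lambda>s. f (c (s + t) \<otimes>\<^bsub>G\<^esub> d t)) 0 = deriv (\<lambda>s. h (c s)) 0"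
      unfolding h_def using cadd[of t] by (simp add: add.commute m_assoc cc dc)
    also have "\<dots> = lfield G ex Y h \<one>\<^bsub>G\<^esub>" by (rule velocityD(2)[OF Y V h])
    finally have 3: "deriv (\<lambda>s. f (c (s + t) \<otimes>\<^bsub>G\<^esub> d t)) 0 = lfield G ex Y h \<one>\<^bsub>G\<^esub>" .
    have "deriv (\<lambda>s. f (c t \<otimes>\<^bsub>G\<^esub> d (s + t))) 0 = deriv (\<lambda>s. h (d s)) 0"
      unfolding h_def using dadd by simp
    also have "\<dots> = lfield G ex (- Y) h \<one>\<^bsub>G\<^esub>"
      unfolding d_def by (rule lfield_one[OF mYg, symmetric])
    also have "\<dots> = - lfield G ex Y h \<one>\<^bsub>G\<^esub>"
      using lfield_linear[OF Yg Yg h V, of "-1" 0] by simp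
    finally have 4: "deriv (\<lambda>s. f (c t \<otimes>\<^bsub>G\<^esub> d (s + t))) 0 = - lfield G ex Y h \<one>\<^bsub>G\<^esub>" .
    show "((\<lambda>s. f (c s \<otimes>\<^bsub>G\<^esub> d s)) has_real_derivative 0) (at t)"
      using DERIV_product_curves[OF c d f W] 1 2 3 4 by simp
  qed
  have "ex (t *\<^sub>R Y) = c t" for t
  proof -
    have "c t \<otimes>\<^bsub>G\<^esub> inv\<^bsub>G\<^esub> (ex (t *\<^sub>R Y)) = \<one>\<^bsub>G\<^esub>"
      using cd[of t] c0 ex_zero ex_minus[OF scale_alg[OF Yg], of t] by (simp add: d_def)
    then show ?thesis using cc[of t] ec[OF Yg, of t]
      by (metis inv_closed inv_equality inv_inv)
  qed
  \<comment> \<open>Another generator of \<open>c\<close> would be a velocity of \<open>c\<close> as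
    well.\<close>
  moreover have "Z = Y" if "Z \<in> g" "\<forall>t. ex (t *\<^sub>R Z) = c t" for Z
    using velocity_ex[OF that(1)] velocity_exists[OF c c0] Y that(2) by auto
  ultimately show ?thesis using Yg unfolding c_def by blast
qed

end

section \<open>The adjoint representation\<close>

context lie_group_algebra
begin

lemma smooth_map_reparam:
  fixes l :: "'v::euclidean_space \<Rightarrow> 'w::euclidean_space"
  assumes "smooth_map vec_mfd UNIV (man G) c" "smooth_on UNIV l"
  shows "smooth_map vec_mfd UNIV (man G) (\<lambda>v. c (l v))"
  by (rule smooth_map_compose[OF _ assms(1) compatible_vec compatible_vec])
    (use assms(2) in \<open>auto simp: smooth_map_vec_iff\<close>)

lemma smooth_map_vec_constant:
  "x \<in> carrier G \<Longrightarrow> smooth_map vec_mfd UNIV (man G) (\<lambda>_. x)"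
  by (rule smooth_map_constant) (auto simp: compatible_vec openin_vec_mfd)

lemma product_curves_mixed:
  fixes a b :: "real \<Rightarrow> 'a"
  assumes a: "smooth_map vec_mfd UNIV (man G) a" and b: "smooth_map vec_mfd UNIV (man G) b"
    and f: "smooth_fun (man G) W f" "a 0 \<otimes>\<^bsub>G\<^esub> b 0 \<in> W"
  defines "F \<equiv> (\<lambda>s t. f (a s \<otimes>\<^bsub>G\<^esub> b t))"
  shows "deriv (\<lambda>s. deriv (\<lambda>t. F s t) 0) 0 = deriv (\<lambda>t. deriv (\<lambda>s. F s t) 0) 0"
    "((\<lambda>s. deriv (\<lambda>t. F s t) 0) has_real_derivative deriv (\<lambda>s. deriv (\<lambda>t. F s t) 0) 0) (at 0)"
proof -
  let ?c = "\<lambda>z::real \<times> real. a (fst z) \<otimes>\<^bsub>G\<^esub> b (snd z)"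
  have c: "smooth_map vec_mfd UNIV (man G) ?c"
    by (intro smooth_map_mult compatible_vec smooth_map_reparam[OF a] smooth_map_reparam[OF b] smooth_on_bounded_linear
        bounded_linear_fst bounded_linear_snd)
  have 0: "(0, 0) \<in> ?c -` W" using f(2) by simp
  note m = mixed_partials[OF smooth_fun_Ck(2)[OF c f(1)] 0, of F]
  show "deriv (\<lambda>s. deriv (\<lambda>t. F s t) 0) 0 = deriv (\<lambda>t. deriv (\<lambda>s. F s t) 0) 0"
    by (rule m(1)) (unfold F_def, rule smooth_fun_Ck(1)[OF c f(1)])
  show "((\<lambda>s. deriv (\<lambda>t. F s t) 0) has_real_derivative deriv (\<lambda>s. deriv (\<lambda>t. F s t) 0) 0) (at 0)"
    by (rule m(2)) (unfold F_def, rule smooth_fun_Ck(1)[OF c f(1)])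
qed

text \<open>The product rule is applied to the constant curve formed by \<open>b s\<close> times its
  inverse.\<close>

lemma velocity_inverse:
  assumes b: "smooth_map vec_mfd UNIV (man G) b" "b 0 = \<one>\<^bsub>G\<^esub>" "velocity b Z"
    and f: "\<one>\<^bsub>G\<^esub> \<in> W" "smooth_fun (man G) W f"
  shows "deriv (\<lambda>s. f (inv\<^bsub>G\<^esub> (b s))) 0 = - lfield G ex Z f \<one>\<^bsub>G\<^esub>"
proof -
  have bi: "smooth_map vec_mfd UNIV (man G) (\<lambda>s. inv\<^bsub>G\<^esub> (b s))"
    by (rule smooth_map_inv[OF compatible_vec b(1)])
  have bc: "b s \<in> carrier G" for s using smooth_map_carrier[OF b(1)] by simp
  have "((\<lambda>s. f (b s \<otimes>\<^bsub>G\<^esub> inv\<^bsub>G\<^esub> (b s))) has_real_derivative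
     deriv (\<lambda>s. f (b s \<otimes>\<^bsub>G\<^esub> inv\<^bsub>G\<^esub> (b 0))) 0 + deriv (\<lambda>s. f (b 0 \<otimes>\<^bsub>G\<^esub> inv\<^bsub>G\<^esub> (b s))) 0) (at 0)"
    by (rule DERIV_product_curves[OF b(1) bi f(2)]) (use f(1) b(2) in simp)
  then have "((\<lambda>s::real. f \<one>\<^bsub>G\<^esub>) has_real_derivative
     deriv (\<lambda>s. f (b s)) 0 + deriv (\<lambda>s. f (inv\<^bsub>G\<^esub> (b s))) 0) (at 0)"
    using bc b(2) by simp
  from DERIV_unique[OF this DERIV_const] show ?thesis using velocityD(2)[OF b(3) f] by simp
qed

end

section \<open>The adjoint action when the Lie algebra is the whole type\<close>

locale lie_group_total = lie_group_algebra G UNIV br ex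
  for G :: "('a, 'e::euclidean_space) lgroup" and br :: "'d::real_vector \<Rightarrow> 'd \<Rightarrow> 'd" and ex :: "'d \<Rightarrow> 'a"
begin

lemma exs_carrier: "ex X \<in> carrier G"
  by (rule ex_carrier) simp

text \<open>The description that defines \<open>Adj\<close> ranges over the whole type; the
  uniqueness in \<open>ad_exists\<close> is relative to the Lie algebra, and the two match because
  that algebra is \<open>UNIV\<close> here.\<close>

lemma ex_Adj:
  assumes "x \<in> carrier G"
  shows "ex (t *\<^sub>R Adj G ex x X) = x \<otimes>\<^bsub>G\<^esub> ex (t *\<^sub>R X) \<otimes>\<^bsub>G\<^esub> inv\<^bsub>G\<^esub> x"
  using theI'[OF ad_exists[OF assms UNIV_I, of X]] unfolding Adj_def by simp

lemma Adj_eqI: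
  assumes "x \<in> carrier G" "\<And>t. ex (t *\<^sub>R Y) = x \<otimes>\<^bsub>G\<^esub> ex (t *\<^sub>R X) \<otimes>\<^bsub>G\<^esub> inv\<^bsub>G\<^esub> x"
  shows "Adj G ex x X = Y"
  using ad_exists[OF assms(1) UNIV_I, of X] ex_Adj[OF assms(1)] assms(2) by auto

lemma Adj_mult:
  assumes "x \<in> carrier G" "y \<in> carrier G"
  shows "Adj G ex (x \<otimes>\<^bsub>G\<^esub> y) X = Adj G ex x (Adj G ex y X)"
  by (rule Adj_eqI) (use assms exs_carrier in \<open>simp_all add: ex_Adj inv_mult_group m_assoc\<close>)

lemma Adj_one: "Adj G ex \<one>\<^bsub>G\<^esub> X = X"
  by (rule Adj_eqI) (use exs_carrier in simp_all)

lemma Adj_inv: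
  assumes "x \<in> carrier G"
  shows "Adj G ex x (Adj G ex (inv\<^bsub>G\<^esub> x) X) = X" "Adj G ex (inv\<^bsub>G\<^esub> x) (Adj G ex x X) = X"
  using Adj_mult[of x "inv\<^bsub>G\<^esub> x" X] Adj_mult[of "inv\<^bsub>G\<^esub> x" x X] assms by (simp_all add: Adj_one)

lemma lfield_Adj:
  assumes "x \<in> carrier G"
  shows "lfield G ex (Adj G ex x X) f \<one>\<^bsub>G\<^esub> = lfield G ex X (\<lambda>p. f (x \<otimes>\<^bsub>G\<^esub> p \<otimes>\<^bsub>G\<^esub> inv\<^bsub>G\<^esub> x)) \<one>\<^bsub>G\<^esub>"
  by (simp add: lfield_one ex_Adj[OF assms])

text \<open>Conjugation by \<open>x\<close> pulls a function near the unit back to another such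
  function, whose derivative is linear in the direction; functions separate the points of the Lie
  algebra.\<close>

lemma linear_Adj:
  assumes x: "x \<in> carrier G"
  shows "linear (Adj G ex x)"
proof -
  have comb: "Adj G ex x (a *\<^sub>R X + b *\<^sub>R Y) = a *\<^sub>R Adj G ex x X + b *\<^sub>R Adj G ex x Y" for a b X Y
  proof (rule lfield_eqI)
    fix W and f :: "'a \<Rightarrow> real" assume f: "\<one>\<^bsub>G\<^esub> \<in> W" "smooth_fun (man G) W f"
    let ?h = "\<lambda>p. f (x \<otimes>\<^bsub>G\<^esub> (p \<otimes>\<^bsub>G\<^esub> inv\<^bsub>G\<^esub> x))"
    let ?V = "{p \<in> carrier G. p \<otimes>\<^bsub>G\<^esub> inv\<^bsub>G\<^esub> x \<in> {p \<in> carrier G. x \<otimes>\<^bsub>G\<^esub> p \<in> W}}"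
    have h: "smooth_fun (man G) ?V ?h"
      by (rule smooth_fun_right_translate[OF inv_closed[OF x] smooth_fun_left_translate[OF x f(2)]])
    have V: "\<one>\<^bsub>G\<^esub> \<in> ?V" using f(1) x by simp
    have A: "lfield G ex (Adj G ex x X) f \<one>\<^bsub>G\<^esub> = lfield G ex X ?h \<one>\<^bsub>G\<^esub>" for X
      by (simp add: lfield_one ex_Adj x m_assoc exs_carrier)
    show "lfield G ex (Adj G ex x (a *\<^sub>R X + b *\<^sub>R Y)) f \<one>\<^bsub>G\<^esub>
        = lfield G ex (a *\<^sub>R Adj G ex x X + b *\<^sub>R Adj G ex x Y) f \<one>\<^bsub>G\<^esub>"
      by (simp add: A lfield_linear[OF UNIV_I UNIV_I f(2,1)] lfield_linear[OF UNIV_I UNIV_I h V])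
  qed auto
  show ?thesis
    by (rule linearI) (use comb[of 1 _ 1] comb[of _ _ 0] in simp_all)
qed

text \<open>A chart at the unit, differentiated along the one-parameter groups, embeds the Lie algebra
  into the Euclidean space of the model.\<close>

lemma functional_eq_lfield:
  fixes l :: "'d \<Rightarrow> real"
  assumes l: "linear l"
  obtains W f where "\<one>\<^bsub>G\<^esub> \<in> W" "smooth_fun (man G) W f" "\<And>Z. l Z = lfield G ex Z f \<one>\<^bsub>G\<^esub>"
proof -
  obtain U \<phi> where U: "(U, \<phi>) \<in> charts (man G)" "\<one>\<^bsub>G\<^esub> \<in> U"
    using pointsE[of "\<one>\<^bsub>G\<^esub>" "man G"] points by auto
  have comp: "smooth_fun (man G) U (\<lambda>p. \<phi> p \<bullet> b)" for b
    by (rule smooth_fun_chart[OF manifold U(1) bounded_linear_inner_left])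
  define T where "T Z = (\<Sum>b\<in>Basis. lfield G ex Z (\<lambda>p. \<phi> p \<bullet> b) \<one>\<^bsub>G\<^esub> *\<^sub>R b)" for Z
  have Tb: "T Z \<bullet> b = lfield G ex Z (\<lambda>p. \<phi> p \<bullet> b) \<one>\<^bsub>G\<^esub>" if "b \<in> Basis" for Z b
    unfolding T_def using that by (simp add: inner_sum_left inner_Basis if_distrib cong: if_cong)
  have Tlin: "linear T"
  proof (rule linearI)
    show "T (X + Y) = T X + T Y" for X Y
      by (rule euclidean_eqI)
        (use lfield_linear[OF UNIV_I UNIV_I comp U(2), of 1 X 1 Y] in \<open>simp add: Tb inner_add_left\<close>)
    show "T (r *\<^sub>R X) = r *\<^sub>R T X" for r X
      by (rule euclidean_eqI)
        (use lfield_linear[OF UNIV_I UNIV_I comp U(2), of r X 0 X] in \<open>simp add: Tb\<close>)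
  qed
  have curve: "((\<lambda>t. \<phi> (ex (t *\<^sub>R Z)) \<bullet> b) has_real_derivative T Z \<bullet> b) (at 0)" if "b \<in> Basis" for Z b
    using DERIV_deriv_along[OF smooth_ex_curve[OF UNIV_I] comp, of 0 Z b] U(2)
    by (simp add: Tb[OF that] lfield_one ex_zero)
  have curve': "((\<lambda>t. \<phi> (ex (t *\<^sub>R Z))) has_derivative (\<lambda>h. h *\<^sub>R T Z)) (at 0)" for Z
  proof (subst has_derivative_componentwise_within, intro ballI)
    fix b :: 'e assume "b \<in> Basis"
    from curve[OF this, of Z] show "((\<lambda>t. \<phi> (ex (t *\<^sub>R Z)) \<bullet> b) has_derivative (\<lambda>h. (h *\<^sub>R T Z) \<bullet> b)) (at 0)"
      unfolding has_field_derivative_def by (rule has_derivative_eq_rhs) (auto simp: mult.commute)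
  qed
  \<comment> \<open>Near the unit, every function \<open>f\<close> is a smooth function
    \<open>h\<close> of the chart coordinates. Hence a vector killed by \<open>T\<close>
    differentiates every \<open>f\<close> to zero and cannot be told apart from 0.\<close>
  have inj: "inj T"
  proof (rule linear_injective_0[OF Tlin, THEN iffD2], intro allI impI)
    fix Z assume Z: "T Z = 0"
    show "Z = 0"
    proof (rule lfield_eqI)
      fix W and f :: "'a \<Rightarrow> real" assume f: "\<one>\<^bsub>G\<^esub> \<in> W" "smooth_fun (man G) W f"
      obtain Q where Q: "openin (mfd_top (man G)) Q" "\<one>\<^bsub>G\<^esub> \<in> Q" "Q \<subseteq> U \<inter> W"
        "smooth_on (\<phi> ` Q) (id \<circ> f \<circ> inv_into U \<phi>)"
        using smooth_mapE[of "man G" W vec_mfd f "\<one>\<^bsub>G\<^esub>" U \<phi> UNIV id] f U by (auto simp: smooth_fun_def)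
      obtain O' h where h: "open O'" "\<phi> \<one>\<^bsub>G\<^esub> \<in> O'" "\<forall>n. Ck n O' h"
        "\<forall>y\<in>O' \<inter> \<phi> ` Q. h y = (id \<circ> f \<circ> inv_into U \<phi>) y"
        by (rule smooth_onE[OF Q(4) imageI[OF Q(2)]])
      have e0: "(\<lambda>t::real. ex (t *\<^sub>R Z)) 0 = \<one>\<^bsub>G\<^esub>" by (simp add: ex_zero)
      have "open ((\<lambda>t::real. ex (t *\<^sub>R Z)) -` Q)"
        by (rule open_smooth_map_vimage[OF smooth_ex_curve[OF UNIV_I] compatible Q(1)])
      then have ev1: "\<forall>\<^sub>F t::real in nhds 0. ex (t *\<^sub>R Z) \<in> Q"
        using eventually_nhds_in_open[of _ "0::real"] e0 Q(2) by fastforce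
      have "((\<lambda>t. \<phi> (ex (t *\<^sub>R Z))) \<longlongrightarrow> \<phi> \<one>\<^bsub>G\<^esub>) (nhds 0)"
        using has_derivative_continuous[OF curve'[of Z]]
          tendsto_at_iff_tendsto_nhds[of "\<lambda>t. \<phi> (ex (t *\<^sub>R Z))" 0]
        by (simp add: continuous_at ex_zero)
      then have ev2: "\<forall>\<^sub>F t::real in nhds 0. \<phi> (ex (t *\<^sub>R Z)) \<in> O'"
        by (rule topological_tendstoD[OF _ h(1,2)])
      have ev: "\<forall>\<^sub>F t in nhds 0. f (ex (t *\<^sub>R Z)) = h (\<phi> (ex (t *\<^sub>R Z)))"
        using ev1 ev2
      proof eventually_elim
        case (elim t)
        then show ?case using h(4) Q(3) compatible_chartsD(1)[OF compatible U(1)] by auto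
      qed
      have "Ck (Suc 0) O' h" using h(3) by blast
      from Ck_SucE[OF this h(2)] have hd: "(h has_derivative frechet_derivative h (at (\<phi> \<one>\<^bsub>G\<^esub>))) (at (\<phi> (ex (0 *\<^sub>R Z))))"
        by (simp add: ex_zero)
      have "((\<lambda>t. h (\<phi> (ex (t *\<^sub>R Z)))) has_derivative (\<lambda>t. frechet_derivative h (at (\<phi> \<one>\<^bsub>G\<^esub>)) (t *\<^sub>R T Z))) (at 0)"
        by (rule has_derivative_compose[where g=h, OF curve' hd])
      then have "((\<lambda>t. h (\<phi> (ex (t *\<^sub>R Z)))) has_real_derivative 0) (at 0)"
        unfolding has_field_derivative_def
        by (rule has_derivative_eq_rhs) (use linear_0[OF has_derivative_linear[OF hd]] in \<open>auto simp: Z\<close>)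
      then have "((\<lambda>t. f (ex (t *\<^sub>R Z))) has_real_derivative 0) (at 0)"
        by (subst DERIV_cong_ev[OF refl ev refl])
      then show "lfield G ex Z f \<one>\<^bsub>G\<^esub> = lfield G ex 0 f \<one>\<^bsub>G\<^esub>"
        by (simp add: lfield_one DERIV_imp_deriv)
    qed auto
  qed
  \<comment> \<open>With a left inverse \<open>L\<close> of the differential, the function obtained
    from \<open>l\<close> and \<open>L\<close> in the chart has differential
    \<open>l\<close>.\<close>
  then obtain L where L: "linear L" "L \<circ> T = id" using linear_injective_left_inverse[OF Tlin] by blast
  have lL: "bounded_linear (\<lambda>x. l (L x))"
    using linear_compose[OF L(1) l] by (simp add: linear_conv_bounded_linear o_def)
  have "l Z = lfield G ex Z (\<lambda>p. l (L (\<phi> p))) \<one>\<^bsub>G\<^esub>" for Z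
  proof -
    have "((\<lambda>t. l (L (\<phi> (ex (t *\<^sub>R Z))))) has_derivative (\<lambda>h. l (L (h *\<^sub>R T Z)))) (at 0)"
      by (rule bounded_linear.has_derivative[OF lL curve'])
    moreover have "(\<lambda>h. l (L (h *\<^sub>R T Z))) = (*) (l Z)"
      using fun_cong[OF L(2), of Z] by (simp add: linear_scale[OF L(1)] linear_scale[OF l] mult.commute fun_eq_iff)
    ultimately have "((\<lambda>t. l (L (\<phi> (ex (t *\<^sub>R Z))))) has_real_derivative l Z) (at 0)"
      by (simp add: has_field_derivative_def)
    then show ?thesis by (simp add: lfield_one DERIV_imp_deriv)
  qed
  then show ?thesis using that[OF U(2) smooth_fun_chart[OF manifold U(1) lL]] by blast
qed

text \<open>The derivative of \<open>Ad\<close> along a curve is \<open>ad\<close> of its velocity: the derivatives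
  of \<open>f (b s \<cdot> ex (t X) \<cdot> (b u)\<inverse>)\<close> along \<open>s\<close> and \<open>u\<close> are the two terms of the commutator of vector fields.\<close>

lemma DERIV_Adj_curve:
  fixes l :: "'d \<Rightarrow> real"
  assumes b: "smooth_map vec_mfd UNIV (man G) b" "b 0 = \<one>\<^bsub>G\<^esub>" "velocity b Z" and l: "linear l"
  shows "((\<lambda>s. l (Adj G ex (b s) X)) has_real_derivative l (br Z X)) (at 0)"
proof -
  obtain W f where f: "\<one>\<^bsub>G\<^esub> \<in> W" "smooth_fun (man G) W f" and lf: "\<And>Z. l Z = lfield G ex Z f \<one>\<^bsub>G\<^esub>"
    using functional_eq_lfield[OF l] by blast
  have bc: "b s \<in> carrier G" for s using smooth_map_carrier[OF b(1)] by simp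
  have bi: "smooth_map vec_mfd UNIV (man G) (\<lambda>s. inv\<^bsub>G\<^esub> (b s))"
    by (rule smooth_map_inv[OF compatible_vec b(1)])
  note eX = smooth_ex_curve[OF UNIV_I]
  \<comment> \<open>The two occurrences of \<open>b\<close> get independent parameters. The
    conjugation by \<open>b s\<close> is the diagonal, whose derivative splits into the two partial
    ones by linearity.\<close>
  define c where "c = (\<lambda>v::real \<times> real \<times> real. b (fst v) \<otimes>\<^bsub>G\<^esub> ex (snd (snd v) *\<^sub>R X) \<otimes>\<^bsub>G\<^esub> inv\<^bsub>G\<^esub> (b (fst (snd v))))"
  have c: "smooth_map vec_mfd UNIV (man G) c"
    unfolding c_def
    by (intro smooth_map_mult smooth_map_reparam[OF b(1)] smooth_map_reparam[OF bi] smooth_map_reparam[OF eX]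
        compatible_vec smooth_on_bounded_linear bounded_linear_fst bounded_linear_snd
        bounded_linear_compose[OF bounded_linear_fst] bounded_linear_compose[OF bounded_linear_snd])
  define F where "F = (\<lambda>v. f (c v))"
  define S where "S = c -` W"
  have F: "Ck n S F" and S: "open S" for n
    unfolding F_def S_def using smooth_fun_Ck[OF c f(2)] by auto
  define H where "H = (\<lambda>y. frechet_derivative F (at y) (0, 0, 1))"
  have Hd: "(H has_derivative frechet_derivative H (at y)) (at y)" if "y \<in> S" for y
    unfolding H_def by (rule Ck_SucE[where n=0, OF _ that]) (use F[of "Suc (Suc 0)"] in simp)
  have HF: "H (s, u, 0) = deriv (\<lambda>t. F (s, u, t)) 0" if "(s, u, 0) \<in> S" for s u
    using DERIV_along_line[of F _ "(s, u, 0)" 0 "(0, 0, 1)"] Ck_SucE[OF F that] unfolding H_def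
    by (intro DERIV_imp_deriv[symmetric]) simp
  have S0: "(0, 0, 0) \<in> S" using f(1) by (simp add: S_def c_def b(2) ex_zero)
  define H' where "H' = frechet_derivative H (at (0, 0, 0))"
  have H': "(H has_derivative H') (at (0, 0, 0))" unfolding H'_def by (rule Hd[OF S0])
  have diag: "l (Adj G ex (b s) X) = H (s, s, 0)" for s
  proof -
    have "(s, s, 0) \<in> S" using f(1) bc by (simp add: S_def c_def ex_zero)
    then have "H (s, s, 0) = deriv (\<lambda>t. f (b s \<otimes>\<^bsub>G\<^esub> ex (t *\<^sub>R X) \<otimes>\<^bsub>G\<^esub> inv\<^bsub>G\<^esub> (b s))) 0"
      using HF by (simp add: F_def c_def)
    then show ?thesis by (simp add: lf lfield_Adj[OF bc] lfield_one)
  qed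
  have D: "((\<lambda>s. H (s, s, 0)) has_real_derivative H' (1, 1, 0)) (at 0)"
    using DERIV_along_line[of H H' "(0, 0, 0)" 0 "(1, 1, 0)"] H' by (simp add: zero_prod_def)
  have split: "H' (1, 1, 0) = H' (1, 0, 0) + H' (0, 1, 0)"
    using linear_add[OF has_derivative_linear[OF H'], of "(1, 0, 0)" "(0, 1, 0)"] by simp
  have ev: "\<forall>\<^sub>F s in nhds (0::real). (s, 0, 0) \<in> S" "\<forall>\<^sub>F u in nhds (0::real). (0, u, 0) \<in> S"
    by (rule topological_tendstoD[OF _ S S0]; intro tendsto_Pair tendsto_const filterlim_ident)+
  have evW: "\<forall>\<^sub>F t::real in nhds 0. ex (t *\<^sub>R X) \<in> W"
  proof -
    have "open ((\<lambda>t::real. ex (t *\<^sub>R X)) -` W)" by (rule smooth_fun_Ck(2)[OF eX f(2)])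
    then have "\<forall>\<^sub>F t::real in nhds 0. t \<in> (\<lambda>t::real. ex (t *\<^sub>R X)) -` W"
      by (rule eventually_nhds_in_open) (use f(1) in \<open>simp add: ex_zero\<close>)
    then show ?thesis by simp
  qed
  have "H' (1, 0, 0) = deriv (\<lambda>s. H (s, 0, 0)) 0"
    using DERIV_along_line[of H H' "(0, 0, 0)" 0 "(1, 0, 0)"] H' by (intro DERIV_imp_deriv[symmetric]) (simp add: zero_prod_def)
  also have "\<dots> = deriv (\<lambda>s. deriv (\<lambda>t. f (b s \<otimes>\<^bsub>G\<^esub> ex (t *\<^sub>R X))) 0) 0"
    by (rule deriv_cong_ev[OF eventually_mono[OF ev(1)]])
      (use HF bc exs_carrier in \<open>simp_all add: F_def c_def b(2)\<close>)
  \<comment> \<open>Interchanging the derivatives makes the one along \<open>b\<close> the inner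
    one, where \<open>b\<close> may be replaced by the one-parameter group of its velocity
    \<open>Z\<close>; a second interchange then restores the order.\<close>
  also have "\<dots> = deriv (\<lambda>t. deriv (\<lambda>s. f (b s \<otimes>\<^bsub>G\<^esub> ex (t *\<^sub>R X))) 0) 0"
    by (rule product_curves_mixed(1)[OF b(1) eX f(2)]) (use f(1) in \<open>simp add: b(2) ex_zero\<close>)
  also have "\<dots> = deriv (\<lambda>t. deriv (\<lambda>s. f (ex (s *\<^sub>R Z) \<otimes>\<^bsub>G\<^esub> ex (t *\<^sub>R X))) 0) 0"
  proof (rule deriv_cong_ev[OF eventually_mono[OF evW] refl])
    fix t assume t: "ex (t *\<^sub>R X) \<in> W"
    have "deriv (\<lambda>s. f (b s \<otimes>\<^bsub>G\<^esub> ex (t *\<^sub>R X))) 0 = lfield G ex Z (\<lambda>p. f (p \<otimes>\<^bsub>G\<^esub> ex (t *\<^sub>R X))) \<one>\<^bsub>G\<^esub>"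
      by (rule velocityD(2)[OF b(3) _ smooth_fun_right_translate[OF exs_carrier f(2)]])
        (use t exs_carrier in simp)
    then show "deriv (\<lambda>s. f (b s \<otimes>\<^bsub>G\<^esub> ex (t *\<^sub>R X))) 0 = deriv (\<lambda>s. f (ex (s *\<^sub>R Z) \<otimes>\<^bsub>G\<^esub> ex (t *\<^sub>R X))) 0"
      by (simp add: lfield_one)
  qed
  also have "\<dots> = deriv (\<lambda>s. deriv (\<lambda>t. f (ex (s *\<^sub>R Z) \<otimes>\<^bsub>G\<^esub> ex (t *\<^sub>R X))) 0) 0"
    by (rule product_curves_mixed(1)[OF eX eX f(2), symmetric]) (use f(1) in \<open>simp add: ex_zero\<close>)
  also have "\<dots> = lfield G ex Z (lfield G ex X f) \<one>\<^bsub>G\<^esub>"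
    by (simp add: lfield_one) (simp add: lfield_def)
  finally have 1: "H' (1, 0, 0) = lfield G ex Z (lfield G ex X f) \<one>\<^bsub>G\<^esub>" .
  \<comment> \<open>The existence of this derivative is kept along with its value, because the sign
    produced by the inverse has to be pulled out of it.\<close>
  have XZ: "((\<lambda>t. deriv (\<lambda>u. f (ex (t *\<^sub>R X) \<otimes>\<^bsub>G\<^esub> ex (u *\<^sub>R Z))) 0) has_real_derivative
      lfield G ex X (lfield G ex Z f) \<one>\<^bsub>G\<^esub>) (at 0)"
    using product_curves_mixed(2)[OF eX eX f(2), of X Z] f(1)
    by (simp add: ex_zero lfield_one) (simp add: lfield_def)
  have "H' (0, 1, 0) = deriv (\<lambda>u. H (0, u, 0)) 0"
    using DERIV_along_line[of H H' "(0, 0, 0)" 0 "(0, 1, 0)"] H' by (intro DERIV_imp_deriv[symmetric]) (simp add: zero_prod_def)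
  also have "\<dots> = deriv (\<lambda>u. deriv (\<lambda>t. f (ex (t *\<^sub>R X) \<otimes>\<^bsub>G\<^esub> inv\<^bsub>G\<^esub> (b u))) 0) 0"
    by (rule deriv_cong_ev[OF eventually_mono[OF ev(2)]])
      (use HF bc exs_carrier in \<open>simp_all add: F_def c_def b(2)\<close>)
  also have "\<dots> = deriv (\<lambda>t. deriv (\<lambda>u. f (ex (t *\<^sub>R X) \<otimes>\<^bsub>G\<^esub> inv\<^bsub>G\<^esub> (b u))) 0) 0"
    by (rule product_curves_mixed(1)[OF eX bi f(2), symmetric]) (use f(1) in \<open>simp add: b(2) ex_zero\<close>)
  also have "\<dots> = deriv (\<lambda>t. - deriv (\<lambda>u. f (ex (t *\<^sub>R X) \<otimes>\<^bsub>G\<^esub> ex (u *\<^sub>R Z))) 0) 0"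
  proof (rule deriv_cong_ev[OF eventually_mono[OF evW] refl])
    fix t assume t: "ex (t *\<^sub>R X) \<in> W"
    have "deriv (\<lambda>u. f (ex (t *\<^sub>R X) \<otimes>\<^bsub>G\<^esub> inv\<^bsub>G\<^esub> (b u))) 0 = - lfield G ex Z (\<lambda>p. f (ex (t *\<^sub>R X) \<otimes>\<^bsub>G\<^esub> p)) \<one>\<^bsub>G\<^esub>"
      by (rule velocity_inverse[OF b _ smooth_fun_left_translate[OF exs_carrier f(2)]])
        (use t exs_carrier in simp)
    then show "deriv (\<lambda>u. f (ex (t *\<^sub>R X) \<otimes>\<^bsub>G\<^esub> inv\<^bsub>G\<^esub> (b u))) 0 = - deriv (\<lambda>u. f (ex (t *\<^sub>R X) \<otimes>\<^bsub>G\<^esub> ex (u *\<^sub>R Z))) 0"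
      by (simp add: lfield_one)
  qed
  also have "\<dots> = - lfield G ex X (lfield G ex Z f) \<one>\<^bsub>G\<^esub>"
    by (rule DERIV_imp_deriv[OF DERIV_minus[OF XZ]])
  finally have 2: "H' (0, 1, 0) = - lfield G ex X (lfield G ex Z f) \<one>\<^bsub>G\<^esub>" .
  have "H' (1, 1, 0) = l (br Z X)"
    unfolding split 1 2 lf using lfield_br[OF UNIV_I UNIV_I f(2,1), of Z X] by simp
  then show ?thesis using D by (simp add: diag)
qed

end

section \<open>Lie subgroups\<close>

text \<open>Differentiability of \<open>X\<close> and \<open>Y\<close> is expressed through linear
  functionals only; coordinates in a finite basis reduce the claim to the product rule for real
  functions.\<close>

lemma DERIV_bilinear:
  fixes \<beta> :: "'d::real_vector \<Rightarrow> 'd \<Rightarrow> real"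
  assumes fin: "finite B" "span B = (UNIV :: 'd set)" and \<beta>: "bilinear \<beta>"
    and X: "\<And>l::'d \<Rightarrow> real. linear l \<Longrightarrow> ((\<lambda>s. l (X s)) has_real_derivative l X') (at t)"
    and Y: "\<And>l::'d \<Rightarrow> real. linear l \<Longrightarrow> ((\<lambda>s. l (Y s)) has_real_derivative l Y') (at t)"
  shows "((\<lambda>s. \<beta> (X s) (Y s)) has_real_derivative \<beta> X' (Y t) + \<beta> (X t) Y') (at t)"
proof -
  obtain C where C: "C \<subseteq> B" "independent C" "B \<subseteq> span C"
    using maximal_independent_subset[of B] by blast
  have span: "v \<in> span C" for v using fin(2) span_minimal[OF C(3) subspace_span] by blast
  have finC: "finite C" using C(1) fin(1) finite_subset by blast
  define r where "r c v = representation C v c" for c v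
  have r: "linear (r c)" for c
    unfolding r_def by (rule linearI) (simp_all add: representation_add representation_scale C(2) span)
  have exp: "\<beta> x y = (\<Sum>c\<in>C. r c x * \<beta> c y)" for x y
  proof -
    have "linear (\<lambda>x. \<beta> x y)" using \<beta> by (simp add: bilinear_def)
    then have "\<beta> (\<Sum>c\<in>C. r c x *\<^sub>R c) y = (\<Sum>c\<in>C. r c x * \<beta> c y)"
      using linear_sum[of "\<lambda>x. \<beta> x y" "\<lambda>c. r c x *\<^sub>R c" C] linear_scale[of "\<lambda>x. \<beta> x y"] by simp
    moreover have "(\<Sum>c\<in>C. r c x *\<^sub>R c) = x"
      unfolding r_def by (rule sum_representation_eq) (use C span finC in auto)
    ultimately show ?thesis by simp
  qed
  have lin: "linear (\<beta> c)" for c using \<beta> by (simp add: bilinear_def)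
  have "((\<lambda>s. \<Sum>c\<in>C. r c (X s) * \<beta> c (Y s)) has_real_derivative
      (\<Sum>c\<in>C. r c X' * \<beta> c (Y t) + \<beta> c Y' * r c (X t))) (at t)"
    by (intro DERIV_sum DERIV_mult X Y r lin)
  moreover have "(\<lambda>s. \<beta> (X s) (Y s)) = (\<lambda>s. \<Sum>c\<in>C. r c (X s) * \<beta> c (Y s))" by (rule ext) (rule exp)
  moreover have "\<beta> X' (Y t) + \<beta> (X t) Y' = (\<Sum>c\<in>C. r c X' * \<beta> c (Y t) + \<beta> c Y' * r c (X t))"
    by (simp add: exp[of X'] exp[of "X t"] sum.distrib mult.commute)
  ultimately show ?thesis by (simp only:)
qed

text \<open>The fibre through \<open>a\<close> and its complement are both open, and connectedness
  forbids that both are inhabited.\<close>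

lemma connected_space_locally_constant:
  assumes "connected_space T" "a \<in> topspace T" "b \<in> topspace T"
    and loc: "\<And>p. p \<in> topspace T \<Longrightarrow> \<exists>Q. openin T Q \<and> p \<in> Q \<and> (\<forall>q\<in>Q. k q = k p)"
  shows "k a = k b"
proof (rule ccontr)
  assume ne: "k a \<noteq> k b"
  have op: "openin T {q \<in> topspace T. R (k q)}" for R
  proof (subst openin_subopen, safe)
    fix p assume p: "p \<in> topspace T" "R (k p)"
    obtain Q where Q: "openin T Q" "p \<in> Q" "\<forall>q\<in>Q. k q = k p" using loc[OF p(1)] by blast
    have "R (k q)" if "q \<in> Q" for q
      using p(2) bspec[OF Q(3) that] by (simp only:)
    then have "Q \<subseteq> {q \<in> topspace T. R (k q)}" using openin_subset[OF Q(1)] by blast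
    then show "\<exists>Q. openin T Q \<and> p \<in> Q \<and> Q \<subseteq> {q \<in> topspace T. R (k q)}" using Q(1,2) by blast
  qed
  have "openin T {q \<in> topspace T. k q = k a}" "openin T {q \<in> topspace T. k q \<noteq> k a}"
    by (rule op)+
  moreover have "topspace T \<subseteq> {q \<in> topspace T. k q = k a} \<union> {q \<in> topspace T. k q \<noteq> k a}" by auto
  moreover have "{q \<in> topspace T. k q = k a} \<inter> {q \<in> topspace T. k q \<noteq> k a} = {}" by auto
  moreover have "a \<in> {q \<in> topspace T. k q = k a}" "b \<in> {q \<in> topspace T. k q \<noteq> k a}" using assms(2,3) ne by auto
  ultimately show False using assms(1) unfolding connected_space_def by blast
qed

text \<open>The segment in a chart is run through by \<open>sin\<close>, because velocities are only defined for curves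
  on the whole line.\<close>

lemma manifold_curve_nbhd:
  fixes N :: "('a, 'e::euclidean_space) mfd"
  assumes N: "manifold N" and p: "p \<in> points N"
  shows "\<exists>Q. openin (mfd_top N) Q \<and> p \<in> Q \<and>
    (\<forall>q\<in>Q. \<exists>c s t. smooth_map vec_mfd UNIV N c \<and> c (s::real) = p \<and> c t = q)"
proof -
  obtain U \<phi> where U: "(U, \<phi>) \<in> charts N" "p \<in> U" by (rule pointsE[OF p])
  note c = compatible_chartsD[OF manifold_compatible[OF N] U(1)]
  have sub: "subspace (model N)" using N by (simp add: manifold_def)
  obtain r where r: "r > 0" "ball (\<phi> p) r \<inter> model N \<subseteq> \<phi> ` U"
    using c(2) U(2) unfolding openin_contains_ball by blast
  have mod: "\<phi> q \<in> model N" if "q \<in> U" for q using openin_imp_subset[OF c(2)] that by blast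
  define Q where "Q = {q \<in> U. \<phi> q \<in> ball (\<phi> p) r}"
  have "\<phi> ` Q = \<phi> ` U \<inter> ball (\<phi> p) r" by (auto simp: Q_def)
  then have "openin (top_of_set (model N)) (\<phi> ` Q)" using c(2) by (simp add: openin_Int_open)
  then have oQ: "openin (mfd_top N) Q" using openin_chartI[OF U(1), of Q] by (auto simp: Q_def)
  have "\<exists>c s t. smooth_map vec_mfd UNIV N c \<and> c (s::real) = p \<and> c t = q" if q: "q \<in> Q" for q
  proof -
    define v where "v = \<phi> q - \<phi> p"
    \<comment> \<open>The bound of \<open>sin\<close> by 1 keeps the curve in the ball, and the
      times \<open>0\<close> and \<open>pi / 2\<close> give the endpoints \<open>p\<close> and
      \<open>q\<close>.\<close>
    define \<gamma> where "\<gamma> = (\<lambda>t::real. \<phi> p + sin t *\<^sub>R v)"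
    have qU: "q \<in> U" and v: "norm v < r" using q by (auto simp: Q_def v_def dist_norm norm_minus_commute)
    have "\<gamma> t \<in> \<phi> ` U" for t
    proof -
      have "norm (sin t *\<^sub>R v) \<le> norm v" using abs_sin_le_one[of t] by (simp add: mult_left_le_one_le)
      then have "\<gamma> t \<in> ball (\<phi> p) r" using v by (simp add: \<gamma>_def dist_norm)
      moreover have "\<gamma> t \<in> model N" unfolding \<gamma>_def v_def
        by (intro subspace_add[OF sub] subspace_scale[OF sub] subspace_diff[OF sub] mod U(2) qU)
      ultimately show ?thesis using r(2) by blast
    qed
    then have ran: "range \<gamma> \<subseteq> \<phi> ` U" by blast
    have "smooth_on UNIV (sin :: real \<Rightarrow> real)" by (rule smooth_onI) (use Ck_sin_cos in auto)
    then have "smooth_on UNIV \<gamma>" unfolding \<gamma>_def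
      by (intro smooth_on_add smooth_on_const smooth_on_scaleR_left)
    then have "smooth_map vec_mfd UNIV N (\<lambda>t. inv_into U \<phi> (\<gamma> t))"
      by (rule smooth_map_chart_inv[OF N U(1) _ ran])
    moreover have "inv_into U \<phi> (\<gamma> 0) = p" "inv_into U \<phi> (\<gamma> (pi / 2)) = q"
      using inv_into_f_f[OF c(1) U(2)] inv_into_f_f[OF c(1) qU] by (simp_all add: \<gamma>_def v_def)
    ultimately show ?thesis by blast
  qed
  moreover have "p \<in> Q" using U(2) r(1) by (simp add: Q_def)
  ultimately show ?thesis using oQ by blast
qed

text \<open>One bracket and one \<open>ex\<close> serve both groups, which encodes that the
  exponential map of the subgroup is the restriction of the ambient one.\<close>

locale lie_subgroup_total = G: lie_group_total G br ex + S: lie_group_algebra S s br ex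
  for G S :: "('a, 'e::euclidean_space) lgroup" and s :: "'d::real_vector set"
    and br :: "'d \<Rightarrow> 'd \<Rightarrow> 'd" and ex :: "'d \<Rightarrow> 'a" +
  assumes sub_carrier: "carrier S \<subseteq> carrier G"
    and sub_mult: "\<And>x y. x \<in> carrier S \<Longrightarrow> y \<in> carrier S \<Longrightarrow> x \<otimes>\<^bsub>S\<^esub> y = x \<otimes>\<^bsub>G\<^esub> y"
    and sub_smooth: "smooth_map (man S) (carrier S) (man G) (\<lambda>x. x)"
begin

lemma sub_mem: "x \<in> carrier S \<Longrightarrow> x \<in> carrier G"
  using sub_carrier by blast

lemma sub_one: "\<one>\<^bsub>S\<^esub> = \<one>\<^bsub>G\<^esub>"
  using sub_mult[OF S.one_closed S.one_closed] sub_mem[OF S.one_closed] by (simp add: G.l_cancel_one)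

lemma sub_inv: "x \<in> carrier S \<Longrightarrow> inv\<^bsub>S\<^esub> x = inv\<^bsub>G\<^esub> x"
  using sub_mult[of "inv\<^bsub>S\<^esub> x" x] by (intro G.inv_equality[symmetric]) (simp_all add: sub_one sub_mem)

lemma sub_curve: "smooth_map vec_mfd W (man S) c \<Longrightarrow> smooth_map vec_mfd W (man G) c"
  by (rule smooth_map_compose[OF _ sub_smooth compatible_vec S.compatible])
    (use S.smooth_map_carrier in auto)

lemma sub_smooth_fun: "smooth_fun (man G) W f \<Longrightarrow> smooth_fun (man S) {p \<in> carrier S. p \<in> W} f"
  using smooth_fun_compose[OF sub_smooth S.compatible G.compatible S.open_carrier] by simp

lemma sub_ex: "X \<in> s \<Longrightarrow> ex (t *\<^sub>R X) \<in> carrier S"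
  by (intro S.ex_carrier S.scale_alg)

lemma sub_lfield: "X \<in> s \<Longrightarrow> p \<in> carrier S \<Longrightarrow> lfield S ex X f p = lfield G ex X f p"
  by (simp add: lfield_def sub_mult sub_ex)

text \<open>Smooth functions on \<open>G\<close> restrict to smooth functions on \<open>S\<close>,
  and the derivatives along one-parameter groups of \<open>S\<close> are the same in both
  groups.\<close>

lemma sub_velocity: assumes "S.velocity c Z" shows "G.velocity c Z"
  unfolding G.velocity_def
proof (intro conjI allI impI)
  fix W f assume f: "\<one>\<^bsub>G\<^esub> \<in> W \<and> smooth_fun (man G) W f"
  have "deriv (\<lambda>t. f (c t)) 0 = lfield S ex Z f \<one>\<^bsub>S\<^esub>"
    by (rule S.velocityD(2)[OF assms _ sub_smooth_fun[of W]]) (use f sub_one S.one_closed in auto)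
  then show "deriv (\<lambda>t. f (c t)) 0 = lfield G ex Z f \<one>\<^bsub>G\<^esub>"
    using sub_lfield[OF S.velocityD(1)[OF assms] S.one_closed] by (simp add: sub_one)
qed simp

text \<open>Conjugation inside \<open>S\<close> has a generator in \<open>s\<close>; uniqueness in
  the ambient group identifies it with \<open>Adj\<close>.\<close>

lemma Adj_closed:
  assumes x: "x \<in> carrier S" and X: "X \<in> s"
  shows "Adj G ex x X \<in> s"
proof -
  obtain Y where Y: "Y \<in> s" "\<And>t. ex (t *\<^sub>R Y) = x \<otimes>\<^bsub>S\<^esub> ex (t *\<^sub>R X) \<otimes>\<^bsub>S\<^esub> inv\<^bsub>S\<^esub> x"
    using S.ad_exists[OF x X] by blast
  have "x \<otimes>\<^bsub>S\<^esub> ex (t *\<^sub>R X) \<in> carrier S" for t by (rule S.m_closed[OF x sub_ex[OF X]])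
  then have "Adj G ex x X = Y"
    by (intro G.Adj_eqI) (use x Y(2) sub_ex[OF X] sub_mem sub_mult sub_inv S.inv_closed in simp_all)
  then show ?thesis using Y(1) by simp
qed

text \<open>Since \<open>ex (t X) p = p ex (t (Ad p\<inverse> X))\<close>, right-invariant fields are left-invariant ones.\<close>

lemma rfield_eq_lfield:
  assumes p: "p \<in> carrier S" and X: "X \<in> s"
  shows "rfield S ex X f p = lfield S ex (Adj G ex (inv\<^bsub>G\<^esub> p) X) f p"
proof -
  have A: "Adj G ex (inv\<^bsub>G\<^esub> p) X \<in> s" using Adj_closed[OF S.inv_closed[OF p] X] by (simp add: sub_inv p)
  have "ex (t *\<^sub>R X) \<otimes>\<^bsub>S\<^esub> p = p \<otimes>\<^bsub>S\<^esub> ex (t *\<^sub>R Adj G ex (inv\<^bsub>G\<^esub> p) X)" for t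
  proof -
    have "p \<otimes>\<^bsub>G\<^esub> ex (t *\<^sub>R Adj G ex (inv\<^bsub>G\<^esub> p) X) = ex (t *\<^sub>R X) \<otimes>\<^bsub>G\<^esub> p"
      using sub_mem[OF p] G.exs_carrier by (simp add: G.ex_Adj flip: G.m_assoc)
    then show ?thesis using sub_mem[OF p] G.exs_carrier by (simp add: sub_mult p sub_ex[OF X] sub_ex[OF A])
  qed
  then show ?thesis by (simp add: rfield_def lfield_def)
qed

text \<open>Kept general in \<open>\<beta>\<close> because it is applied twice: to the scalar
  product and to its twist by a projection.\<close>

lemma Adj_invariant:
  fixes \<beta> :: "'d \<Rightarrow> 'd \<Rightarrow> real"
  assumes fin: "finite B" "span B = (UNIV :: 'd set)" and \<beta>: "bilinear \<beta>"
    and inv: "\<And>Z X Y. Z \<in> s \<Longrightarrow> \<beta> (br Z X) Y + \<beta> X (br Z Y) = 0"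
    and conn: "connected_lgroup S" and x: "x \<in> carrier S"
  shows "\<beta> (Adj G ex x X) (Adj G ex x Y) = \<beta> X Y"
proof -
  define k where "k = (\<lambda>x. \<beta> (Adj G ex x X) (Adj G ex x Y))"
  have der: "((\<lambda>t. k (c t)) has_real_derivative 0) (at t)"
    if c: "smooth_map vec_mfd UNIV (man S) c" for c :: "real \<Rightarrow> 'a" and t
  proof -
    \<comment> \<open>Right translation makes the curve pass through the unit at time 0. The
      derivative at an arbitrary time \<open>t\<close> thereby becomes the derivative of
      \<open>Ad\<close> at the unit, applied to the fixed vectors \<open>X'\<close> and
      \<open>Y'\<close>.\<close>
    define b where "b = (\<lambda>u. c (u + t) \<otimes>\<^bsub>S\<^esub> inv\<^bsub>S\<^esub> (c t))"
    have cS: "c u \<in> carrier S" for u using S.smooth_map_carrier[OF c] by simp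
    have shift: "smooth_on UNIV (\<lambda>u. u + t)"
      by (intro smooth_on_add smooth_on_const smooth_on_bounded_linear bounded_linear_ident)
    have b: "smooth_map vec_mfd UNIV (man S) b" unfolding b_def
      by (intro S.smooth_map_mult S.smooth_map_vec_constant S.inv_closed cS compatible_vec
          S.smooth_map_reparam[OF c shift])
    have b0: "b 0 = \<one>\<^bsub>S\<^esub>" using cS by (simp add: b_def)
    have bS: "b u \<in> carrier S" for u using S.smooth_map_carrier[OF b] by simp
    obtain Z where Z: "S.velocity b Z" using S.velocity_exists[OF b b0] by blast
    have bc: "c (u + t) = b u \<otimes>\<^bsub>G\<^esub> c t" for u
      using cS S.m_closed S.inv_closed bS by (simp add: b_def S.m_assoc flip: sub_mult)
    define X' where "X' = Adj G ex (c t) X"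
    define Y' where "Y' = Adj G ex (c t) Y"
    have D: "((\<lambda>u. l (Adj G ex (b u) V)) has_real_derivative l (br Z V)) (at 0)" if "linear l" for l :: "'d \<Rightarrow> real" and V
      by (rule G.DERIV_Adj_curve[OF sub_curve[OF b] _ sub_velocity[OF Z] that]) (simp add: b0 sub_one)
    have "((\<lambda>u. \<beta> (Adj G ex (b u) X') (Adj G ex (b u) Y')) has_real_derivative
       \<beta> (br Z X') (Adj G ex (b 0) Y') + \<beta> (Adj G ex (b 0) X') (br Z Y')) (at 0)"
      by (rule DERIV_bilinear[OF fin \<beta> D D])
    moreover have "\<beta> (br Z X') (Adj G ex (b 0) Y') + \<beta> (Adj G ex (b 0) X') (br Z Y') = 0"
      using inv[OF S.velocityD(1)[OF Z]] by (simp add: b0 sub_one G.Adj_one)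
    moreover have "k (c (u + t)) = \<beta> (Adj G ex (b u) X') (Adj G ex (b u) Y')" for u
      unfolding k_def bc X'_def Y'_def using sub_mem[OF bS] sub_mem[OF cS] by (simp add: G.Adj_mult)
    ultimately have "((\<lambda>u. k (c (u + t))) has_real_derivative 0) (at 0)" by simp
    then show ?thesis using DERIV_shift[of "\<lambda>u. k (c u)" 0 0 t] by simp
  qed
  have "k x = k \<one>\<^bsub>S\<^esub>"
  proof (rule connected_space_locally_constant[OF conn])
    show "x \<in> topspace (mfd_top (man S))" "\<one>\<^bsub>S\<^esub> \<in> topspace (mfd_top (man S))"
      using x by (simp_all add: topspace_mfd[OF S.compatible] S.points)
    fix p assume "p \<in> topspace (mfd_top (man S))"
    then obtain Q where Q: "openin (mfd_top (man S)) Q" "p \<in> Q"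
      "\<And>q. q \<in> Q \<Longrightarrow> \<exists>c a b. smooth_map vec_mfd UNIV (man S) c \<and> c (a::real) = p \<and> c b = q"
      using manifold_curve_nbhd[OF S.manifold, of p] topspace_mfd[OF S.compatible] by auto
    have "k q = k p" if "q \<in> Q" for q
    proof -
      obtain c a b where c: "smooth_map vec_mfd UNIV (man S) c" "c (a::real) = p" "c b = q" using Q(3)[OF \<open>q \<in> Q\<close>] by blast
      have "k (c b) = k (c a)" by (rule DERIV_isconst_all) (use der[OF c(1)] in blast)
      then show ?thesis using c by simp
    qed
    then show "\<exists>Q. openin (mfd_top (man S)) Q \<and> p \<in> Q \<and> (\<forall>q\<in>Q. k q = k p)" using Q by blast
  qed
  then show ?thesis by (simp add: k_def sub_one G.Adj_one)
qed

end

section \<open>The Drinfeld double and its reductive decomposition\<close>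

lemma proj_along_eq:
  assumes "subspace V" "subspace W" "V \<inter> W = {0}" "v \<in> V" "w \<in> W"
  shows "proj_along V W (v + w) = v"
  unfolding proj_along_def
proof (rule the_equality)
  show "v \<in> V \<and> v + w - v \<in> W" using assms(4,5) by simp
  fix x assume x: "x \<in> V \<and> v + w - x \<in> W"
  have "(v + w - x) - w \<in> W" by (rule subspace_diff[OF assms(2) conjunct2[OF x] assms(5)])
  moreover have "v - x \<in> V" by (rule subspace_diff[OF assms(1) assms(4) conjunct1[OF x]])
  ultimately have "v - x \<in> V \<inter> W" by simp
  then show "x = v" unfolding assms(3) by simp
qed

lemma direct_sum_split:
  assumes "direct_sum V W UNIV" obtains v w where "v \<in> V" "w \<in> W" "x = v + w"
proof -
  have "x \<in> {x + y | x y. x \<in> V \<and> y \<in> W}" using assms by (simp add: direct_sum_def)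
  then show ?thesis using that by auto
qed

lemma direct_sum_proj:
  assumes "direct_sum V W UNIV"
  shows "v \<in> V \<Longrightarrow> w \<in> W \<Longrightarrow> proj_along V W (v + w) = v" "linear (proj_along V W)"
    "proj_along V W x \<in> V" "x - proj_along V W x \<in> W"
    "v \<in> V \<Longrightarrow> proj_along V W v = v" "w \<in> W \<Longrightarrow> proj_along V W w = 0"
proof -
  have ds: "subspace V" "subspace W" "V \<inter> W = {0}" using assms by (auto simp: direct_sum_def)
  note eq = proj_along_eq[OF ds]
  show "v \<in> V \<Longrightarrow> w \<in> W \<Longrightarrow> proj_along V W (v + w) = v" by (rule eq)
  show "linear (proj_along V W)"
  proof (rule linearI)
    fix x y obtain v w v' w' where e: "v \<in> V" "w \<in> W" "x = v + w" "v' \<in> V" "w' \<in> W" "y = v' + w'"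
      by (metis direct_sum_split[OF assms])
    have "x + y = (v + v') + (w + w')" using e by simp
    then show "proj_along V W (x + y) = proj_along V W x + proj_along V W y"
      using e eq ds by (metis subspace_add)
  next
    fix r x obtain v w where e: "v \<in> V" "w \<in> W" "x = v + w" by (metis direct_sum_split[OF assms])
    have "r *\<^sub>R x = r *\<^sub>R v + r *\<^sub>R w" using e by (simp add: scaleR_add_right)
    then show "proj_along V W (r *\<^sub>R x) = r *\<^sub>R proj_along V W x"
      using e eq ds by (metis subspace_scale)
  qed
  obtain v' w' where e: "v' \<in> V" "w' \<in> W" "x = v' + w'" by (metis direct_sum_split[OF assms])
  show "proj_along V W x \<in> V" "x - proj_along V W x \<in> W" using e eq by auto
  show "v \<in> V \<Longrightarrow> proj_along V W v = v" using eq[of v 0] subspace_0[OF ds(2)] by simp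
  show "w \<in> W \<Longrightarrow> proj_along V W w = 0" using eq[of 0 w] subspace_0[OF ds(1)] by simp
qed

section \<open>Duality between \<open>k\<close> and \<open>ks\<close> and between their
  subspaces\<close>

locale reductive_double =
  fixes br :: "'d::real_vector \<Rightarrow> 'd \<Rightarrow> 'd" and form :: "'d \<Rightarrow> 'd \<Rightarrow> real"
    and k ks h m hs ms :: "'d set"
  assumes double: "drinfeld_double br form k ks"
    and decomp: "direct_sum h m k"
    and hs: "hs = annihilator form ks m" and ms: "ms = annihilator form ks h"
    and hs_subalgebra: "\<forall>\<alpha>\<in>hs. \<forall>\<beta>\<in>hs. br \<alpha> \<beta> \<in> hs"
    and ms_ideal: "\<forall>\<alpha>\<in>ks. \<forall>\<beta>\<in>ms. br \<alpha> \<beta> \<in> ms"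
    and reductive: "\<forall>X\<in>h. \<forall>Y\<in>m. br X Y \<in> m"
begin

lemma finite_dim: obtains B where "finite B" "span B = (UNIV :: 'd set)"
  using double unfolding drinfeld_double_def by blast

lemma bilinear_form: "bilinear form" and form_sym: "form X Y = form Y X"
  and form_br: "form (br X Y) Z = form X (br Y Z)"
  and form_k: "X \<in> k \<Longrightarrow> Y \<in> k \<Longrightarrow> form X Y = 0"
  and form_ks: "\<alpha> \<in> ks \<Longrightarrow> \<beta> \<in> ks \<Longrightarrow> form \<alpha> \<beta> = 0"
  and dual_exists: "linear (l :: 'd \<Rightarrow> real) \<Longrightarrow> \<exists>!\<alpha>. \<alpha> \<in> ks \<and> (\<forall>X\<in>k. form \<alpha> X = l X)"
  and bilinear_br: "bilinear br" and br_self: "br X X = 0"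
  and k_ks: "direct_sum k ks UNIV"
proof -
  note d = double[unfolded drinfeld_double_def lie_bracket_def]
  have "\<forall>X Y. form X Y = form Y X" using d by (elim conjE)
  then show "form X Y = form Y X" by blast
  have "\<forall>X Y Z. form (br X Y) Z = form X (br Y Z)" using d by (elim conjE)
  then show "form (br X Y) Z = form X (br Y Z)" by blast
  have "\<forall>l::'d \<Rightarrow> real. linear l \<longrightarrow> (\<exists>!\<alpha>. \<alpha> \<in> ks \<and> (\<forall>X\<in>k. form \<alpha> X = l X))" using d by (elim conjE)
  then show "linear l \<Longrightarrow> \<exists>!\<alpha>. \<alpha> \<in> ks \<and> (\<forall>X\<in>k. form \<alpha> X = l X)" for l :: "'d \<Rightarrow> real"
    by (elim allE impE)
  have "\<forall>X\<in>k. \<forall>Y\<in>k. form X Y = 0" using d by (elim conjE)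
  then show "X \<in> k \<Longrightarrow> Y \<in> k \<Longrightarrow> form X Y = 0" by simp
  have "\<forall>\<alpha>\<in>ks. \<forall>\<beta>\<in>ks. form \<alpha> \<beta> = 0" using d by (elim conjE)
  then show "\<alpha> \<in> ks \<Longrightarrow> \<beta> \<in> ks \<Longrightarrow> form \<alpha> \<beta> = 0" by simp
  have "\<forall>X. br X X = 0" using d by (elim conjE)
  then show "br X X = 0" ..
  show "bilinear form" using d by (elim conjE)
  show "bilinear br" using d by (elim conjE)
  show "direct_sum k ks UNIV" using d by (elim conjE)
qed

lemmas form_simps = bilinear_ladd[OF bilinear_form] bilinear_radd[OF bilinear_form]
  bilinear_lmul[OF bilinear_form] bilinear_rmul[OF bilinear_form]
  bilinear_lneg[OF bilinear_form] bilinear_rneg[OF bilinear_form]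
  bilinear_lsub[OF bilinear_form] bilinear_rsub[OF bilinear_form]
  bilinear_lzero[OF bilinear_form] bilinear_rzero[OF bilinear_form]

lemma linear_form: "linear (form X)"
  using bilinear_form by (simp add: bilinear_def)

lemma br_anti: "br X Y = - br Y X"
proof -
  have "br (X + Y) (X + Y) = br X Y + br Y X"
    by (simp add: bilinear_ladd[OF bilinear_br] bilinear_radd[OF bilinear_br] br_self[of X] br_self[of Y])
  from trans[OF sym[OF this] br_self] have "br X Y + br Y X = 0" .
  then show ?thesis by (rule eq_neg_iff_add_eq_0[THEN iffD2])
qed

lemma form_invariant: "form (br Z X) Y + form X (br Z Y) = 0"
  using form_br[of X Z Y] br_anti[of Z X] by (simp add: form_simps)

lemma sub: "subspace k" "subspace ks" "subspace h" "subspace m" "subspace hs" "subspace ms"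
  using k_ks decomp hs ms
  by (auto simp: direct_sum_def annihilator_def form_simps subspace_def)

lemma h_k: "X \<in> h \<Longrightarrow> X \<in> k" and m_k: "X \<in> m \<Longrightarrow> X \<in> k"
  and hs_ks: "X \<in> hs \<Longrightarrow> X \<in> ks" and ms_ks: "X \<in> ms \<Longrightarrow> X \<in> ks"
proof -
  have k: "k = {x + y | x y. x \<in> h \<and> y \<in> m}" using decomp by (simp add: direct_sum_def)
  show "X \<in> h \<Longrightarrow> X \<in> k" unfolding k using subspace_0[OF sub(4)] by force
  show "X \<in> m \<Longrightarrow> X \<in> k" unfolding k using subspace_0[OF sub(3)] by force
  show "X \<in> hs \<Longrightarrow> X \<in> ks" "X \<in> ms \<Longrightarrow> X \<in> ks" by (auto simp: hs ms annihilator_def)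
qed

lemma k_split: assumes "X \<in> k" obtains a b where "a \<in> h" "b \<in> m" "X = a + b"
proof -
  have "k = {x + y | x y. x \<in> h \<and> y \<in> m}" using decomp by (simp add: direct_sum_def)
  then show ?thesis using assms that by blast
qed

lemma form_m_hs: "X \<in> m \<Longrightarrow> \<alpha> \<in> hs \<Longrightarrow> form X \<alpha> = 0" "X \<in> m \<Longrightarrow> \<alpha> \<in> hs \<Longrightarrow> form \<alpha> X = 0"
  using form_sym by (auto simp: hs annihilator_def)

lemma form_h_ms: "X \<in> h \<Longrightarrow> \<alpha> \<in> ms \<Longrightarrow> form X \<alpha> = 0" "X \<in> h \<Longrightarrow> \<alpha> \<in> ms \<Longrightarrow> form \<alpha> X = 0"
  using form_sym by (auto simp: ms annihilator_def)

lemma nondeg_ks: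
  assumes "\<alpha> \<in> ks" "\<And>X. X \<in> k \<Longrightarrow> form \<alpha> X = 0" shows "\<alpha> = 0"
proof -
  have "\<exists>!\<alpha>. \<alpha> \<in> ks \<and> (\<forall>X\<in>k. form \<alpha> X = (\<lambda>_. 0) X)" by (rule dual_exists) (rule linear_zero)
  then show ?thesis using assms subspace_0[OF sub(2)] form_simps(9) by metis
qed

text \<open>A functional with value 1 at a nonzero \<open>X\<close> is represented by an element of
  \<open>ks\<close>, which then pairs nontrivially with \<open>X\<close>.\<close>

lemma nondeg_k:
  assumes "X \<in> k" "\<And>\<alpha>. \<alpha> \<in> ks \<Longrightarrow> form X \<alpha> = 0" shows "X = 0"
proof (rule ccontr)
  assume "X \<noteq> 0"
  then have "independent {X}" by simp
  then obtain l :: "'d \<Rightarrow> real" where l: "linear l" "l X = 1"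
    using linear_independent_extend[of "{X}" "\<lambda>_. 1 :: real"] by auto
  then obtain \<alpha> where "\<alpha> \<in> ks" "form \<alpha> X = 1" using dual_exists[OF l(1)] assms(1) by auto
  then show False using assms(2)[of \<alpha>] form_sym by auto
qed

text \<open>The component in \<open>hs\<close> represents the functional that equals
  \<open>\<alpha>\<close> on \<open>h\<close> and vanishes on \<open>m\<close>; the rest annihilates
  \<open>h\<close>.\<close>

lemma ks_split: assumes "\<alpha> \<in> ks" obtains a b where "a \<in> hs" "b \<in> ms" "\<alpha> = a + b"
proof -
  \<comment> \<open>\<open>dual_exists\<close> takes functionals on the whole double, so
    \<open>\<alpha>\<close> is composed with the projection onto \<open>h\<close> along a complement
    that contains \<open>m\<close>.\<close>
  let ?W = "{x + y | x y. x \<in> m \<and> y \<in> ks}"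
  have hm: "h \<inter> m = {0}" and kk: "k \<inter> ks = {0}" using decomp k_ks by (auto simp: direct_sum_def)
  have W: "subspace ?W" by (rule subspace_sums[OF sub(4,2)])
  have "x = 0" if x: "x \<in> h" "y \<in> m" "z \<in> ks" "x = y + z" for x y z
  proof -
    have "x - y \<in> k" using h_k[OF x(1)] m_k[OF x(2)] by (rule subspace_diff[OF sub(1)])
    then have "z = 0" using kk x by auto
    then show "x = 0" using hm x by auto
  qed
  then have "h \<inter> ?W \<subseteq> {0}" by blast
  moreover have "0 \<in> h \<inter> ?W" using subspace_0[OF sub(3)] subspace_0[OF W] by blast
  moreover have "x \<in> {x + y | x y. x \<in> h \<and> y \<in> ?W}" for x
  proof -
    obtain u v where u: "u \<in> k" "v \<in> ks" "x = u + v" by (rule direct_sum_split[OF k_ks])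
    obtain a b where "a \<in> h" "b \<in> m" "u = a + b" by (rule k_split[OF u(1)])
    then have "x = a + (b + v)" "a \<in> h" "b + v \<in> ?W" using u by auto
    then show ?thesis by blast
  qed
  ultimately have ds: "direct_sum h ?W UNIV" using sub(3) W unfolding direct_sum_def by blast
  have mW: "m \<subseteq> ?W" using subspace_0[OF sub(2)] by force
  let ?P = "proj_along h ?W"
  have "linear (\<lambda>x. form \<alpha> (?P x))"
    using linear_compose[OF direct_sum_proj(2)[OF ds] linear_form] by (simp add: o_def)
  from dual_exists[OF this] obtain a where a: "a \<in> ks" "\<And>X. X \<in> k \<Longrightarrow> form a X = form \<alpha> (?P X)" by blast
  have "form a X = 0" if "X \<in> m" for X
    using a(2)[OF m_k[OF that]] direct_sum_proj(6)[OF ds subsetD[OF mW that]] by (simp add: form_simps)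
  then have "a \<in> hs" using a(1) by (simp add: hs annihilator_def)
  moreover have "form a X = form \<alpha> X" if "X \<in> h" for X
    using a(2)[OF h_k[OF that]] direct_sum_proj(5)[OF ds that] by simp
  then have "\<alpha> - a \<in> ms" using subspace_diff[OF sub(2) assms a(1)] by (simp add: ms annihilator_def form_simps)
  ultimately show ?thesis using that[of a "\<alpha> - a"] by simp
qed

text \<open>As \<open>ms\<close> annihilates \<open>h\<close>, pairing with \<open>hs\<close>
  detects all that pairing with \<open>ks\<close> does.\<close>

lemma nondeg_h:
  assumes "X \<in> h" "\<And>\<alpha>. \<alpha> \<in> hs \<Longrightarrow> form X \<alpha> = 0" shows "X = 0"
proof (rule nondeg_k[OF h_k[OF assms(1)]])
  fix \<alpha> assume "\<alpha> \<in> ks"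
  then obtain a b where "a \<in> hs" "b \<in> ms" "\<alpha> = a + b" by (rule ks_split)
  then show "form X \<alpha> = 0" using assms form_h_ms by (simp add: form_simps)
qed

lemma hs_ms_zero: assumes "\<alpha> \<in> hs" "\<alpha> \<in> ms" shows "\<alpha> = 0"
proof (rule nondeg_ks[OF hs_ks[OF assms(1)]])
  fix X assume "X \<in> k"
  then obtain a b where "a \<in> h" "b \<in> m" "X = a + b" by (rule k_split)
  then show "form \<alpha> X = 0" using assms form_h_ms form_m_hs by (simp add: form_simps)
qed

lemma k_ks_zero: "X \<in> k \<Longrightarrow> X \<in> ks \<Longrightarrow> X = 0"
  using k_ks by (auto simp: direct_sum_def)

lemma h_m_zero: "X \<in> h \<Longrightarrow> X \<in> m \<Longrightarrow> X = 0"
  using decomp by (auto simp: direct_sum_def)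

text \<open>Both summands are isotropic, so pairing with \<open>ks\<close> tests the
  \<open>k\<close>-component alone and pairing with \<open>k\<close> tests the other one.\<close>

lemma nondegenerate:
  assumes "\<And>Y. form X Y = 0" shows "X = 0"
proof -
  obtain u v where u: "u \<in> k" "v \<in> ks" "X = u + v" by (rule direct_sum_split[OF k_ks])
  have *: "form u Y + form v Y = 0" for Y using assms[of Y] u(3) by (simp add: form_simps)
  have "u = 0"
  proof (rule nondeg_k[OF u(1)])
    show "form u \<alpha> = 0" if "\<alpha> \<in> ks" for \<alpha> using *[of \<alpha>] form_ks[OF u(2) that] by simp
  qed
  moreover have "v = 0"
  proof (rule nondeg_ks[OF u(2)])
    show "form v Y = 0" if "Y \<in> k" for Y using *[of Y] form_k[OF u(1) that] by simp
  qed
  ultimately show ?thesis using u by simp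
qed

text \<open>The representing element is read off the basis of \<open>ks\<close> dual to a basis of \<open>k\<close>.\<close>

lemma represent_functional:
  fixes \<phi> :: "'d \<Rightarrow> real"
  assumes \<phi>: "\<And>X Y a b. X \<in> ks \<Longrightarrow> Y \<in> ks \<Longrightarrow> \<phi> (a *\<^sub>R X + b *\<^sub>R Y) = a * \<phi> X + b * \<phi> Y"
  obtains Y where "Y \<in> k" "\<And>X. X \<in> ks \<Longrightarrow> form Y X = \<phi> X"
proof -
  obtain C where C: "C \<subseteq> k" "independent C" "k \<subseteq> span C" by (rule basis_exists[of k])
  obtain B where B: "finite B" "span B = (UNIV :: 'd set)" by (rule finite_dim)
  have fin: "finite C" using independent_span_bound[OF B(1) C(2)] B(2) by simp
  have "\<exists>\<alpha>. \<alpha> \<in> ks \<and> (\<forall>x\<in>C. form \<alpha> x = (if x = c then 1 else 0))" for c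
  proof -
    obtain l :: "'d \<Rightarrow> real" where l: "linear l" "\<forall>x\<in>C. l x = (if x = c then 1 else 0)"
      using linear_independent_extend[OF C(2), of "\<lambda>x. if x = c then 1 else 0 :: real"] by blast
    from dual_exists[OF l(1)] obtain \<alpha> where a: "\<alpha> \<in> ks" "\<forall>X\<in>k. form \<alpha> X = l X" by blast
    have "form \<alpha> x = (if x = c then 1 else 0)" if "x \<in> C" for x
      using bspec[OF a(2) subsetD[OF C(1) that]] bspec[OF l(2) that] by (simp only:)
    then show ?thesis using a(1) by blast
  qed
  then obtain \<alpha> where \<alpha>: "\<And>c. \<alpha> c \<in> ks" "\<And>c x. x \<in> C \<Longrightarrow> form (\<alpha> c) x = (if x = c then 1 else 0)" by metis
  have exp: "X = (\<Sum>c\<in>C. form X c *\<^sub>R \<alpha> c)" if X: "X \<in> ks" for X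
  proof -
    let ?S = "\<Sum>c\<in>C. form X c *\<^sub>R \<alpha> c"
    have S: "?S \<in> ks" by (intro subspace_sum[OF sub(2)] subspace_scale[OF sub(2)] \<alpha>)
    have "form (X - ?S) x = 0" if "x \<in> C" for x
    proof -
      have "form ?S x = form x ?S" by (rule form_sym)
      also have "\<dots> = (\<Sum>c\<in>C. form X c * form x (\<alpha> c))"
        by (simp add: linear_sum[OF linear_form] form_simps)
      also have "\<dots> = (\<Sum>c\<in>C. if c = x then form X c else 0)"
        by (rule sum.cong) (use \<alpha>(2)[OF that] form_sym[of x] in auto)
      also have "\<dots> = form X x" using that fin by simp
      finally show ?thesis by (simp add: form_simps)
    qed
    then have "form (X - ?S) x = 0" if "x \<in> k" for x
      using linear_eq_0_on_span[OF linear_form, of C "X - ?S" x] C(3) that by blast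
    then have "X - ?S = 0" by (intro nondeg_ks subspace_diff[OF sub(2)] X S)
    then show ?thesis by simp
  qed
  \<comment> \<open>\<open>\<phi>\<close> is linear on \<open>ks\<close> only, so its additivity
    over finite sums is proved by an induction that stays inside \<open>ks\<close>.\<close>
  have sum: "\<phi> (\<Sum>c\<in>I. r c *\<^sub>R \<alpha> c) = (\<Sum>c\<in>I. r c * \<phi> (\<alpha> c))" if "finite I" for I and r :: "'d \<Rightarrow> real"
    using that
  proof induction
    case empty
    have "\<phi> (0 *\<^sub>R 0 + 0 *\<^sub>R 0) = 0 * \<phi> 0 + 0 * \<phi> 0" by (rule \<phi>) (rule subspace_0[OF sub(2)])+
    then show ?case by simp
  next
    case (insert c I)
    have "(\<Sum>c\<in>I. r c *\<^sub>R \<alpha> c) \<in> ks" by (intro subspace_sum[OF sub(2)] subspace_scale[OF sub(2)] \<alpha>)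
    then show ?case using \<phi>[OF \<alpha>(1)[of c], of "\<Sum>c\<in>I. r c *\<^sub>R \<alpha> c" "r c" 1] insert by simp
  qed
  show ?thesis
  proof (rule that[of "\<Sum>c\<in>C. \<phi> (\<alpha> c) *\<^sub>R c"])
    show "(\<Sum>c\<in>C. \<phi> (\<alpha> c) *\<^sub>R c) \<in> k"
      using C(1) by (intro subspace_sum[OF sub(1)] subspace_scale[OF sub(1)]) auto
    fix X assume X: "X \<in> ks"
    have "form (\<Sum>c\<in>C. \<phi> (\<alpha> c) *\<^sub>R c) X = form X (\<Sum>c\<in>C. \<phi> (\<alpha> c) *\<^sub>R c)" by (rule form_sym)
    also have "\<dots> = (\<Sum>c\<in>C. form X c * \<phi> (\<alpha> c))"
      by (simp add: linear_sum[OF linear_form] form_simps mult.commute)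
    also have "\<dots> = \<phi> (\<Sum>c\<in>C. form X c *\<^sub>R \<alpha> c)" by (rule sum[OF fin, symmetric])
    also have "\<dots> = \<phi> X" using exp[OF X] by simp
    finally show "form (\<Sum>c\<in>C. \<phi> (\<alpha> c) *\<^sub>R c) X = \<phi> X" .
  qed
qed

section \<open>The orthogonal splitting into the double of \<open>h\<close> and its
  complement\<close>

definition hpart :: "'d set" where "hpart = {x + y | x y. x \<in> h \<and> y \<in> hs}"
definition mpart :: "'d set" where "mpart = {x + y | x y. x \<in> m \<and> y \<in> ms}"

lemma hpartE: assumes "X \<in> hpart" obtains a b where "a \<in> h" "b \<in> hs" "X = a + b"
  using assms by (auto simp: hpart_def)

lemma mpartE: assumes "X \<in> mpart" obtains a b where "a \<in> m" "b \<in> ms" "X = a + b"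
  using assms by (auto simp: mpart_def)

lemma hpartI: "X \<in> h \<Longrightarrow> X \<in> hpart" "X \<in> hs \<Longrightarrow> X \<in> hpart"
  using subspace_0[OF sub(3)] subspace_0[OF sub(5)] by (force simp: hpart_def)+

lemma mpartI: "X \<in> m \<Longrightarrow> X \<in> mpart" "X \<in> ms \<Longrightarrow> X \<in> mpart"
  using subspace_0[OF sub(4)] subspace_0[OF sub(6)] by (force simp: mpart_def)+

lemma form_hpart_mpart: assumes "X \<in> hpart" "Y \<in> mpart" shows "form X Y = 0"
proof -
  obtain a b where X: "a \<in> h" "b \<in> hs" "X = a + b" by (rule hpartE[OF assms(1)])
  obtain c d where Y: "c \<in> m" "d \<in> ms" "Y = c + d" by (rule mpartE[OF assms(2)])
  show ?thesis using X Y form_k[OF h_k m_k] form_ks[OF hs_ks ms_ks] form_h_ms form_m_hs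
    by (simp add: form_simps)
qed

lemma subspace_parts: "subspace hpart" "subspace mpart"
  unfolding hpart_def mpart_def by (intro subspace_sums sub)+

text \<open>The sum is direct because an element of both summands is orthogonal to both, hence to
  everything.\<close>

lemma hpart_mpart: "direct_sum hpart mpart UNIV"
proof -
  have dec: "X \<in> {x + y | x y. x \<in> hpart \<and> y \<in> mpart}" for X
  proof -
    obtain u v where u: "u \<in> k" "v \<in> ks" "X = u + v" by (rule direct_sum_split[OF k_ks])
    obtain a b where a: "a \<in> h" "b \<in> m" "u = a + b" by (rule k_split[OF u(1)])
    obtain c d where c: "c \<in> hs" "d \<in> ms" "v = c + d" by (rule ks_split[OF u(2)])
    have "X = (a + c) + (b + d)" using u a c by simp
    then show ?thesis using a c by (force simp: hpart_def mpart_def)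
  qed
  have "X = 0" if X: "X \<in> hpart" "X \<in> mpart" for X
  proof (rule nondegenerate)
    fix Y
    obtain u v where u: "u \<in> hpart" "v \<in> mpart" "Y = u + v" using dec[of Y] by blast
    show "form X Y = 0"
      using form_hpart_mpart[OF X(1) u(2)] form_hpart_mpart[OF u(1) X(2)] form_sym[of X u] u(3)
      by (simp add: form_simps)
  qed
  moreover have "0 \<in> hpart" "0 \<in> mpart" using subspace_0 subspace_parts by blast+
  ultimately show ?thesis unfolding direct_sum_def using subspace_parts dec by auto
qed

text \<open>The \<open>mpart\<close>-component of such an \<open>X\<close> is orthogonal to the
  whole double. This turns membership into pairings that the invariance of the form can
  evaluate.\<close>

lemma hpartI_orthogonal: assumes "\<And>Y. Y \<in> mpart \<Longrightarrow> form X Y = 0" shows "X \<in> hpart"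
proof -
  obtain a b where X: "a \<in> hpart" "b \<in> mpart" "X = a + b" by (rule direct_sum_split[OF hpart_mpart])
  have "b = 0"
  proof (rule nondegenerate)
    fix Y obtain u v where u: "u \<in> hpart" "v \<in> mpart" "Y = u + v" by (rule direct_sum_split[OF hpart_mpart])
    have "form X v = 0" using assms u by blast
    then show "form b Y = 0"
      using form_hpart_mpart[OF X(1) u(2)] form_hpart_mpart[OF u(1) X(2)] form_sym[of b u] X(3) u(3)
      by (simp add: form_simps)
  qed
  then show ?thesis using X by simp
qed

lemma mpartI_orthogonal: assumes "\<And>Y. Y \<in> hpart \<Longrightarrow> form X Y = 0" shows "X \<in> mpart"
proof -
  obtain a b where X: "a \<in> hpart" "b \<in> mpart" "X = a + b" by (rule direct_sum_split[OF hpart_mpart])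
  have "a = 0"
  proof (rule nondegenerate)
    fix Y obtain u v where u: "u \<in> hpart" "v \<in> mpart" "Y = u + v" by (rule direct_sum_split[OF hpart_mpart])
    have "form X u = 0" using assms u by blast
    then show "form a Y = 0"
      using form_hpart_mpart[OF X(1) u(2)] form_hpart_mpart[OF u(1) X(2)] form_sym[of b u] X(3) u(3)
      by (simp add: form_simps)
  qed
  then show ?thesis using X by simp
qed

text \<open>All three algebraic hypotheses meet here. The subalgebra condition treats the component
  in \<open>hs\<close>. For \<open>a\<close> in \<open>h\<close>, shifting the bracket across the
  form turns the pairing with \<open>c\<close> in \<open>m\<close> into that of \<open>Z\<close>
  with \<open>br a c\<close> in \<open>m\<close>, and the pairing with \<open>d\<close> in
  \<open>ms\<close> into that of \<open>a\<close> with \<open>br Z d\<close> in \<open>ms\<close>,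
  up to sign; both are zero.\<close>

lemma br_hpart: assumes Z: "Z \<in> hs" and X: "X \<in> hpart" shows "br Z X \<in> hpart"
proof -
  obtain a b where ab: "a \<in> h" "b \<in> hs" "X = a + b" by (rule hpartE[OF X])
  have "br Z a \<in> hpart"
  proof (rule hpartI_orthogonal)
    fix Y assume "Y \<in> mpart"
    then obtain c d where cd: "c \<in> m" "d \<in> ms" "Y = c + d" by (rule mpartE)
    have "br a c \<in> m" "br Z d \<in> ms" using reductive ms_ideal ab cd hs_ks[OF Z] by auto
    then have "form Z (br a c) = 0" "form a (br Z d) = 0" using form_m_hs(2)[OF _ Z] form_h_ms(1)[OF ab(1)] by auto
    then show "form (br Z a) Y = 0" using form_invariant[of Z a d] by (simp add: cd(3) form_simps form_br)
  qed
  moreover have "br Z b \<in> hpart" using hs_subalgebra Z ab hpartI(2) by blast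
  ultimately show ?thesis
    using subspace_add[OF subspace_parts(1)] by (simp add: ab(3) bilinear_radd[OF bilinear_br])
qed

text \<open>\<open>br Z\<close> is skew for the form, so it preserves the orthogonal complement of a
  subspace that it preserves.\<close>

lemma br_mpart: assumes Z: "Z \<in> hs" and X: "X \<in> mpart" shows "br Z X \<in> mpart"
proof (rule mpartI_orthogonal)
  fix Y assume "Y \<in> hpart"
  then have "form (br Z Y) X = 0" using form_hpart_mpart[OF br_hpart[OF Z] X] by blast
  then show "form (br Z X) Y = 0" using form_invariant[of Z X Y] form_sym by simp
qed

lemma proj_br:
  assumes Z: "Z \<in> hs"
  shows "proj_along hpart mpart (br Z X) = br Z (proj_along hpart mpart X)"
proof -
  obtain u v where u: "u \<in> hpart" "v \<in> mpart" "X = u + v" by (rule direct_sum_split[OF hpart_mpart])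
  have "br Z X = br Z u + br Z v" by (simp add: u(3) bilinear_radd[OF bilinear_br])
  then show ?thesis
    using direct_sum_proj(1)[OF hpart_mpart br_hpart[OF Z u(1)] br_mpart[OF Z u(2)]]
      direct_sum_proj(1)[OF hpart_mpart u(1,2)] u(3) by simp
qed

text \<open>Translates the component of the four-term decomposition in the final formula into the
  two-term decomposition available for vectors of \<open>mpart\<close>.\<close>

lemma proj_along_ms:
  assumes "a \<in> m" "b \<in> ms"
  shows "proj_along ms (span (h \<union> m \<union> hs)) (a + b) = b"
proof -
  have "{x + y | x y. x \<in> k \<and> y \<in> hs} \<supseteq> span (h \<union> m \<union> hs)"
  proof (rule span_minimal[OF _ subspace_sums[OF sub(1,5)]])
    have "x = x + 0" "x = 0 + x" for x :: 'd by auto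
    then show "h \<union> m \<union> hs \<subseteq> {x + y | x y. x \<in> k \<and> y \<in> hs}"
      using subspace_0[OF sub(1)] subspace_0[OF sub(5)] h_k m_k by blast
  qed
  moreover have "x + y = 0" if "x \<in> k" "y \<in> hs" "x + y \<in> ms" for x y
  proof -
    have "x + y - y \<in> ks" by (rule subspace_diff[OF sub(2) ms_ks[OF that(3)] hs_ks[OF that(2)]])
    then have "x = 0" using k_ks_zero[OF that(1)] by simp
    then show ?thesis using hs_ms_zero that by simp
  qed
  ultimately have "ms \<inter> span (h \<union> m \<union> hs) = {0}"
    using subspace_0[OF sub(6)] span_0 by blast
  then have "proj_along ms (span (h \<union> m \<union> hs)) (b + a) = b"
    by (intro proj_along_eq sub subspace_span assms(2)) (use assms(1) in \<open>auto intro: span_base\<close>)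
  then show ?thesis by (simp add: add.commute)
qed

lemma proj_along_m:
  assumes "a \<in> m" "b \<in> ms"
  shows "proj_along m (span (h \<union> hs \<union> ms)) (a + b) = a"
proof -
  have "{x + y | x y. x \<in> h \<and> y \<in> ks} \<supseteq> span (h \<union> hs \<union> ms)"
  proof (rule span_minimal[OF _ subspace_sums[OF sub(3,2)]])
    have "x = x + 0" "x = 0 + x" for x :: 'd by auto
    then show "h \<union> hs \<union> ms \<subseteq> {x + y | x y. x \<in> h \<and> y \<in> ks}"
      using subspace_0[OF sub(3)] subspace_0[OF sub(2)] hs_ks ms_ks by blast
  qed
  moreover have "x + y = 0" if "x \<in> h" "y \<in> ks" "x + y \<in> m" for x y
  proof -
    have "x + y - x \<in> k" by (rule subspace_diff[OF sub(1) m_k[OF that(3)] h_k[OF that(1)]])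
    then have "y = 0" using k_ks_zero[OF _ that(2)] by simp
    then show ?thesis using h_m_zero that by simp
  qed
  ultimately have "m \<inter> span (h \<union> hs \<union> ms) = {0}"
    using subspace_0[OF sub(4)] span_0 by blast
  then show ?thesis
    by (intro proj_along_eq sub subspace_span assms(1)) (use assms(2) in \<open>auto intro: span_base\<close>)
qed

end

section \<open>The Dirac reduction\<close>

lemma lie_subgroup_smooth: "lie_subgroup S G \<Longrightarrow> smooth_map (man S) (carrier S) (man G) (\<lambda>x. x)"
  unfolding lie_subgroup_def immersion_def lie_group_def by auto

section \<open>The action of \<open>Hs\<close> on the splitting of the double\<close>

locale dual_reduction = reductive_double br form k ks h m hs ms
    + K: lie_subgroup_total D Ks ks br ex + H: lie_subgroup_total D Hs hs br ex
  for D Ks Hs :: "('a, 'e::euclidean_space) lgroup"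
    and br :: "'d::real_normed_vector \<Rightarrow> 'd \<Rightarrow> 'd" and form ex k ks h m hs ms +
  assumes connected: "connected_lgroup Hs"
    and Hs_Ks: "carrier Hs \<subseteq> carrier Ks"
    and smooth_Hs_Ks: "smooth_map (man Hs) (carrier Hs) (man Ks) (\<lambda>x. x)"
begin

abbreviation "Ad \<equiv> Adj D ex"

lemma Hs_in_Ks: "l \<in> carrier Hs \<Longrightarrow> l \<in> carrier Ks"
  using Hs_Ks by blast

lemma form_Ad: assumes "l \<in> carrier Hs" shows "form (Ad l X) (Ad l Y) = form X Y"
proof -
  obtain B where B: "finite B" "span B = (UNIV :: 'd set)" by (rule finite_dim)
  show ?thesis by (rule H.Adj_invariant[OF B bilinear_form form_invariant connected assms])
qed

lemma form_Ad_inv: assumes "l \<in> carrier Hs" shows "form X (Ad (inv\<^bsub>D\<^esub> l) Y) = form (Ad l X) Y"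
  using form_Ad[OF assms, of X "Ad (inv\<^bsub>D\<^esub> l) Y"] K.G.Adj_inv(1)[OF H.sub_mem[OF assms]] by simp

lemma linear_Ad: assumes "l \<in> carrier Hs" shows "linear (Ad l)"
  by (rule K.G.linear_Adj[OF H.sub_mem[OF assms]])

text \<open>The form twisted by the projection onto \<open>h + h\<^sup>*\<close> is again \<open>ad h\<^sup>*\<close>-invariant, hence invariant
  under \<open>Ad\<close>; by nondegeneracy the projection therefore commutes with \<open>Ad\<close>.\<close>

lemma proj_Ad:
  assumes l: "l \<in> carrier Hs"
  shows "proj_along hpart mpart (Ad l X) = Ad l (proj_along hpart mpart X)"
proof -
  let ?P = "proj_along hpart mpart"
  have P: "linear ?P" by (rule direct_sum_proj(2)[OF hpart_mpart])
  have \<beta>: "bilinear (\<lambda>X Y. form (?P X) Y)"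
    using bilinear_form linear_compose[OF P, of "\<lambda>x. form x y" for y] by (simp add: bilinear_def o_def)
  obtain B where B: "finite B" "span B = (UNIV :: 'd set)" by (rule finite_dim)
  have inv: "form (?P (Ad l X)) (Ad l Y) = form (?P X) Y" for X Y
    by (rule H.Adj_invariant[OF B \<beta> _ connected l]) (simp add: proj_br form_invariant)
  have "?P (Ad l X) - Ad l (?P X) = 0"
  proof (rule nondegenerate)
    fix Y
    \<comment> \<open>Every \<open>Y\<close> is \<open>Ad l\<close> of something, so invariance of
      the twisted form and of the form itself compares the two operators against arbitrary
      vectors.\<close>
    have "form (?P (Ad l X)) (Ad l (Ad (inv\<^bsub>D\<^esub> l) Y)) = form (Ad l (?P X)) (Ad l (Ad (inv\<^bsub>D\<^esub> l) Y))"
      by (simp only: inv form_Ad[OF l])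
    then show "form (?P (Ad l X) - Ad l (?P X)) Y = 0"
      using K.G.Adj_inv(1)[OF H.sub_mem[OF l]] by (simp add: form_simps)
  qed
  then show ?thesis by simp
qed

lemma Ad_h:
  assumes "l \<in> carrier Hs" "X \<in> h" obtains a b where "a \<in> h" "b \<in> hs" "Ad l X = a + b"
proof -
  have "proj_along hpart mpart (Ad l X) = Ad l X"
    using proj_Ad[OF assms(1), of X] direct_sum_proj(5)[OF hpart_mpart hpartI(1)[OF assms(2)]] by simp
  then have "Ad l X \<in> hpart" using direct_sum_proj(3)[OF hpart_mpart, of "Ad l X"] by simp
  then show ?thesis using that by (rule hpartE)
qed

lemma Ad_m:
  assumes "l \<in> carrier Hs" "X \<in> m" obtains a b where "a \<in> m" "b \<in> ms" "Ad l X = a + b"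
proof -
  have "proj_along hpart mpart (Ad l X) = 0"
    using proj_Ad[OF assms(1), of X] direct_sum_proj(6)[OF hpart_mpart mpartI(1)[OF assms(2)]]
      linear_0[OF linear_Ad[OF assms(1)]] by simp
  then have "Ad l X \<in> mpart" using direct_sum_proj(4)[OF hpart_mpart, of "Ad l X"] by simp
  then show ?thesis using that by (rule mpartE)
qed

text \<open>The Poisson bivector at \<open>l\<close>, moved to the unit by left translation and
  evaluated on two gradients.\<close>

definition \<omega> :: "'a \<Rightarrow> 'd \<Rightarrow> 'd \<Rightarrow> real" where
  "\<omega> l X Y = form (proj_along k ks (Ad l X)) (Ad l Y)"

lemma bilinear_\<omega>: assumes "l \<in> carrier Hs" shows "bilinear (\<omega> l)"
proof -
  have 1: "linear (\<lambda>X. proj_along k ks (Ad l X))"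
    using linear_compose[OF linear_Ad[OF assms] direct_sum_proj(2)[OF k_ks]] by (simp add: o_def)
  have "linear (\<lambda>X. form (proj_along k ks (Ad l X)) (Ad l Y))" for Y
    using linear_compose[OF 1, of "\<lambda>X. form X (Ad l Y)"] bilinear_form by (simp add: o_def bilinear_def)
  moreover have "linear (\<lambda>Y. form (proj_along k ks (Ad l X)) (Ad l Y))" for X
    using linear_compose[OF linear_Ad[OF assms] linear_form] by (simp add: o_def)
  ultimately show ?thesis by (simp add: bilinear_def \<omega>_def)
qed

text \<open>\<open>Ad l\<close> carries the arguments into orthogonal summands, and taking the
  \<open>k\<close>-component does not leave either summand.\<close>

lemma \<omega>_h_m: assumes l: "l \<in> carrier Hs" and X: "X \<in> h" "Y \<in> m" shows "\<omega> l X Y = 0" "\<omega> l Y X = 0"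
proof -
  obtain a b where ab: "a \<in> h" "b \<in> hs" "Ad l X = a + b" by (rule Ad_h[OF l X(1)])
  obtain c d where cd: "c \<in> m" "d \<in> ms" "Ad l Y = c + d" by (rule Ad_m[OF l X(2)])
  have "proj_along k ks (Ad l X) = a" "proj_along k ks (Ad l Y) = c"
    using direct_sum_proj(1)[OF k_ks] ab cd h_k m_k hs_ks ms_ks by auto
  then show "\<omega> l X Y = 0" "\<omega> l Y X = 0" unfolding \<omega>_def ab(3) cd(3)
    using ab cd form_k[OF h_k m_k] form_k[OF m_k h_k] form_h_ms form_m_hs by (auto simp: form_simps)
qed

text \<open>The \<open>k\<close>-component of \<open>Ad l X\<close> is its
  \<open>m\<close>-component, and by isotropy of \<open>k\<close> it sees only the
  \<open>ms\<close>-component of \<open>Ad l Y\<close>.\<close>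

lemma \<omega>_m:
  assumes l: "l \<in> carrier Hs" and X: "X \<in> m" "Y \<in> m"
  shows "\<omega> l X Y = form (proj_along ms (span (h \<union> m \<union> hs)) (Ad l Y)) (proj_along m (span (h \<union> hs \<union> ms)) (Ad l X))"
proof -
  obtain a b where ab: "a \<in> m" "b \<in> ms" "Ad l X = a + b" by (rule Ad_m[OF l X(1)])
  obtain c d where cd: "c \<in> m" "d \<in> ms" "Ad l Y = c + d" by (rule Ad_m[OF l X(2)])
  have "\<omega> l X Y = form a (c + d)" unfolding \<omega>_def ab(3) cd(3)
    using direct_sum_proj(1)[OF k_ks m_k[OF ab(1)] ms_ks[OF ab(2)]] by simp
  also have "\<dots> = form d a" using form_k[OF m_k[OF ab(1)] m_k[OF cd(1)]] form_sym[of a d] by (simp add: form_simps)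
  finally show ?thesis unfolding ab(3) cd(3) proj_along_ms[OF cd(1,2)] proj_along_m[OF ab(1,2)] .
qed

section \<open>Gradients and the brackets on the two dual groups\<close>

lemma gradient_exists:
  assumes "smooth_fun (man Ks) W f" "p \<in> W"
  obtains Y where "Y \<in> k" "\<And>X. X \<in> ks \<Longrightarrow> form Y X = lfield Ks ex X f p"
  by (rule represent_functional[OF K.S.lfield_linear[OF _ _ assms]], assumption, assumption) (rule that)

text \<open>\<open>grad\<close> is the \<open>k\<close>-component of \<open>Ad l\<close> applied to
  \<open>grad'\<close>: right-invariant fields are left-invariant ones twisted by \<open>Ad\<close>
  of the inverse, and the discarded \<open>ks\<close>-component pairs to zero with
  \<open>ks\<close>.\<close>

lemma bracket_Ks:
  assumes l: "l \<in> carrier Hs"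
    and Y1: "Y1 \<in> k" "\<And>X. X \<in> ks \<Longrightarrow> form Y1 X = lfield Ks ex X f1 l"
    and Y2: "Y2 \<in> k" "\<And>X. X \<in> ks \<Longrightarrow> form Y2 X = lfield Ks ex X f2 l"
  shows "dual_bracket D Ks k ks form ex f1 f2 l = \<omega> l Y1 Y2"
proof -
  have uniq: "Y = Y'" if "Y \<in> k" "Y' \<in> k" "\<And>X. X \<in> ks \<Longrightarrow> form Y X = form Y' X" for Y Y'
  proof -
    have "Y - Y' = 0" by (rule nondeg_k) (use that subspace_diff[OF sub(1)] in \<open>auto simp: form_simps\<close>)
    then show ?thesis by simp
  qed
  have g': "grad' Ks k ks form ex f2 l = Y2"
    unfolding grad'_def by (rule the_equality) (use Y2 uniq in auto)
  let ?Y = "proj_along k ks (Ad l Y1)"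
  have Yk: "?Y \<in> k" by (rule direct_sum_proj(3)[OF k_ks])
  have Y: "form ?Y X = rfield Ks ex X f1 l" if X: "X \<in> ks" for X
  proof -
    have A: "Ad (inv\<^bsub>D\<^esub> l) X \<in> ks"
      using K.Adj_closed[OF K.S.inv_closed[OF Hs_in_Ks[OF l]] X] by (simp add: K.sub_inv Hs_in_Ks l)
    have "form (Ad l Y1 - ?Y) X = 0" by (rule form_ks[OF direct_sum_proj(4)[OF k_ks] X])
    then have "form ?Y X = form Y1 (Ad (inv\<^bsub>D\<^esub> l) X)" by (simp add: form_simps form_Ad_inv[OF l])
    also have "\<dots> = lfield Ks ex (Ad (inv\<^bsub>D\<^esub> l) X) f1 l" by (rule Y1(2)[OF A])
    finally show ?thesis by (simp add: K.rfield_eq_lfield[OF Hs_in_Ks[OF l] X])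
  qed
  have g: "grad Ks k ks form ex f1 l = ?Y"
    unfolding grad_def
  proof (rule the_equality)
    show "?Y \<in> k \<and> (\<forall>X\<in>ks. form ?Y X = rfield Ks ex X f1 l)" using Yk Y by blast
    show "Z = ?Y" if "Z \<in> k \<and> (\<forall>X\<in>ks. form Z X = rfield Ks ex X f1 l)" for Z
      by (rule uniq) (use that Yk Y in auto)
  qed
  show ?thesis unfolding dual_bracket_def g g' \<omega>_def ..
qed

text \<open>For \<open>Y1\<close> in \<open>h\<close> the vector \<open>Ad l Y1\<close> lies in
  \<open>h + hs\<close>, so its \<open>k\<close>-component belongs to \<open>h\<close> and serves as
  the gradient within the smaller double.\<close>

lemma bracket_Hs:
  assumes l: "l \<in> carrier Hs"
    and Y1: "Y1 \<in> h" "\<And>X. X \<in> hs \<Longrightarrow> form Y1 X = lfield Hs ex X f1 l"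
    and Y2: "Y2 \<in> h" "\<And>X. X \<in> hs \<Longrightarrow> form Y2 X = lfield Hs ex X f2 l"
  shows "dual_bracket D Hs h hs form ex f1 f2 l = \<omega> l Y1 Y2"
proof -
  have uniq: "Y = Y'" if "Y \<in> h" "Y' \<in> h" "\<And>X. X \<in> hs \<Longrightarrow> form Y X = form Y' X" for Y Y'
  proof -
    have "Y - Y' = 0" by (rule nondeg_h) (use that subspace_diff[OF sub(3)] in \<open>auto simp: form_simps\<close>)
    then show ?thesis by simp
  qed
  have g': "grad' Hs h hs form ex f2 l = Y2"
    unfolding grad'_def by (rule the_equality) (use Y2 uniq in auto)
  obtain a b where ab: "a \<in> h" "b \<in> hs" "Ad l Y1 = a + b" by (rule Ad_h[OF l Y1(1)])
  have a: "proj_along k ks (Ad l Y1) = a"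
    using direct_sum_proj(1)[OF k_ks h_k[OF ab(1)] hs_ks[OF ab(2)]] ab(3) by simp
  have Y: "form a X = rfield Hs ex X f1 l" if X: "X \<in> hs" for X
  proof -
    have A: "Ad (inv\<^bsub>D\<^esub> l) X \<in> hs"
      using H.Adj_closed[OF H.S.inv_closed[OF l] X] by (simp add: H.sub_inv l)
    have "form a X = form Y1 (Ad (inv\<^bsub>D\<^esub> l) X)"
      using form_ks[OF hs_ks[OF ab(2)] hs_ks[OF X]] by (simp add: form_simps form_Ad_inv[OF l] ab(3))
    also have "\<dots> = lfield Hs ex (Ad (inv\<^bsub>D\<^esub> l) X) f1 l" by (rule Y1(2)[OF A])
    finally show ?thesis by (simp add: H.rfield_eq_lfield[OF l X])
  qed
  have g: "grad Hs h hs form ex f1 l = a"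
    unfolding grad_def
  proof (rule the_equality)
    show "a \<in> h \<and> (\<forall>X\<in>hs. form a X = rfield Hs ex X f1 l)" using ab(1) Y by blast
    show "Z = a" if "Z \<in> h \<and> (\<forall>X\<in>hs. form Z X = rfield Hs ex X f1 l)" for Z
      by (rule uniq) (use that ab(1) Y in auto)
  qed
  show ?thesis unfolding dual_bracket_def g g' \<omega>_def a ..
qed

text \<open>The curve is continuous for the manifold topology of \<open>Hs\<close>, in which
  \<open>V\<close> is open. It is written with the product of \<open>Ks\<close> because constraints
  and extensions are differentiated there.\<close>

lemma eventually_Hs:
  assumes "openin (mfd_top (man Hs)) V" "l \<in> V" "X \<in> hs"
  shows "\<forall>\<^sub>F t in nhds (0::real). l \<otimes>\<^bsub>Ks\<^esub> ex (t *\<^sub>R X) \<in> V"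
proof -
  have l: "l \<in> carrier Hs" using openin_mfd_points[OF assms(1)] assms(2) H.S.points by auto
  let ?c = "\<lambda>t::real. l \<otimes>\<^bsub>Hs\<^esub> ex (t *\<^sub>R X)"
  have "open (?c -` V)"
    by (rule open_smooth_map_vimage[OF _ H.S.compatible assms(1)])
      (intro H.S.smooth_map_mult compatible_vec H.S.smooth_map_vec_constant l H.S.smooth_ex_curve assms(3))
  then have "\<forall>\<^sub>F t in nhds 0. t \<in> ?c -` V"
    by (rule eventually_nhds_in_open) (use l assms(2) in \<open>simp add: H.S.ex_zero\<close>)
  then show ?thesis
    by (rule eventually_mono)
      (use l H.sub_ex[OF assms(3)] in \<open>simp add: H.sub_mult K.sub_mult Hs_in_Ks\<close>)
qed

section \<open>Constraints and extensions in coordinates around the submanifold\<close>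

lemma local_constraintsE:
  assumes "local_constraints Ks Hs ex form m ms M N U \<xi>"
  obtains V B where "openin (mfd_top (man Hs)) V" "openin (top_of_set ms) B" "0 \<in> B"
    "inj_on (\<lambda>(l, \<mu>). l \<otimes>\<^bsub>Ks\<^esub> ex \<mu>) (V \<times> B)" "openin (mfd_top (man Ks)) U"
    "smooth_map (man Ks) U (man Hs) (base_point Ks ex V B)"
    "\<forall>X\<in>m. smooth_fun (man Ks) U (constraint Ks ex form V B X)"
    "U \<inter> N = V" "\<xi> = (\<lambda>i. constraint Ks ex form V B (M i))"
  using assms unfolding local_constraints_def by blast

text \<open>Injectivity of the coordinate map makes the descriptions in \<open>constraint\<close>
  and \<open>base_point\<close> determinate.\<close>

lemma tube_unique:
  assumes "inj_on (\<lambda>(l, \<mu>). l \<otimes>\<^bsub>Ks\<^esub> ex \<mu>) (V \<times> B)" "l \<in> V" "\<mu> \<in> B"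
  shows "constraint Ks ex form V B X (l \<otimes>\<^bsub>Ks\<^esub> ex \<mu>) = form \<mu> X" "base_point Ks ex V B (l \<otimes>\<^bsub>Ks\<^esub> ex \<mu>) = l"
proof -
  have uniq: "l' = l \<and> \<mu>' = \<mu>" if "l' \<in> V" "\<mu>' \<in> B" "l \<otimes>\<^bsub>Ks\<^esub> ex \<mu> = l' \<otimes>\<^bsub>Ks\<^esub> ex \<mu>'" for l' \<mu>'
    using inj_onD[OF assms(1), of "(l, \<mu>)" "(l', \<mu>')"] that assms(2,3) by simp
  have "(THE \<mu>'. \<mu>' \<in> B \<and> (\<exists>l'\<in>V. l \<otimes>\<^bsub>Ks\<^esub> ex \<mu> = l' \<otimes>\<^bsub>Ks\<^esub> ex \<mu>')) = \<mu>"
    by (rule the_equality) (use assms(2,3) uniq in blast)+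
  then show "constraint Ks ex form V B X (l \<otimes>\<^bsub>Ks\<^esub> ex \<mu>) = form \<mu> X" by (simp add: constraint_def)
  show "base_point Ks ex V B (l \<otimes>\<^bsub>Ks\<^esub> ex \<mu>) = l"
    unfolding base_point_def by (rule the_equality) (use assms(2,3) uniq in blast)+
qed

text \<open>Along \<open>h\<^sup>*\<close> the constraint vanishes identically and along \<open>m\<^sup>*\<close> it is linear, so its
  left gradient on \<open>H\<^sup>*\<close> is constant.\<close>

lemma lfield_constraint:
  assumes c: "local_constraints Ks Hs ex form m ms M N U \<xi>" and l: "l \<in> U" "l \<in> N"
    and M: "M i \<in> m" and X: "X \<in> ks"
  shows "lfield Ks ex X (\<xi> i) l = form (M i) X"
proof -
  obtain V B where V: "openin (mfd_top (man Hs)) V" "openin (top_of_set ms) B" "0 \<in> B"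
    "inj_on (\<lambda>(l, \<mu>). l \<otimes>\<^bsub>Ks\<^esub> ex \<mu>) (V \<times> B)" "openin (mfd_top (man Ks)) U"
    "smooth_map (man Ks) U (man Hs) (base_point Ks ex V B)"
    and sm: "\<forall>X\<in>m. smooth_fun (man Ks) U (constraint Ks ex form V B X)"
    and UV: "U \<inter> N = V" and \<xi>: "\<xi> = (\<lambda>i. constraint Ks ex form V B (M i))"
    by (rule local_constraintsE[OF c]) 
  have lV: "l \<in> V" using UV l by blast
  have lH: "l \<in> carrier Hs" using openin_mfd_points[OF V(1)] lV H.S.points by auto
  note tube = tube_unique(1)[OF V(4)]
  have on_hs: "lfield Ks ex X (\<xi> i) l = form (M i) X" if "X \<in> hs" for X
  proof -
    have "\<xi> i (l \<otimes>\<^bsub>Ks\<^esub> ex (t *\<^sub>R X)) = 0" if "l \<otimes>\<^bsub>Ks\<^esub> ex (t *\<^sub>R X) \<in> V" for t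
    proof -
      have "l \<otimes>\<^bsub>Ks\<^esub> ex (t *\<^sub>R X) \<in> carrier Ks"
        using openin_mfd_points[OF V(1)] that H.S.points Hs_in_Ks by auto
      \<comment> \<open>A point of \<open>V\<close> has second coordinate 0, as \<open>0\<close>
        lies in \<open>B\<close> and \<open>ex 0\<close> is the unit.\<close>
      then show ?thesis using tube[OF that V(3), of "M i"] by (simp add: \<xi> K.S.ex_zero form_simps)
    qed
    then have "deriv (\<lambda>t. \<xi> i (l \<otimes>\<^bsub>Ks\<^esub> ex (t *\<^sub>R X))) 0 = deriv (\<lambda>t::real. 0) (0::real)"
      by (intro deriv_cong_ev eventually_mono[OF eventually_Hs[OF V(1) lV \<open>X \<in> hs\<close>]]) auto
    then show ?thesis using form_m_hs(1)[OF M \<open>X \<in> hs\<close>] by (simp add: lfield_def)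
  qed
  have on_ms: "lfield Ks ex X (\<xi> i) l = form (M i) X" if "X \<in> ms" for X
  proof -
    obtain T where T: "open T" "B = ms \<inter> T" using V(2) unfolding openin_open by blast
    have "((\<lambda>t::real. t *\<^sub>R X) \<longlongrightarrow> 0 *\<^sub>R X) (nhds 0)" by (intro tendsto_scaleR filterlim_ident tendsto_const)
    then have "\<forall>\<^sub>F t::real in nhds 0. t *\<^sub>R X \<in> T"
      by (rule topological_tendstoD[OF _ T(1)]) (use V(3) T(2) in simp)
    then have "\<forall>\<^sub>F t::real in nhds 0. \<xi> i (l \<otimes>\<^bsub>Ks\<^esub> ex (t *\<^sub>R X)) = t * form (M i) X"
    proof (rule eventually_mono)
      fix t assume "t *\<^sub>R X \<in> T"
      then have "t *\<^sub>R X \<in> B" using T(2) subspace_scale[OF sub(6) that] by blast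
      then show "\<xi> i (l \<otimes>\<^bsub>Ks\<^esub> ex (t *\<^sub>R X)) = t * form (M i) X"
        using tube[OF lV, of "t *\<^sub>R X" "M i"] form_sym[of X "M i"] by (simp add: \<xi> form_simps)
    qed
    then have "deriv (\<lambda>t. \<xi> i (l \<otimes>\<^bsub>Ks\<^esub> ex (t *\<^sub>R X))) 0 = deriv (\<lambda>t. t * form (M i) X) 0"
      by (rule deriv_cong_ev) simp
    also have "\<dots> = form (M i) X" by (rule DERIV_imp_deriv) (auto intro!: derivative_eq_intros)
    finally show ?thesis by (simp add: lfield_def)
  qed
  obtain a b where ab: "a \<in> hs" "b \<in> ms" "X = a + b" by (rule ks_split[OF X])
  \<comment> \<open>Smoothness of the constraint makes its derivative additive in the direction,
    which joins the cases \<open>hs\<close> and \<open>ms\<close>.\<close>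
  have s: "smooth_fun (man Ks) U (\<xi> i)" unfolding \<xi> by (rule bspec[OF sm M])
  have "lfield Ks ex (1 *\<^sub>R a + 1 *\<^sub>R b) (\<xi> i) l = 1 * lfield Ks ex a (\<xi> i) l + 1 * lfield Ks ex b (\<xi> i) l"
    by (rule K.S.lfield_linear[OF hs_ks[OF ab(1)] ms_ks[OF ab(2)] s l(1)])
  then show ?thesis using on_hs[OF ab(1)] on_ms[OF ab(2)] by (simp add: ab(3) form_simps)
qed

text \<open>Composition with \<open>base_point\<close> extends \<open>F\<close> constantly in the
  direction of the second coordinate.\<close>

lemma extension_exists:
  assumes c: "local_constraints Ks Hs ex form m ms M N U \<xi>" and p: "p \<in> U" "p \<in> N"
    and F: "smooth_fun (man Hs) N F"
  shows "\<exists>W f. local_extension (man Ks) N F p W f"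
proof -
  obtain V B where V: "openin (mfd_top (man Hs)) V" "openin (top_of_set ms) B" "0 \<in> B"
    "inj_on (\<lambda>(l, \<mu>). l \<otimes>\<^bsub>Ks\<^esub> ex \<mu>) (V \<times> B)" "openin (mfd_top (man Ks)) U"
    and sm: "smooth_map (man Ks) U (man Hs) (base_point Ks ex V B)"
    and "\<forall>X\<in>m. smooth_fun (man Ks) U (constraint Ks ex form V B X)"
    and UV: "U \<inter> N = V" and "\<xi> = (\<lambda>i. constraint Ks ex form V B (M i))"
    by (rule local_constraintsE[OF c])
  have base: "base_point Ks ex V B l = l" if "l \<in> V" for l
  proof -
    have "l \<in> carrier Ks" using openin_mfd_points[OF V(1)] that H.S.points Hs_in_Ks by auto
    then show ?thesis using tube_unique(2)[OF V(4) that V(3)] by (simp add: K.S.ex_zero)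
  qed
  have "smooth_fun (man Ks) {x \<in> U. base_point Ks ex V B x \<in> N} (\<lambda>x. F (base_point Ks ex V B x))"
    by (rule smooth_fun_compose[OF sm K.S.compatible H.S.compatible V(5) F])
  then show ?thesis unfolding local_extension_def using p UV base
    by (intro exI[of _ "{x \<in> U. base_point Ks ex V B x \<in> N}"] exI[of _ "\<lambda>x. F (base_point Ks ex V B x)"]) auto
qed

text \<open>For small times the curve in a direction of \<open>hs\<close> stays in \<open>N\<close>,
  where \<open>f\<close> and \<open>F\<close> agree.\<close>

lemma lfield_extension:
  assumes N: "openin (mfd_top (man Hs)) N" and l: "l \<in> N"
    and ext: "local_extension (man Ks) N F l W f" and X: "X \<in> hs"
  shows "lfield Ks ex X f l = lfield Hs ex X F l"
proof -
  have W: "l \<in> W" "openin (mfd_top (man Ks)) W" "\<And>q. q \<in> W \<Longrightarrow> q \<in> N \<Longrightarrow> f q = F q"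
    using ext by (auto simp: local_extension_def smooth_fun_def)
  have lH: "l \<in> carrier Hs" using openin_mfd_points[OF N] l H.S.points by auto
  have "openin (mfd_top (man Hs)) {p \<in> carrier Hs. p \<in> W}"
    using openin_smooth_map_preimage[OF smooth_Hs_Ks H.S.compatible K.S.compatible H.S.open_carrier W(2)] .
  then have "\<forall>\<^sub>F t in nhds (0::real). l \<otimes>\<^bsub>Ks\<^esub> ex (t *\<^sub>R X) \<in> {p \<in> carrier Hs. p \<in> W}"
    by (rule eventually_Hs) (use lH W(1) X in auto)
  then have "\<forall>\<^sub>F t in nhds (0::real). f (l \<otimes>\<^bsub>Ks\<^esub> ex (t *\<^sub>R X)) = F (l \<otimes>\<^bsub>Hs\<^esub> ex (t *\<^sub>R X))"
    using eventually_Hs[OF N l X]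
    by eventually_elim (use W(3) lH H.sub_ex[OF X] in \<open>simp add: H.sub_mult K.sub_mult Hs_in_Ks\<close>)
  then show ?thesis unfolding lfield_def by (rule deriv_cong_ev) simp
qed

end

section \<open>Linear algebra of the Dirac correction\<close>

lemma basis_family_mem: "basis_family n M V \<Longrightarrow> i < n \<Longrightarrow> M i \<in> V"
  unfolding basis_family_def by (auto intro: span_base)

lemma basis_family_expansion:
  assumes "basis_family n M V" "Y \<in> V"
  obtains b where "Y = (\<Sum>i<n. b i *\<^sub>R M i)"
proof -
  have "Y \<in> span (M ` {..<n})" and inj: "inj_on M {..<n}" using assms by (auto simp: basis_family_def)
  then obtain u where "Y = (\<Sum>v\<in>M ` {..<n}. u v *\<^sub>R v)" by (auto simp: span_finite)
  then have "Y = (\<Sum>i<n. u (M i) *\<^sub>R M i)" by (simp add: sum.reindex[OF inj])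
  then show ?thesis by (rule that)
qed

text \<open>Contracting \<open>C'\<close> with the pairings of the \<open>M j\<close> with
  \<open>y\<close> recovers the coordinates \<open>b\<close> of \<open>y\<close>; the remaining sum
  rebuilds \<open>w x y\<close>.\<close>

lemma dirac_correction:
  assumes w: "bilinear (w :: 'd::real_vector \<Rightarrow> 'd \<Rightarrow> real)" and C': "inverse_matrix n (\<lambda>i j. w (M i) (M j)) C'"
    and y: "y = (\<Sum>i<n. b i *\<^sub>R M i)"
  shows "(\<Sum>i<n. \<Sum>j<n. w x (M i) * C' i j * w (M j) y) = w x y"
proof -
  have exp: "w x y = (\<Sum>l<n. w x (M l) * b l)" for x
  proof -
    have "linear (w x)" using w by (simp add: bilinear_def)
    then show ?thesis unfolding y by (simp add: linear_sum linear_scale mult.commute)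
  qed
  have "(\<Sum>j<n. C' i j * w (M j) y) = b i" if i: "i < n" for i
  proof -
    have "(\<Sum>j<n. C' i j * w (M j) y) = (\<Sum>j<n. \<Sum>l<n. C' i j * w (M j) (M l) * b l)"
      by (simp add: exp sum_distrib_left mult.assoc)
    also have "\<dots> = (\<Sum>l<n. (\<Sum>j<n. C' i j * w (M j) (M l)) * b l)"
      by (subst sum.swap) (simp add: sum_distrib_right)
    also have "\<dots> = (\<Sum>l<n. of_bool (i = l) * b l)"
      using C' i by (intro sum.cong refl) (simp add: inverse_matrix_def)
    also have "\<dots> = b i" using i by (simp add: of_bool_def if_distrib if_distribR cong: if_cong)
    finally show ?thesis .
  qed
  then have "(\<Sum>i<n. w x (M i) * (\<Sum>j<n. C' i j * w (M j) y)) = (\<Sum>i<n. w x (M i) * b i)" by simp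
  then show ?thesis by (simp add: exp[of x] sum_distrib_left mult.assoc)
qed

context dual_reduction
begin

lemma constraint_bracket:
  assumes c: "local_constraints Ks Hs ex form m ms M N U \<xi>" and l: "l \<in> U" "l \<in> N" "l \<in> carrier Hs"
    and M: "M i \<in> m" "M j \<in> m"
  shows "dual_bracket D Ks k ks form ex (\<xi> i) (\<xi> j) l = \<omega> l (M i) (M j)"
  using lfield_constraint[OF c l(1,2)] M by (intro bracket_Ks l(3) m_k) simp_all

lemma dirac_bracket_eq:
  assumes M: "basis_family n M m" and N: "openin (mfd_top (man Hs)) N" and p: "p \<in> N" "p \<in> U"
    and c: "local_constraints Ks Hs ex form m ms M N U \<xi>"
    and e1: "local_extension (man Ks) N F1 p W1 f1" and e2: "local_extension (man Ks) N F2 p W2 f2"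
    and C': "inverse_matrix n (\<lambda>i j. dual_bracket D Ks k ks form ex (\<xi> i) (\<xi> j) p) C'"
  shows "dual_bracket D Hs h hs form ex F1 F2 p = dirac_bracket (dual_bracket D Ks k ks form ex) n \<xi> C' f1 f2 p"
proof -
  have pH: "p \<in> carrier Hs" using openin_mfd_points[OF N] p H.S.points by auto
  note Mm = basis_family_mem[OF M]
  note \<omega> = bilinear_\<omega>[OF pH]
  have f: "smooth_fun (man Ks) W1 f1" "p \<in> W1" "smooth_fun (man Ks) W2 f2" "p \<in> W2"
    using e1 e2 by (auto simp: local_extension_def)
  obtain Y1 where Y1: "Y1 \<in> k" "\<And>X. X \<in> ks \<Longrightarrow> form Y1 X = lfield Ks ex X f1 p"
    by (rule gradient_exists[OF f(1,2)]) (rule that)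
  obtain Y2 where Y2: "Y2 \<in> k" "\<And>X. X \<in> ks \<Longrightarrow> form Y2 X = lfield Ks ex X f2 p"
    by (rule gradient_exists[OF f(3,4)]) (rule that)
  obtain A1 B1 where 1: "A1 \<in> h" "B1 \<in> m" "Y1 = A1 + B1" by (rule k_split[OF Y1(1)])
  obtain A2 B2 where 2: "A2 \<in> h" "B2 \<in> m" "Y2 = A2 + B2" by (rule k_split[OF Y2(1)])
  \<comment> \<open>The \<open>m\<close>-component of the gradient pairs to zero with
    \<open>hs\<close>, so only \<open>A1\<close> is tested there.\<close>
  have A1: "form A1 X = lfield Hs ex X F1 p" if "X \<in> hs" for X
    using Y1(2)[OF hs_ks[OF that]] lfield_extension[OF N p(1) e1 that] form_m_hs(1)[OF 1(2) that]
    by (simp add: 1(3) form_simps)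
  have A2: "form A2 X = lfield Hs ex X F2 p" if "X \<in> hs" for X
    using Y2(2)[OF hs_ks[OF that]] lfield_extension[OF N p(1) e2 that] form_m_hs(1)[OF 2(2) that]
    by (simp add: 2(3) form_simps)
  note \<omega>_simps = bilinear_ladd[OF \<omega>] bilinear_radd[OF \<omega>] \<omega>_h_m[OF pH]
  have \<xi>: "form (M i) X = lfield Ks ex X (\<xi> i) p" if "i < n" "X \<in> ks" for i X
    by (rule lfield_constraint[OF c p(2,1) Mm[OF that(1)] that(2), symmetric])
  have b1: "dual_bracket D Ks k ks form ex f1 (\<xi> i) p = \<omega> p B1 (M i)" if "i < n" for i
    using bracket_Ks[OF pH Y1 m_k[OF Mm[OF that]] \<xi>[OF that]] 1 Mm[OF that] by (simp add: \<omega>_simps)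
  have b2: "dual_bracket D Ks k ks form ex (\<xi> j) f2 p = \<omega> p (M j) B2" if "j < n" for j
    using bracket_Ks[OF pH m_k[OF Mm[OF that]] \<xi>[OF that] Y2] 2 Mm[OF that] by (simp add: \<omega>_simps)
  have "inverse_matrix n (\<lambda>i j. \<omega> p (M i) (M j)) C'"
    using C' constraint_bracket[OF c p(2,1) pH Mm Mm] by (simp add: inverse_matrix_def)
  moreover obtain b where "B2 = (\<Sum>i<n. b i *\<^sub>R M i)" by (rule basis_family_expansion[OF M 2(2)])
  ultimately have "(\<Sum>i<n. \<Sum>j<n. \<omega> p B1 (M i) * C' i j * \<omega> p (M j) B2) = \<omega> p B1 B2"
    by (rule dirac_correction[OF \<omega>])
  then have "dirac_bracket (dual_bracket D Ks k ks form ex) n \<xi> C' f1 f2 p = \<omega> p Y1 Y2 - \<omega> p B1 B2"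
    unfolding dirac_bracket_def using bracket_Ks[OF pH Y1 Y2] by (simp add: b1 b2)
  also have "\<dots> = \<omega> p A1 A2" using 1 2 by (simp add: \<omega>_simps)
  also have "\<dots> = dual_bracket D Hs h hs form ex F1 F2 p"
    by (rule bracket_Hs[OF pH 1(1) A1 2(1) A2, symmetric])
  finally show ?thesis by simp
qed

end

theorem theorem3p4:
  fixes D K Ks H Hs :: "('a, 'e::euclidean_space) lgroup"
    and br :: "'d::real_normed_vector \<Rightarrow> 'd \<Rightarrow> 'd" and form :: "'d \<Rightarrow> 'd \<Rightarrow> real"
    and ex :: "'d \<Rightarrow> 'a" and k ks h m hs ms :: "'d set"
    and pbK :: "('a \<Rightarrow> real) \<Rightarrow> ('a \<Rightarrow> real) \<Rightarrow> 'a \<Rightarrow> real"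
    and n :: nat and M :: "nat \<Rightarrow> 'd" and Hc :: "'a set"
    and pbKs pbHs :: "('a \<Rightarrow> real) \<Rightarrow> ('a \<Rightarrow> real) \<Rightarrow> 'a \<Rightarrow> real"
    and cons :: "'a set \<Rightarrow> (nat \<Rightarrow> 'a \<Rightarrow> real) \<Rightarrow> bool"
  assumes pbKs: "pbKs = dual_bracket D Ks k ks form ex"
    and pbHs: "pbHs = dual_bracket D Hs h hs form ex"
    and cons: "cons = local_constraints Ks Hs ex form m ms M Hc"
    and double: "drinfeld_double br form k ks"
    and D: "lie_group D" "has_lie_algebra D UNIV br ex"
    and K: "lie_subgroup K D" "has_lie_algebra K k br ex" "connected_lgroup K"
      "poisson_lie_group K pbK" "linearization K pbK k ks form br ex"
    and Ks: "lie_subgroup Ks D" "has_lie_algebra Ks ks br ex" "poisson_lie_group Ks pbKs"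
    and H: "poisson_lie_subgroup H K pbK" "has_lie_algebra H h br ex" "connected_lgroup H"
    and decomp: "direct_sum h m k"
    and hs: "hs = annihilator form ks m" and ms: "ms = annihilator form ks h"
    and hs_subalgebra: "\<forall>\<alpha>\<in>hs. \<forall>\<beta>\<in>hs. br \<alpha> \<beta> \<in> hs"
    and ms_ideal: "\<forall>\<alpha>\<in>ks. \<forall>\<beta>\<in>ms. br \<alpha> \<beta> \<in> ms"
    and reductive: "\<forall>X\<in>h. \<forall>Y\<in>m. br X Y \<in> m"
    and Hs: "lie_subgroup Hs Ks" "has_lie_algebra Hs hs br ex" "connected_lgroup Hs"
    and M: "basis_family n M m"
    and Hc: "openin (mfd_top (man Hs)) Hc" "\<forall>l\<in>Hc. \<exists>U \<xi>. l \<in> U \<and> cons U \<xi>"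
  shows "(\<forall>U \<xi> l. cons U \<xi> \<and> l \<in> U \<inter> Hc \<longrightarrow>
           (\<forall>i<n. \<forall>j<n. pbKs (\<xi> i) (\<xi> j) l
              = form (proj_along ms (span (h \<union> m \<union> hs)) (Adj D ex l (M j)))
                     (proj_along m (span (h \<union> hs \<union> ms)) (Adj D ex l (M i)))))
       \<and> ((\<forall>U \<xi> l. cons U \<xi> \<and> l \<in> U \<inter> Hc \<longrightarrow>
             (\<exists>C'. inverse_matrix n (\<lambda>i j. pbKs (\<xi> i) (\<xi> j) l) C'))
          \<longrightarrow> dirac_reduction (man Ks) pbKs n cons (man Hs) Hc pbHs)"
proof -
  interpret dual_reduction D Ks Hs br form ex k ks h m hs ms
  proof
    show KsD: "carrier Ks \<subseteq> carrier D" using Ks(1) by (simp add: lie_subgroup_def subgroup.subset)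
    show HsKs: "carrier Hs \<subseteq> carrier Ks" using Hs(1) by (simp add: lie_subgroup_def subgroup.subset)
    show "carrier Hs \<subseteq> carrier D" using HsKs KsD by (rule subset_trans)
    show "smooth_map (man Ks) (carrier Ks) (man D) (\<lambda>x. x)"
      by (rule lie_subgroup_smooth[OF Ks(1)])
    show sm: "smooth_map (man Hs) (carrier Hs) (man Ks) (\<lambda>x. x)"
      by (rule lie_subgroup_smooth[OF Hs(1)])
    \<comment> \<open>\<open>Hs\<close> is given as a Lie subgroup of \<open>Ks\<close>, so its
      inclusion into \<open>D\<close> is obtained as a composite.\<close>
    show "smooth_map (man Hs) (carrier Hs) (man D) (\<lambda>x. x)"
      by (rule smooth_map_compose[OF sm lie_subgroup_smooth[OF Ks(1)]])
        (use Hs(1) HsKs in \<open>auto simp: lie_subgroup_def lie_group_def intro!: manifold_compatible\<close>)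
    show "lie_group Ks" "lie_group Hs" using Ks(1) Hs(1) by (auto simp: lie_subgroup_def)
    show "x \<otimes>\<^bsub>Ks\<^esub> y = x \<otimes>\<^bsub>D\<^esub> y" if "x \<in> carrier Ks" "y \<in> carrier Ks" for x y
      using Ks(1) that by (auto simp: lie_subgroup_def)
    then show "x \<otimes>\<^bsub>Hs\<^esub> y = x \<otimes>\<^bsub>D\<^esub> y" if "x \<in> carrier Hs" "y \<in> carrier Hs" for x y
      using Hs(1) that HsKs by (simp add: lie_subgroup_def subset_iff)
  qed (use assms in auto)
  have carrier: "l \<in> carrier Hs" if "l \<in> Hc" for l
    using openin_mfd_points[OF Hc(1)] that H.S.points by auto
  have 1: "pbKs (\<xi> i) (\<xi> j) l = form (proj_along ms (span (h \<union> m \<union> hs)) (Adj D ex l (M j)))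
      (proj_along m (span (h \<union> hs \<union> ms)) (Adj D ex l (M i)))"
    if "cons U \<xi>" "l \<in> U \<inter> Hc" "i < n" "j < n" for U \<xi> l i j
  proof -
    have c: "local_constraints Ks Hs ex form m ms M Hc U \<xi>" using that(1) cons by simp
    have l: "l \<in> U" "l \<in> Hc" "l \<in> carrier Hs" using that(2) carrier by auto
    note Mm = basis_family_mem[OF M that(3)] basis_family_mem[OF M that(4)]
    show ?thesis unfolding pbKs constraint_bracket[where \<xi>=\<xi>, OF c l Mm] by (rule \<omega>_m[OF l(3) Mm])
  qed
  have 2: "dirac_reduction (man Ks) pbKs n cons (man Hs) Hc pbHs"
    unfolding dirac_reduction_def
  proof (intro conjI allI impI)
    fix F p assume F: "smooth_fun (man Hs) Hc F \<and> p \<in> Hc"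
    then obtain U \<xi> where U: "p \<in> U" "local_constraints Ks Hs ex form m ms M Hc U \<xi>"
      using Hc(2) unfolding cons by blast
    show "\<exists>W f. local_extension (man Ks) Hc F p W f"
      by (rule extension_exists[OF U(2,1) conjunct2[OF F] conjunct1[OF F]])
  next
    fix F1 F2 p U \<xi> W1 f1 W2 f2 C'
    assume "smooth_fun (man Hs) Hc F1 \<and> smooth_fun (man Hs) Hc F2 \<and> p \<in> Hc \<and> p \<in> U \<and> cons U \<xi> \<and>
       local_extension (man Ks) Hc F1 p W1 f1 \<and> local_extension (man Ks) Hc F2 p W2 f2 \<and>
       inverse_matrix n (\<lambda>i j. pbKs (\<xi> i) (\<xi> j) p) C'"
    then show "pbHs F1 F2 p = dirac_bracket pbKs n \<xi> C' f1 f2 p"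
      unfolding pbKs pbHs cons by (elim conjE) (rule dirac_bracket_eq[OF M Hc(1)])
  qed
  show ?thesis using 1 2 by blast
qed

end
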